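(* Let $A\Rightarrow M$ be a Lie algebroid with an IM connection $(\mathcal C,v)\in\mathcal A(A;\mathfrak k)$ for a bundle of ideals $\mathfrak k$. The horizontal projection of Weil cochains $h^*\colon W^{p,q}(A;\mathfrak k)\to W^{p,q}(A;\mathfrak k)^{\mathrm{Hor}}$ is a cochain map, that is, $$h^*\delta=\delta h^*$$ (for all $p,q\ge0$).
   Context: $\rho$ is the anchor of $A$. A bundle of ideals is a vector subbundle $\mathfrak k\subset\ker\rho\subset A$ with $[\Gamma(A),\Gamma(\mathfrak k)]\subset\Gamma(\mathfrak k)$. $W^{p,q}(A;\mathfrak k)$ is the set of sequences $c=(c_0,\dots,c_p)$ of $\mathbb R$-multilinear alternating maps $c_k\colon\Gamma(A)^{p-k}\to\Omega^{q-k}(M;S^k(A^* )\otimes\mathfrak k)$ (negative-degree forms are zero), written $c_k(\alpha_1,\dots,\alpha_{p-k}|\beta_1,\dots,\beta_k)\in\Omega^{q-k}(M;\mathfrak k)$, with $c_k(f\alpha_1,\alpha_2,\dots|\cdot)=fc_k(\alpha_1,\alpha_2,\dots|\cdot)+\mathrm df\wedge c_{k+1}(\alpha_2,\dots|\alpha_1,\cdot)$; $c_{-1}=c_{p+1}=0$. $c$ is horizontal, $c\in W^{p,q}(A;\mathfrak k)^{\mathrm{Hor}}$, if $c_i(\cdot|\xi,\cdot)=0$ for all $i\ge1$ and $\xi\in\Gamma(\mathfrak k)$. For $\gamma\in\Omega^m(M;S^n(A^* )\otimes\mathfrak k)$: $(\mathcal L^A_\alpha\gamma)(\underline\beta)(\underline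 X)=[\alpha,\gamma(\underline\beta)(\underline X)]-\sum_i\gamma(\dots,[\alpha,\beta_i],\dots)(\underline X)-\sum_j\gamma(\underline\beta)(\dots,[\rho(\alpha),X_j],\dots)$. Simplicial differential $\delta\colon W^{p,q}\to W^{p+1,q}$: $$(-1)^k(\delta c)_k(\alpha_0,\dots,\alpha_{p-k}|\underline\beta)=\sum_i(-1)^i\mathcal L^A_{\alpha_i}\big(c_k(\dots,\widehat{\alpha_i},\dots|\cdot)\big)(\underline\beta)+\sum_{i<j}(-1)^{i+j}c_k([\alpha_i,\alpha_j],\dots,\widehat{\alpha_i},\dots,\widehat{\alpha_j},\dots|\underline\beta)-\sum_{j=1}^k\iota_{\rho(\beta_j)}c_{k-1}(\underline\alpha|\beta_1,\dots,\widehat{\beta_j},\dots,\beta_k).$$ An IM connection is $(\mathcal C,v)\in\ker\delta\subset W^{1,1}(A;\mathfrak k)$ ($\mathcal C=c_0$, $v=c_1\colon A\to\mathfrak k$) with $v|_{\mathfrak k}=\mathrm{id}_{\mathfrak k}$; the set of these is $\mathcal A(A;\mathfrak k)$. Put $h=\mathrm{id}_A-v$. For $\gamma\in\Omega^m(M;S^j(A^* )\otimes\mathfrak k)$ and $\vartheta_1,\dots,\vartheta_\ell\in\Omega^1(M;\mathfrak k)$, $\ell\le j$, let $$\big(\gamma\dot\wedge(\vartheta_1,\dots,\vartheta_\ell)\big)(\cdot)(X_1,\dots,X_{m+\ell})=\tfrac1{m!}\sum_{\sigma\in S_{m+\ell}}\mathrm{sgn}(\sigma)\,\gamma\big(\vartheta_1(X_{\sigma(1)}),\dots,\vartheta_\ell(X_{\sigma(\ell)}),\cdot\big)(X_{\sigma(\ell+1)},\dots,X_{\sigma(\ell+m)}).$$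 The horizontal projection is, for $0\le k\le p$, $$(h^*c)_k(\alpha_1,\dots,\alpha_{p-k}|\beta_1,\dots,\beta_k)=\sum_{j=k}^p(-1)^{j-k}\sum_{\sigma\in S_{(j-k,p-j)}}\mathrm{sgn}(\sigma)\,c_j(\alpha_{\sigma(j-k+1)},\dots,\alpha_{\sigma(p-k)}|h\beta_1,\dots,h\beta_k,\cdot)\dot\wedge(\mathcal C\alpha_{\sigma(1)},\dots,\mathcal C\alpha_{\sigma(j-k)}),$$ where $S_{(a,b)}$ is the set of $(a,b)$-shuffles. *)

theory Defs
  imports
    "HOL-Analysis.Analysis"
    "HOL-Library.Function_Algebras"
    "HOL-Combinatorics.Permutations"
begin

section \<open>Smooth manifolds\<close>

text \<open>
  \<open>\<real>\<^sup>n\<close> is the library's \<open>Euclidean_space n\<close>: real sequences that vanish from index \<open>n\<close> on.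
  \<open>Ck n k V f\<close>: on the open set \<open>V\<close> of \<open>\<real>\<^sup>n\<close>, all iterated partial derivatives of \<open>f\<close>
  of order at most \<open>k\<close> exist and are continuous.
\<close>

primrec Ck :: "nat \<Rightarrow> nat \<Rightarrow> (nat \<Rightarrow> real) set \<Rightarrow> ((nat \<Rightarrow> real) \<Rightarrow> real) \<Rightarrow> bool" where
  "Ck n 0 V f \<longleftrightarrow> continuous_map (subtopology (Euclidean_space n) V) euclideanreal f"
| "Ck n (Suc k) V f \<longleftrightarrow>
     continuous_map (subtopology (Euclidean_space n) V) euclideanreal f \<and>
     (\<forall>i<n. (\<forall>x\<in>V. (\<lambda>t. f (x(i := t))) field_differentiable at (x i)) \<and>
            Ck n k V (\<lambda>x. deriv (\<lambda>t. f (x(i := t))) (x i)))"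

definition Csmooth :: "nat \<Rightarrow> (nat \<Rightarrow> real) set \<Rightarrow> ((nat \<Rightarrow> real) \<Rightarrow> real) \<Rightarrow> bool" where
  "Csmooth n V f \<longleftrightarrow> (\<forall>k. Ck n k V f)"

text \<open>The underlying set of the manifold is the whole type \<open>'m\<close>; a chart is its domain together
  with the coordinate map.\<close>

record 'm manifold =
  mdim :: nat
  charts :: "('m set \<times> ('m \<Rightarrow> nat \<Rightarrow> real)) set"

definition smooth_manifold ::
    "('m::{second_countable_topology,t2_space}, 'z) manifold_scheme \<Rightarrow> bool" where
  "smooth_manifold M \<longleftrightarrow>
     (\<forall>(U, \<phi>)\<in>charts M. open U \<and> openin (Euclidean_space (mdim M)) (\<phi> ` U) \<and>
        homeomorphic_map (top_of_set U) (subtopology (Euclidean_space (mdim M)) (\<phi> ` U)) \<phi>) \<and>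
     (\<Union>(U, \<phi>)\<in>charts M. U) = UNIV \<and>
     (\<forall>(U, \<phi>)\<in>charts M. \<forall>(V, \<psi>)\<in>charts M. \<forall>i<mdim M.
        Csmooth (mdim M) (\<phi> ` (U \<inter> V)) (\<lambda>x. \<psi> (inv_into U \<phi> x) i))"

definition smooth_funs :: "('m, 'z) manifold_scheme \<Rightarrow> 'm set \<Rightarrow> ('m \<Rightarrow> real) set" where
  "smooth_funs M W =
     {f. \<forall>(U, \<phi>)\<in>charts M. Csmooth (mdim M) (\<phi> ` (U \<inter> W)) (\<lambda>x. f (inv_into U \<phi> x))}"

abbreviation Cinf :: "('m, 'z) manifold_scheme \<Rightarrow> ('m \<Rightarrow> real) set" where
  "Cinf M \<equiv> smooth_funs M UNIV"

text \<open>Tangent vectors at \<open>p\<close> are the derivations of \<open>C\<^sup>\<infinity>(M)\<close> at \<open>p\<close>; being total HOL functions,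
  they are set to \<open>0\<close> on non-smooth arguments.\<close>

definition tangent_space :: "('m, 'z) manifold_scheme \<Rightarrow> 'm \<Rightarrow> (('m \<Rightarrow> real) \<Rightarrow> real) set" where
  "tangent_space M p = {D.
     (\<forall>f. f \<notin> Cinf M \<longrightarrow> D f = 0) \<and>
     (\<forall>f\<in>Cinf M. \<forall>g\<in>Cinf M. D (f + g) = D f + D g \<and> D (f * g) = f p * D g + g p * D f) \<and>
     (\<forall>f\<in>Cinf M. \<forall>a::real. D (\<lambda>x. a * f x) = a * D f)}"

type_synonym 'm vfield = "'m \<Rightarrow> ('m \<Rightarrow> real) \<Rightarrow> real"

definition vfields :: "('m, 'z) manifold_scheme \<Rightarrow> 'm vfield set" where
  "vfields M = {X. (\<forall>p. X p \<in> tangent_space M p) \<and> (\<forall>f\<in>Cinf M. (\<lambda>p. X p f) \<in> Cinf M)}"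

definition vf_bracket :: "'m vfield \<Rightarrow> 'm vfield \<Rightarrow> 'm vfield" where
  "vf_bracket X Y = (\<lambda>p f. X p (\<lambda>x. Y x f) - Y p (\<lambda>x. X x f))"

text \<open>Sums, differences and zero of sections and of vector fields are pointwise
  (theory \<open>Function_Algebras\<close>); the following are the multiplications by functions.\<close>

definition scale_sec :: "('m \<Rightarrow> real) \<Rightarrow> ('m \<Rightarrow> 'a::real_vector) \<Rightarrow> 'm \<Rightarrow> 'a" where
  "scale_sec f s = (\<lambda>p. f p *\<^sub>R s p)"

definition scale_vf :: "('m \<Rightarrow> real) \<Rightarrow> 'm vfield \<Rightarrow> 'm vfield" where
  "scale_vf f X = (\<lambda>p g. f p * X p g)"

abbreviation rscale :: "real \<Rightarrow> ('m \<Rightarrow> 'a::real_vector) \<Rightarrow> 'm \<Rightarrow> 'a" where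
  "rscale a s \<equiv> scale_sec (\<lambda>_. a) s"


section \<open>Vector bundles\<close>

text \<open>
  The fibres are linear subspaces of an arbitrary real vector space \<open>'a\<close>, which carries no topology:
  the smooth structure is given by the local frames \<open>(U, e)\<close>, where \<open>e 0 p, \<dots>, e (r - 1) p\<close> is
  a basis of the fibre over \<open>p \<in> U\<close> (equivalently, by local trivializations). Any family of
  abstract fibres embeds in its direct sum, so this is no restriction.
\<close>

record ('m, 'a) vbundle = "'m manifold" +
  fibre :: "'m \<Rightarrow> 'a set"
  brank :: nat
  frames :: "('m set \<times> (nat \<Rightarrow> 'm \<Rightarrow> 'a)) set"

definition frame_basis :: "(nat \<Rightarrow> 'a::real_vector) \<Rightarrow> nat \<Rightarrow> 'a set \<Rightarrow> bool" where
  "frame_basis b r E \<longleftrightarrow> inj_on b {..<r} \<and> independent (b ` {..<r}) \<and> span (b ` {..<r}) = E"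

definition local_sections ::
    "('m, 'a::real_vector, 'z) vbundle_scheme \<Rightarrow> 'm set \<Rightarrow> ('m \<Rightarrow> 'a) set" where
  "local_sections E W = {s. (\<forall>p\<in>W. s p \<in> fibre E p) \<and>
     (\<forall>(U, e)\<in>frames E. \<exists>a. (\<forall>i<brank E. a i \<in> smooth_funs E (U \<inter> W)) \<and>
        (\<forall>p\<in>U \<inter> W. s p = (\<Sum>i<brank E. a i p *\<^sub>R e i p)))}"

abbreviation sections :: "('m, 'a::real_vector, 'z) vbundle_scheme \<Rightarrow> ('m \<Rightarrow> 'a) set" where
  "sections E \<equiv> local_sections E UNIV"

definition vector_bundle ::
    "('m::{second_countable_topology,t2_space}, 'a::real_vector, 'z) vbundle_scheme \<Rightarrow> bool" where
  "vector_bundle E \<longleftrightarrow> smooth_manifold E \<and>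
     (\<forall>(U, e)\<in>frames E. open U \<and> (\<forall>p\<in>U. frame_basis (\<lambda>i. e i p) (brank E) (fibre E p)) \<and>
        (\<forall>i<brank E. e i \<in> local_sections E U)) \<and>
     (\<Union>(U, e)\<in>frames E. U) = UNIV"

definition subbundle ::
    "('m::{second_countable_topology,t2_space}, 'a::real_vector, 'z) vbundle_scheme
      \<Rightarrow> ('m \<Rightarrow> 'a set) \<Rightarrow> bool" where
  "subbundle E K \<longleftrightarrow> (\<forall>p. K p \<subseteq> fibre E p) \<and>
     (\<exists>d\<le>brank E. \<forall>p. \<exists>U e. open U \<and> p \<in> U \<and>
        (\<forall>i<brank E. e i \<in> local_sections E U) \<and>
        (\<forall>x\<in>U. frame_basis (\<lambda>i. e i x) (brank E) (fibre E x) \<and>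
               frame_basis (\<lambda>i. e i x) d (K x)))"

definition sub_sections ::
    "('m, 'a::real_vector, 'z) vbundle_scheme \<Rightarrow> ('m \<Rightarrow> 'a set) \<Rightarrow> ('m \<Rightarrow> 'a) set" where
  "sub_sections E K = {s \<in> sections E. \<forall>p. s p \<in> K p}"


section \<open>Lie algebroids and bundles of ideals\<close>

record ('m, 'a) algebroid = "('m, 'a) vbundle" +
  anchor :: "'m \<Rightarrow> 'a \<Rightarrow> ('m \<Rightarrow> real) \<Rightarrow> real"
  brk :: "('m \<Rightarrow> 'a) \<Rightarrow> ('m \<Rightarrow> 'a) \<Rightarrow> 'm \<Rightarrow> 'a"

definition rho :: "('m, 'a, 'z) algebroid_scheme \<Rightarrow> ('m \<Rightarrow> 'a) \<Rightarrow> 'm vfield" where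
  "rho A \<alpha> = (\<lambda>p. anchor A p (\<alpha> p))"

text \<open>Compatibility of the anchor with the brackets follows from the Jacobi and Leibniz identities;
  as in many texts it is listed among the axioms.\<close>

definition lie_algebroid ::
    "('m::{second_countable_topology,t2_space}, 'a::real_vector, 'z) algebroid_scheme \<Rightarrow> bool" where
  "lie_algebroid A \<longleftrightarrow> vector_bundle A \<and>
     (\<forall>p. \<forall>u\<in>fibre A p. \<forall>v\<in>fibre A p. \<forall>a::real. anchor A p u \<in> tangent_space A p \<and>
        anchor A p (u + v) = anchor A p u + anchor A p v \<and>
        anchor A p (a *\<^sub>R u) = (\<lambda>f. a * anchor A p u f)) \<and>
     (\<forall>\<alpha>\<in>sections A. rho A \<alpha> \<in> vfields A) \<and>
     (\<forall>\<alpha>\<in>sections A. \<forall>\<beta>\<in>sections A. brk A \<alpha> \<beta> \<in> sections A) \<and>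
     (\<forall>\<alpha>\<in>sections A. \<forall>\<beta>\<in>sections A. \<forall>\<gamma>\<in>sections A. \<forall>a.
        brk A (\<alpha> + \<beta>) \<gamma> = brk A \<alpha> \<gamma> + brk A \<beta> \<gamma> \<and>
        brk A \<gamma> (\<alpha> + \<beta>) = brk A \<gamma> \<alpha> + brk A \<gamma> \<beta> \<and>
        brk A (rscale a \<alpha>) \<beta> = rscale a (brk A \<alpha> \<beta>) \<and>
        brk A \<alpha> (rscale a \<beta>) = rscale a (brk A \<alpha> \<beta>)) \<and>
     (\<forall>\<alpha>\<in>sections A. brk A \<alpha> \<alpha> = 0) \<and>
     (\<forall>\<alpha>\<in>sections A. \<forall>\<beta>\<in>sections A. \<forall>\<gamma>\<in>sections A.
        brk A \<alpha> (brk A \<beta> \<gamma>) + brk A \<beta> (brk A \<gamma> \<alpha>) + brk A \<gamma> (brk A \<alpha> \<beta>) = 0) \<and>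
     (\<forall>\<alpha>\<in>sections A. \<forall>\<beta>\<in>sections A. \<forall>f\<in>Cinf A.
        brk A \<alpha> (scale_sec f \<beta>) = scale_sec f (brk A \<alpha> \<beta>) + scale_sec (\<lambda>p. rho A \<alpha> p f) \<beta>) \<and>
     (\<forall>\<alpha>\<in>sections A. \<forall>\<beta>\<in>sections A. rho A (brk A \<alpha> \<beta>) = vf_bracket (rho A \<alpha>) (rho A \<beta>))"

definition bundle_of_ideals ::
    "('m::{second_countable_topology,t2_space}, 'a::real_vector, 'z) algebroid_scheme
      \<Rightarrow> ('m \<Rightarrow> 'a set) \<Rightarrow> bool" where
  "bundle_of_ideals A K \<longleftrightarrow> subbundle A K \<and>
     (\<forall>p. \<forall>v\<in>K p. anchor A p v = 0) \<and>
     (\<forall>\<alpha>\<in>sections A. \<forall>\<xi>\<in>sub_sections A K. brk A \<alpha> \<xi> \<in> sub_sections A K)"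


section \<open>Multilinear maps on tuples\<close>

definition tuples :: "nat \<Rightarrow> 'x set \<Rightarrow> 'x list set" where
  "tuples n S = {xs. length xs = n \<and> set xs \<subseteq> S}"

definition omit :: "nat \<Rightarrow> 'x list \<Rightarrow> 'x list" where
  "omit i xs = take i xs @ drop (Suc i) xs"

text \<open>Multilinearity over a ring \<open>R\<close> of functions acting on the arguments by \<open>sm\<close>;
  for \<open>\<real>\<close>-multilinear maps, \<open>R\<close> is the set of constant functions.\<close>

definition multilinear_on ::
    "('m \<Rightarrow> real) set \<Rightarrow> (('m \<Rightarrow> real) \<Rightarrow> 'x \<Rightarrow> 'x) \<Rightarrow> 'x::plus set \<Rightarrow> nat
      \<Rightarrow> ('x list \<Rightarrow> 'm \<Rightarrow> 'a::real_vector) \<Rightarrow> bool" where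
  "multilinear_on R sm S n F \<longleftrightarrow>
     (\<forall>xs\<in>tuples n S. \<forall>i<n. \<forall>x\<in>S. \<forall>y\<in>S. \<forall>f\<in>R.
        F (xs[i := x + y]) = F (xs[i := x]) + F (xs[i := y]) \<and>
        F (xs[i := sm f x]) = scale_sec f (F (xs[i := x])))"

definition alternating_on :: "'x set \<Rightarrow> nat \<Rightarrow> ('x list \<Rightarrow> 'y::zero) \<Rightarrow> bool" where
  "alternating_on S n F \<longleftrightarrow>
     (\<forall>xs\<in>tuples n S. \<forall>i j. i < j \<and> j < n \<and> xs ! i = xs ! j \<longrightarrow> F xs = 0)"

definition symmetric_on :: "'x set \<Rightarrow> nat \<Rightarrow> ('x list \<Rightarrow> 'y) \<Rightarrow> bool" where
  "symmetric_on S n F \<longleftrightarrow>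
     (\<forall>xs\<in>tuples n S. \<forall>ys\<in>tuples n S. mset ys = mset xs \<longrightarrow> F ys = F xs)"

type_synonym ('m, 'a) symform = "('m \<Rightarrow> 'a) list \<Rightarrow> 'm vfield list \<Rightarrow> 'm \<Rightarrow> 'a"

text \<open>\<open>\<Omega>\<^sup>m(M; S\<^sup>n(A\<^sup>*) \<otimes> \<kk>)\<close>, as \<open>C\<^sup>\<infinity>(M)\<close>-multilinear maps on
  sections of \<open>A\<close> and vector fields (tensor characterization lemma).\<close>

definition forms ::
    "('m, 'a::real_vector, 'z) algebroid_scheme \<Rightarrow> ('m \<Rightarrow> 'a set) \<Rightarrow> nat \<Rightarrow> nat
      \<Rightarrow> ('m, 'a) symform set" where
  "forms A K m n = {\<gamma>.
     (\<forall>\<beta>s\<in>tuples n (sections A). \<forall>Xs\<in>tuples m (vfields A). \<gamma> \<beta>s Xs \<in> sub_sections A K) \<and>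
     (\<forall>Xs\<in>tuples m (vfields A).
        multilinear_on (Cinf A) scale_sec (sections A) n (\<lambda>\<beta>s. \<gamma> \<beta>s Xs) \<and>
        symmetric_on (sections A) n (\<lambda>\<beta>s. \<gamma> \<beta>s Xs)) \<and>
     (\<forall>\<beta>s\<in>tuples n (sections A).
        multilinear_on (Cinf A) scale_vf (vfields A) m (\<gamma> \<beta>s) \<and>
        alternating_on (vfields A) m (\<gamma> \<beta>s))}"

definition df_wedge :: "('m \<Rightarrow> real) \<Rightarrow> ('m, 'a::real_vector) symform \<Rightarrow> ('m, 'a) symform" where
  "df_wedge f \<gamma> \<beta>s Xs =
     (\<Sum>i<length Xs. scale_sec (\<lambda>p. (-1) ^ i * (Xs ! i) p f) (\<gamma> \<beta>s (omit i Xs)))"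

definition lieD ::
    "('m, 'a::real_vector, 'z) algebroid_scheme \<Rightarrow> ('m \<Rightarrow> 'a) \<Rightarrow> ('m, 'a) symform
      \<Rightarrow> ('m, 'a) symform" where
  "lieD A \<alpha> \<gamma> \<beta>s Xs =
     brk A \<alpha> (\<gamma> \<beta>s Xs)
     - (\<Sum>i<length \<beta>s. \<gamma> (\<beta>s[i := brk A \<alpha> (\<beta>s ! i)]) Xs)
     - (\<Sum>j<length Xs. \<gamma> \<beta>s (Xs[j := vf_bracket (rho A \<alpha>) (Xs ! j)]))"

text \<open>\<open>dot_wedge m \<gamma> \<theta>s\<close> is \<open>\<gamma> \<and> (\<theta>\<^sub>1, \<dots>, \<theta>\<^sub>\<ell>)\<close> with the wedge dotted,
  for \<open>\<gamma>\<close> of form degree \<open>m\<close>.\<close>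

definition dot_wedge ::
    "nat \<Rightarrow> ('m, 'a::real_vector) symform \<Rightarrow> ('m vfield \<Rightarrow> 'm \<Rightarrow> 'a) list
      \<Rightarrow> ('m, 'a) symform" where
  "dot_wedge m \<gamma> \<theta>s \<beta>s Xs =
     (let l = length \<theta>s in
      rscale (1 / fact m)
       (\<Sum>\<sigma> | \<sigma> permutes {..<m + l}. rscale (of_int (sign \<sigma>))
          (\<gamma> (map (\<lambda>i. (\<theta>s ! i) (Xs ! \<sigma> i)) [0..<l] @ \<beta>s) (map (\<lambda>i. Xs ! \<sigma> i) [l..<l + m]))))"

definition shuffles :: "nat \<Rightarrow> nat \<Rightarrow> (nat \<Rightarrow> nat) set" where
  "shuffles a b =
     {\<sigma>. \<sigma> permutes {..<a + b} \<and> strict_mono_on {..<a} \<sigma> \<and> strict_mono_on {a..<a + b} \<sigma>}"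


section \<open>Weil cochains\<close>

text \<open>
  \<open>c k [\<alpha>\<^sub>1, \<dots>, \<alpha>\<^sub>p\<^sub>-\<^sub>k] [\<beta>\<^sub>1, \<dots>, \<beta>\<^sub>k] [X\<^sub>1, \<dots>, X\<^sub>q\<^sub>-\<^sub>k]\<close> is
  \<open>c\<^sub>k(\<alpha>\<^sub>1, \<dots> | \<beta>\<^sub>1, \<dots>)(X\<^sub>1, \<dots>)\<close>. Cochains are \<open>0\<close> outside \<open>weil_dom\<close>, so that
  equality of cochains is equality in HOL; \<open>k \<le> p\<close> encodes \<open>c\<^sub>p\<^sub>+\<^sub>1 = 0\<close>, and
  \<open>k \<le> q\<close> that forms of negative degree vanish.
\<close>

type_synonym ('m, 'a) cochain = "nat \<Rightarrow> ('m \<Rightarrow> 'a) list \<Rightarrow> ('m, 'a) symform"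

definition weil_dom ::
    "('m, 'a::real_vector, 'z) algebroid_scheme \<Rightarrow> nat \<Rightarrow> nat \<Rightarrow> nat
      \<Rightarrow> ('m \<Rightarrow> 'a) list \<Rightarrow> ('m \<Rightarrow> 'a) list \<Rightarrow> 'm vfield list \<Rightarrow> bool" where
  "weil_dom A p q k \<alpha>s \<beta>s Xs \<longleftrightarrow> k \<le> p \<and> k \<le> q \<and>
     \<alpha>s \<in> tuples (p - k) (sections A) \<and> \<beta>s \<in> tuples k (sections A) \<and> Xs \<in> tuples (q - k) (vfields A)"

definition weil ::
    "('m, 'a::real_vector, 'z) algebroid_scheme \<Rightarrow> ('m \<Rightarrow> 'a set) \<Rightarrow> nat \<Rightarrow> nat
      \<Rightarrow> ('m, 'a) cochain set" where
  "weil A K p q = {c.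
     (\<forall>k \<alpha>s \<beta>s Xs. \<not> weil_dom A p q k \<alpha>s \<beta>s Xs \<longrightarrow> c k \<alpha>s \<beta>s Xs = 0) \<and>
     (\<forall>k. k \<le> p \<and> k \<le> q \<longrightarrow>
        (\<forall>\<alpha>s\<in>tuples (p - k) (sections A). c k \<alpha>s \<in> forms A K (q - k) k) \<and>
        (\<forall>\<beta>s\<in>tuples k (sections A). \<forall>Xs\<in>tuples (q - k) (vfields A).
           multilinear_on (range (\<lambda>a _. a)) scale_sec (sections A) (p - k) (\<lambda>\<alpha>s. c k \<alpha>s \<beta>s Xs) \<and>
           alternating_on (sections A) (p - k) (\<lambda>\<alpha>s. c k \<alpha>s \<beta>s Xs))) \<and>
     (\<forall>k f \<alpha> \<alpha>s \<beta>s Xs. f \<in> Cinf A \<and> k < p \<and> weil_dom A p q k (\<alpha> # \<alpha>s) \<beta>s Xs \<longrightarrow>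
        c k (scale_sec f \<alpha> # \<alpha>s) \<beta>s Xs =
          scale_sec f (c k (\<alpha> # \<alpha>s) \<beta>s Xs)
          + df_wedge f (\<lambda>\<beta>s. c (Suc k) \<alpha>s (\<alpha> # \<beta>s)) \<beta>s Xs)}"

definition weil_hor ::
    "('m, 'a::real_vector, 'z) algebroid_scheme \<Rightarrow> ('m \<Rightarrow> 'a set) \<Rightarrow> nat \<Rightarrow> nat
      \<Rightarrow> ('m, 'a) cochain set" where
  "weil_hor A K p q = {c \<in> weil A K p q.
     \<forall>i \<alpha>s \<beta>s Xs. \<forall>\<xi>\<in>sub_sections A K. i \<ge> 1 \<longrightarrow> c i \<alpha>s (\<xi> # \<beta>s) Xs = 0}"

definition delta ::
    "('m, 'a::real_vector, 'z) algebroid_scheme \<Rightarrow> nat \<Rightarrow> nat \<Rightarrow> ('m, 'a) cochain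
      \<Rightarrow> ('m, 'a) cochain" where
  "delta A p q c k \<alpha>s \<beta>s Xs =
     (if weil_dom A (Suc p) q k \<alpha>s \<beta>s Xs then
        rscale ((-1) ^ k)
         ((\<Sum>i<length \<alpha>s. rscale ((-1) ^ i) (lieD A (\<alpha>s ! i) (c k (omit i \<alpha>s)) \<beta>s Xs))
          + (\<Sum>j<length \<alpha>s. \<Sum>i<j. rscale ((-1) ^ (i + j))
               (c k (brk A (\<alpha>s ! i) (\<alpha>s ! j) # omit i (omit j \<alpha>s)) \<beta>s Xs))
          - (\<Sum>j<k. c (k - 1) \<alpha>s (omit j \<beta>s) (rho A (\<beta>s ! j) # Xs)))
      else 0)"

definition im_connections ::
    "('m, 'a::real_vector, 'z) algebroid_scheme \<Rightarrow> ('m \<Rightarrow> 'a set) \<Rightarrow> ('m, 'a) cochain set" where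
  "im_connections A K =
     {w \<in> weil A K 1 1. delta A 1 1 w = 0 \<and> (\<forall>\<xi>\<in>sub_sections A K. w 1 [] [\<xi>] [] = \<xi>)}"

text \<open>The components \<open>\<C>\<close> and \<open>v\<close> of an IM connection, and \<open>h = id - v\<close> on sections.\<close>

definition conn_C :: "('m, 'a) cochain \<Rightarrow> ('m \<Rightarrow> 'a) \<Rightarrow> 'm vfield \<Rightarrow> 'm \<Rightarrow> 'a" where
  "conn_C w \<alpha> X = w 0 [\<alpha>] [] [X]"

definition conn_v :: "('m, 'a) cochain \<Rightarrow> ('m \<Rightarrow> 'a) \<Rightarrow> 'm \<Rightarrow> 'a" where
  "conn_v w \<beta> = w 1 [] [\<beta>] []"

definition conn_h :: "('m, 'a::real_vector) cochain \<Rightarrow> ('m \<Rightarrow> 'a) \<Rightarrow> 'm \<Rightarrow> 'a" where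
  "conn_h w \<beta> = \<beta> - conn_v w \<beta>"

text \<open>The summation stops at \<open>min p q\<close> because \<open>c\<^sub>j = 0\<close> for \<open>j > q\<close>. Indices are shifted to
  start from \<open>0\<close>.\<close>

definition hor_proj ::
    "('m, 'a::real_vector, 'z) algebroid_scheme \<Rightarrow> ('m, 'a) cochain \<Rightarrow> nat \<Rightarrow> nat
      \<Rightarrow> ('m, 'a) cochain \<Rightarrow> ('m, 'a) cochain" where
  "hor_proj A w p q c k \<alpha>s \<beta>s Xs =
     (if weil_dom A p q k \<alpha>s \<beta>s Xs then
        \<Sum>j = k..min p q. rscale ((-1) ^ (j - k))
          (\<Sum>\<sigma>\<in>shuffles (j - k) (p - j). rscale (of_int (sign \<sigma>))
             (dot_wedge (q - j)
                (\<lambda>\<gamma>s. c j (map (\<lambda>i. \<alpha>s ! \<sigma> i) [j - k..<p - k]) (map (conn_h w) \<beta>s @ \<gamma>s))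
                (map (\<lambda>i. conn_C w (\<alpha>s ! \<sigma> i)) [0..<j - k])
                [] Xs))
      else 0)"

end

theory Submission
  imports Defs "Jordan_Normal_Form.Determinant"
begin

text \<open>
  The pair \<open>(C, v)\<close> acts on the arguments of a Weil cochain by the projection
  \<open>\<alpha> \<mapsto> C \<alpha>\<close>, \<open>\<beta> \<mapsto> v \<beta>\<close> onto the vertical part. Let \<open>N\<close> be the derivation that replaces one
  argument at a time by its projection. It counts vertical arguments: its kernel consists of the
  horizontal cochains, and the cochain \<open>u = \<Prod>\<^sub>r (1 - N / r) c\<close>, \<open>r = 1, \<dots>, p\<close>, is
  horizontal and congruent to \<open>c\<close> modulo the image of \<open>N\<close>. As \<open>h\<^sup>*\<close> is the identity on horizontal
  cochains and \<open>h\<^sup>* N = 0\<close>, this gives \<open>h\<^sup>* c = u\<close>; and if \<open>N\<close> commutes with \<open>\<delta>\<close>, then \<open>\<delta> u\<close> is again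
  horizontal and \<open>h\<^sup>* \<delta> c = \<delta> u = \<delta> h\<^sup>* c\<close>.

  For \<open>N \<delta> = \<delta> N\<close>, let \<open>\<iota>\<^sub>\<alpha>\<close> be the contraction and let \<open>\<kappa>\<^sub>\<alpha>\<close> insert \<open>C \<alpha>\<close> into a symmetric slot. Then
  \<open>\<iota>\<^sub>\<alpha> \<delta> + \<delta> \<iota>\<^sub>\<alpha> = \<L>\<^sub>\<alpha>\<close> and \<open>\<iota>\<^sub>\<alpha> N - N \<iota>\<^sub>\<alpha> = \<kappa>\<^sub>\<alpha>\<close>, and \<open>\<delta> (C, v) = 0\<close> yields
  \<open>\<L>\<^sub>\<alpha> N - N \<L>\<^sub>\<alpha> = \<kappa>\<^sub>\<alpha> \<delta> + \<delta> \<kappa>\<^sub>\<alpha>\<close>; the claim follows by induction on the number of arguments.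
\<close>

text \<open>The shuffle formula shows neither that its values are Weil cochains nor how it meets
  \<delta>: \<alpha> \<mapsto> C \<alpha> is not linear over functions, and it moves an argument
  from the alternating to the symmetric slots at the cost of a vector field. The detour through
  \<open>N\<close> avoids both computations. As \<open>u\<close> is a polynomial in \<open>N\<close>
  applied to \<open>c\<close>, the Leibniz rule has to be checked for \<open>N\<close> alone, where
  it comes down to C (f \<alpha>) = f C \<alpha> + df v(\<alpha>). For \<delta> itself only
  additivity, symmetry and alternation are carried along; this is why linearity is always relative
  to a set of scalars, which is the ring of functions for \<open>N\<close> and empty for \<delta>.
  The factors 1 - N / r have this form because \<open>N\<close> multiplies by \<open>r\<close> on
  exactly \<open>r\<close> vertical arguments, as long as \<open>r + 1\<close> of them give zero; so
  each factor lowers by one the number of vertical arguments that can be nonzero. The same count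
  shows the converse, that the kernel of \<open>N\<close> is horizontal, and hence that \<delta>
  preserves horizontal cochains.\<close>

instantiation "fun" :: (type, real_vector) real_vector
begin

text \<open>Sections, forms and cochains are functions, so pointwise scaling makes each of them a
  real vector space to which \<open>linear\<close> and \<open>subspace\<close> apply.\<close>

definition scaleR_fun :: "real \<Rightarrow> ('a \<Rightarrow> 'b) \<Rightarrow> 'a \<Rightarrow> 'b" where
  "scaleR_fun a f = (\<lambda>x. a *\<^sub>R f x)"

instance
  by standard (auto simp: scaleR_fun_def fun_eq_iff algebra_simps)

end

section \<open>Sums over argument lists\<close>

text \<open>Recursion on the list allows identities between such sums to be proved by induction on the
  arguments; the closed forms are \<open>asum_index\<close>, \<open>ssum_index\<close> and \<open>dsum_index\<close>.\<close>

primrec asum :: "'x list \<Rightarrow> ('x \<Rightarrow> 'x list \<Rightarrow> 'v::real_vector) \<Rightarrow> 'v" where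
  "asum [] F = 0"
| "asum (x # xs) F = F x xs - asum xs (\<lambda>y ys. F y (x # ys))"

primrec ssum :: "'x list \<Rightarrow> ('x \<Rightarrow> 'x list \<Rightarrow> 'v::real_vector) \<Rightarrow> 'v" where
  "ssum [] F = 0"
| "ssum (x # xs) F = F x xs + ssum xs (\<lambda>y ys. F y (x # ys))"

primrec dsum :: "'x list \<Rightarrow> ('x \<Rightarrow> 'x) \<Rightarrow> ('x list \<Rightarrow> 'v::real_vector) \<Rightarrow> 'v" where
  "dsum [] \<phi> F = 0"
| "dsum (x # xs) \<phi> F = F (\<phi> x # xs) + dsum xs \<phi> (\<lambda>ys. F (x # ys))"

text \<open>Many identities between cochains hold only for arguments in the carrier, so rewriting
  under a list sum has to remember that the entries stay there. The length of the remaining list is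
  supplied for signs that depend on it.\<close>

lemma asum_cong:
  assumes "set xs \<subseteq> V"
    and "\<And>y ys. y \<in> V \<Longrightarrow> set ys \<subseteq> V \<Longrightarrow> Suc (length ys) = length xs \<Longrightarrow> F y ys = G y ys"
  shows "asum xs F = asum xs G"
  using assms
proof (induction xs arbitrary: F G)
  case (Cons x xs)
  have "asum xs (\<lambda>y ys. F y (x # ys)) = asum xs (\<lambda>y ys. G y (x # ys))"
    by (rule Cons.IH) (use Cons.prems in auto)
  then show ?case using Cons.prems by auto
qed simp

lemma ssum_cong:
  assumes "set xs \<subseteq> V"
    and "\<And>y ys. y \<in> V \<Longrightarrow> set ys \<subseteq> V \<Longrightarrow> Suc (length ys) = length xs \<Longrightarrow> F y ys = G y ys"
  shows "ssum xs F = ssum xs G"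
  using assms
proof (induction xs arbitrary: F G)
  case (Cons x xs)
  have "ssum xs (\<lambda>y ys. F y (x # ys)) = ssum xs (\<lambda>y ys. G y (x # ys))"
    by (rule Cons.IH) (use Cons.prems in auto)
  then show ?case using Cons.prems by auto
qed simp

lemma dsum_cong:
  assumes "set xs \<subseteq> V" and "\<And>y. y \<in> V \<Longrightarrow> \<phi> y \<in> V"
    and "\<And>ys. set ys \<subseteq> V \<Longrightarrow> length ys = length xs \<Longrightarrow> F ys = G ys"
  shows "dsum xs \<phi> F = dsum xs \<phi> G"
  using assms
proof (induction xs arbitrary: F G)
  case (Cons x xs)
  have "dsum xs \<phi> (\<lambda>ys. F (x # ys)) = dsum xs \<phi> (\<lambda>ys. G (x # ys))"
    by (rule Cons.IH) (use Cons.prems in auto)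
  then show ?case using Cons.prems by auto
qed simp

lemma dsum_fun_cong:
  assumes "set xs \<subseteq> V" and "\<And>y. y \<in> V \<Longrightarrow> \<phi> y = \<psi> y"
  shows "dsum xs \<phi> F = dsum xs \<psi> F"
  using assms by (induction xs arbitrary: F) auto

lemma asum_zero [simp]: "asum xs (\<lambda>_ _. 0) = 0"
  by (induction xs) auto

lemma ssum_zero [simp]: "ssum xs (\<lambda>_ _. 0) = 0"
  by (induction xs) auto

lemma dsum_zero [simp]: "dsum xs \<phi> (\<lambda>_. 0) = 0"
  by (induction xs) auto

lemma asum_add: "asum xs (\<lambda>y ys. F y ys + G y ys) = asum xs F + asum xs G"
  by (induction xs arbitrary: F G) auto

lemma ssum_add: "ssum xs (\<lambda>y ys. F y ys + G y ys) = ssum xs F + ssum xs G"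
  by (induction xs arbitrary: F G) auto

lemma dsum_add: "dsum xs \<phi> (\<lambda>ys. F ys + G ys) = dsum xs \<phi> F + dsum xs \<phi> G"
  by (induction xs arbitrary: F G) auto

lemma asum_linear:
  assumes "linear f"
  shows "asum xs (\<lambda>y ys. f (F y ys)) = f (asum xs F)"
  by (induction xs arbitrary: F) (auto simp: linear_0[OF assms] linear_diff[OF assms])

lemma ssum_linear:
  assumes "linear f"
  shows "ssum xs (\<lambda>y ys. f (F y ys)) = f (ssum xs F)"
  by (induction xs arbitrary: F) (auto simp: linear_0[OF assms] linear_add[OF assms])

lemma dsum_linear:
  assumes "linear f"
  shows "dsum xs \<phi> (\<lambda>ys. f (F ys)) = f (dsum xs \<phi> F)"
  by (induction xs arbitrary: F) (auto simp: linear_0[OF assms] linear_add[OF assms])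

lemmas asum_scaleR = asum_linear[OF linear_scaleR]
lemmas ssum_scaleR = ssum_linear[OF linear_scaleR]
lemmas dsum_scaleR = dsum_linear[OF linear_scaleR]

lemma asum_minus: "asum xs (\<lambda>y ys. - F y ys) = - asum xs F"
  using asum_scaleR[of xs "-1" F] by simp

lemma ssum_minus: "ssum xs (\<lambda>y ys. - F y ys) = - ssum xs F"
  using ssum_scaleR[of xs "-1" F] by simp

lemma dsum_minus: "dsum xs \<phi> (\<lambda>ys. - F ys) = - dsum xs \<phi> F"
  using dsum_scaleR[of xs \<phi> "-1" F] by simp

lemma asum_diff: "asum xs (\<lambda>y ys. F y ys - G y ys) = asum xs F - asum xs G"
  using asum_add[of xs F "\<lambda>y ys. - G y ys"] by (simp add: asum_minus)

lemma ssum_diff: "ssum xs (\<lambda>y ys. F y ys - G y ys) = ssum xs F - ssum xs G"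
  using ssum_add[of xs F "\<lambda>y ys. - G y ys"] by (simp add: ssum_minus)

lemma dsum_diff: "dsum xs \<phi> (\<lambda>ys. F ys - G ys) = dsum xs \<phi> F - dsum xs \<phi> G"
  using dsum_add[of xs \<phi> F "\<lambda>ys. - G ys"] by (simp add: dsum_minus)

lemmas lsum_simps = asum_add ssum_add dsum_add asum_scaleR ssum_scaleR dsum_scaleR
  asum_minus ssum_minus dsum_minus asum_diff ssum_diff dsum_diff

text \<open>Replacing an entry keeps the length, so the sign is constant; \<open>ssum_sign\<close>
  is the counterpart where one entry is removed.\<close>

lemma dsum_sign: "dsum xs \<phi> (\<lambda>ys. (-1) ^ length ys *\<^sub>R F ys) = (-1) ^ length xs *\<^sub>R dsum xs \<phi> F"
  unfolding dsum_scaleR[symmetric] by (rule dsum_cong[where V = UNIV]) auto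

text \<open>The sign is that of moving the selected entry past \<open>us\<close>. The append rules
  isolate one argument in the middle of a list, as linearity and the exchange of neighbours
  require.\<close>

lemma asum_append:
  "asum (us @ xs) F =
    asum us (\<lambda>y ys. F y (ys @ xs)) + (-1) ^ length us *\<^sub>R asum xs (\<lambda>y ys. F y (us @ ys))"
  by (induction us arbitrary: F) auto

lemma ssum_append:
  "ssum (us @ xs) F = ssum us (\<lambda>y ys. F y (ys @ xs)) + ssum xs (\<lambda>y ys. F y (us @ ys))"
  by (induction us arbitrary: F) auto

lemma dsum_append:
  "dsum (us @ xs) \<phi> F = dsum us \<phi> (\<lambda>ys. F (ys @ xs)) + dsum xs \<phi> (\<lambda>ys. F (us @ ys))"
  by (induction us arbitrary: F) auto

lemma asum_in:
  assumes "subspace K" "set xs \<subseteq> V"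
    and "\<And>y ys. y \<in> V \<Longrightarrow> set ys \<subseteq> V \<Longrightarrow> F y ys \<in> K"
  shows "asum xs F \<in> K"
  using assms(2,3)
  by (induction xs arbitrary: F) (auto intro!: subspace_diff[OF assms(1)] subspace_0[OF assms(1)])

lemma ssum_in:
  assumes "subspace K" "set xs \<subseteq> V"
    and "\<And>y ys. y \<in> V \<Longrightarrow> set ys \<subseteq> V \<Longrightarrow> F y ys \<in> K"
  shows "ssum xs F \<in> K"
  using assms(2,3)
  by (induction xs arbitrary: F) (auto intro!: subspace_add[OF assms(1)] subspace_0[OF assms(1)])

lemma dsum_in:
  assumes "subspace K" "set xs \<subseteq> V" and "\<And>y. y \<in> V \<Longrightarrow> \<phi> y \<in> V"
    and "\<And>ys. set ys \<subseteq> V \<Longrightarrow> F ys \<in> K"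
  shows "dsum xs \<phi> F \<in> K"
  using assms(2,4)
  by (induction xs arbitrary: F)
    (auto intro!: subspace_add[OF assms(1)] subspace_0[OF assms(1)] simp: assms(3))

section \<open>Interchanging two list sums\<close>

lemma asum_asum_swap:
  "asum xs (\<lambda>x xs. asum xs (F x)) = - asum xs (\<lambda>x xs. asum xs (\<lambda>y. F y x))"
proof (induction xs arbitrary: F)
  case (Cons x xs)
  show ?case
    using Cons.IH[of "\<lambda>y z zs. F y z (x # zs)"] by (simp add: lsum_simps)
qed simp

lemma asum_asum_commute:
  "asum as (\<lambda>a as. asum xs (F a as)) = asum xs (\<lambda>x xs. asum as (\<lambda>a as. F a as x xs))"
proof (induction as arbitrary: F)
  case (Cons a as)
  show ?case
    using Cons.IH[of "\<lambda>y ys. F y (a # ys)"] by (simp add: lsum_simps)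
qed simp

lemma dsum_asum_commute:
  "dsum bs \<phi> (\<lambda>bs. asum xs (F bs)) = asum xs (\<lambda>x xs. dsum bs \<phi> (\<lambda>bs. F bs x xs))"
proof (induction bs arbitrary: F)
  case (Cons b bs)
  show ?case
    using Cons.IH[of "\<lambda>ys. F (b # ys)"] by (simp add: lsum_simps)
qed simp

lemma ssum_asum_commute:
  "ssum bs (\<lambda>b bs. asum xs (F b bs)) = asum xs (\<lambda>x xs. ssum bs (\<lambda>b bs. F b bs x xs))"
proof (induction bs arbitrary: F)
  case (Cons b bs)
  show ?case
    using Cons.IH[of "\<lambda>y ys. F y (b # ys)"] by (simp add: lsum_simps)
qed simp

lemma dsum_dsum_commute:
  "dsum bs \<phi> (\<lambda>bs. dsum xs \<psi> (F bs)) = dsum xs \<psi> (\<lambda>xs. dsum bs \<phi> (\<lambda>bs. F bs xs))"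
proof (induction bs arbitrary: F)
  case (Cons b bs)
  show ?case
    using Cons.IH[of "\<lambda>ys. F (b # ys)"] by (simp add: lsum_simps)
qed simp

text \<open>The modified entry either is the selected one or belongs to the rest.\<close>

lemma dsum_asum:
  "dsum xs \<phi> (\<lambda>xs. asum xs F) = asum xs (\<lambda>x xs. F (\<phi> x) xs + dsum xs \<phi> (F x))"
proof (induction xs arbitrary: F)
  case (Cons x xs)
  show ?case
    using Cons.IH[of "\<lambda>y ys. F y (x # ys)"] by (simp add: lsum_simps)
qed simp

lemma dsum_ssum:
  "dsum xs \<phi> (\<lambda>xs. ssum xs F) = ssum xs (\<lambda>x xs. F (\<phi> x) xs + dsum xs \<phi> (F x))"
proof (induction xs arbitrary: F)
  case (Cons x xs)
  show ?case
    using Cons.IH[of "\<lambda>y ys. F y (x # ys)"] by (simp add: lsum_simps)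
qed simp

text \<open>Modifications at two different positions commute and cancel, which leaves the commutator
  of the two maps at a single position.\<close>

lemma dsum_dsum_diff:
  "dsum xs \<phi> (\<lambda>xs. dsum xs \<psi> F) - dsum xs \<psi> (\<lambda>xs. dsum xs \<phi> F) =
    dsum xs (\<psi> \<circ> \<phi>) F - dsum xs (\<phi> \<circ> \<psi>) F"
proof (induction xs arbitrary: F)
  case (Cons x xs)
  show ?case
    using Cons.IH[of "\<lambda>ys. F (x # ys)"] by (simp add: lsum_simps algebra_simps)
qed simp

section \<open>Alternating, symmetric and multilinear maps\<close>

text \<open>Exchanges of neighbours suffice (see \<open>alt_on_repeat\<close> and
  \<open>symm_on_mset\<close>) and are accessible to the append rules. No number of arguments is
  fixed, since a raw cochain takes lists of every length.\<close>

definition alt_on :: "'x set \<Rightarrow> ('x list \<Rightarrow> 'v::real_vector) \<Rightarrow> bool" where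
  "alt_on V F \<longleftrightarrow> (\<forall>us vs. set us \<subseteq> V \<longrightarrow> set vs \<subseteq> V \<longrightarrow> (\<forall>x\<in>V. \<forall>y\<in>V.
     F (us @ x # y # vs) = - F (us @ y # x # vs)))"

definition symm_on :: "'x set \<Rightarrow> ('x list \<Rightarrow> 'v::real_vector) \<Rightarrow> bool" where
  "symm_on V F \<longleftrightarrow> (\<forall>us vs. set us \<subseteq> V \<longrightarrow> set vs \<subseteq> V \<longrightarrow> (\<forall>x\<in>V. \<forall>y\<in>V.
     F (us @ x # y # vs) = F (us @ y # x # vs)))"

text \<open>Additivity is always required, and \<open>R\<close> only says which scalars can be
  pulled out. For \<open>R = {}\<close> this is additivity alone, the form of linearity that is
  carried through the differential.\<close>

definition lin_on :: "'f set \<Rightarrow> ('f \<Rightarrow> 'x \<Rightarrow> 'x) \<Rightarrow> ('f \<Rightarrow> 'v \<Rightarrow> 'v) \<Rightarrow> 'x::plus set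
    \<Rightarrow> ('x \<Rightarrow> 'v::real_vector) \<Rightarrow> bool" where
  "lin_on R sm sc V \<phi> \<longleftrightarrow> (\<forall>x\<in>V. \<forall>y\<in>V. \<phi> (x + y) = \<phi> x + \<phi> y) \<and>
     (\<forall>f\<in>R. \<forall>x\<in>V. \<phi> (sm f x) = sc f (\<phi> x))"

definition mlin_on :: "'f set \<Rightarrow> ('f \<Rightarrow> 'x \<Rightarrow> 'x) \<Rightarrow> ('f \<Rightarrow> 'v \<Rightarrow> 'v) \<Rightarrow> 'x::plus set
    \<Rightarrow> ('x list \<Rightarrow> 'v::real_vector) \<Rightarrow> bool" where
  "mlin_on R sm sc V F \<longleftrightarrow>
     (\<forall>us vs. set us \<subseteq> V \<longrightarrow> set vs \<subseteq> V \<longrightarrow> (lin_on R sm sc V (\<lambda>x. F (us @ x # vs))))"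

section \<open>Exchanging arguments at a distance\<close>

lemma symm_on_move:
  assumes "symm_on V F" "set us \<subseteq> V" "set ws \<subseteq> V" "set vs \<subseteq> V" "x \<in> V"
  shows "F (us @ ws @ x # vs) = F (us @ x # ws @ vs)"
  using assms(2,3)
proof (induction ws arbitrary: us)
  case (Cons w ws)
  have "F (us @ (w # ws) @ x # vs) = F ((us @ [w]) @ x # ws @ vs)"
    using Cons.IH[of "us @ [w]"] Cons.prems by simp
  also have "\<dots> = F (us @ x # w # ws @ vs)"
    using assms(1)[unfolded symm_on_def, rule_format, of us "ws @ vs" w x] Cons.prems assms by simp
  finally show ?case by simp
qed simp

text \<open>The head of \<open>xs\<close> is located in \<open>ys\<close> and moved to the front
  there by \<open>symm_on_move\<close>.\<close>

lemma symm_on_mset: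
  assumes "symm_on V F" "set xs \<subseteq> V" "set ys \<subseteq> V" "mset xs = mset ys"
  shows "F xs = F ys"
proof -
  \<comment> \<open>The prefix \<open>us\<close> holds the entries that are already matched; without
    it the induction could not go below the head.\<close>
  have "F (us @ xs) = F (us @ ys)" if "set us \<subseteq> V" for us
    using assms(2-4) that
  proof (induction xs arbitrary: us ys)
    case (Cons x xs)
    then obtain ws vs where ys: "ys = ws @ x # vs"
      by (metis list.set_intros(1) set_mset_mset split_list)
    have "F (us @ x # xs) = F ((us @ [x]) @ ws @ vs)"
      using Cons.IH[of "ws @ vs" "us @ [x]"] Cons.prems ys by simp
    also have "\<dots> = F (us @ ys)"
      using symm_on_move[OF assms(1), of us ws vs x] Cons.prems ys by simp
    finally show ?case by simp
  qed simp
  from this[of "[]"] show ?thesis by simp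
qed

lemma alt_on_move:
  assumes "alt_on V F" "set us \<subseteq> V" "set ws \<subseteq> V" "set vs \<subseteq> V" "x \<in> V"
  shows "F (us @ ws @ x # vs) = (-1) ^ length ws *\<^sub>R F (us @ x # ws @ vs)"
  using assms(2,3)
proof (induction ws arbitrary: us)
  case (Cons w ws)
  have "F (us @ (w # ws) @ x # vs) = (-1) ^ length ws *\<^sub>R F ((us @ [w]) @ x # ws @ vs)"
    using Cons.IH[of "us @ [w]"] Cons.prems by simp
  also have "F ((us @ [w]) @ x # ws @ vs) = - F (us @ x # w # ws @ vs)"
    using assms(1)[unfolded alt_on_def, rule_format, of us "ws @ vs" w x] Cons.prems assms by simp
  finally show ?case by simp
qed simp

text \<open>The second copy of \<open>x\<close> is moved next to the first; exchanging the two then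
  gives a value equal to its own negative.\<close>

lemma alt_on_repeat:
  assumes "alt_on V F" "set us \<subseteq> V" "set ws \<subseteq> V" "set vs \<subseteq> V" "x \<in> V"
  shows "F (us @ x # ws @ x # vs) = 0"
proof -
  have "F ((us @ [x]) @ ws @ x # vs) = (-1) ^ length ws *\<^sub>R F (us @ x # x # ws @ vs)"
    using alt_on_move[OF assms(1), of "us @ [x]" ws vs x] assms by simp
  moreover have "F (us @ x # x # ws @ vs) = - F (us @ x # x # ws @ vs)"
    using assms(1)[unfolded alt_on_def, rule_format, of us "ws @ vs" x x] assms by simp
  then have "F (us @ x # x # ws @ vs) = 0"
    by (simp add: eq_neg_iff_add_eq_0 flip: scaleR_2)
  ultimately show ?thesis by simp
qed

lemma alt_onI:
  assumes "\<And>us vs x y. set us \<subseteq> V \<Longrightarrow> set vs \<subseteq> V \<Longrightarrow> x \<in> V \<Longrightarrow> y \<in> V \<Longrightarrow>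
    F (us @ x # y # vs) = - F (us @ y # x # vs)"
  shows "alt_on V F"
  using assms unfolding alt_on_def by blast

lemma alt_onD:
  assumes "alt_on V F" "set us \<subseteq> V" "set vs \<subseteq> V" "x \<in> V" "y \<in> V"
  shows "F (us @ x # y # vs) = - F (us @ y # x # vs)"
  using assms unfolding alt_on_def by blast

lemma symm_onI:
  assumes "\<And>us vs x y. set us \<subseteq> V \<Longrightarrow> set vs \<subseteq> V \<Longrightarrow> x \<in> V \<Longrightarrow> y \<in> V \<Longrightarrow>
    F (us @ x # y # vs) = F (us @ y # x # vs)"
  shows "symm_on V F"
  using assms unfolding symm_on_def by blast

lemma symm_onD:
  assumes "symm_on V F" "set us \<subseteq> V" "set vs \<subseteq> V" "x \<in> V" "y \<in> V"
  shows "F (us @ x # y # vs) = F (us @ y # x # vs)"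
  using assms unfolding symm_on_def by blast

lemma mlin_onI:
  assumes "\<And>us vs. set us \<subseteq> V \<Longrightarrow> set vs \<subseteq> V \<Longrightarrow> lin_on R sm sc V (\<lambda>x. F (us @ x # vs))"
  shows "mlin_on R sm sc V F"
  using assms unfolding mlin_on_def by blast

lemma mlin_onD:
  assumes "mlin_on R sm sc V F" "set us \<subseteq> V" "set vs \<subseteq> V"
  shows "lin_on R sm sc V (\<lambda>x. F (us @ x # vs))"
  using assms unfolding mlin_on_def by blast

lemma lin_on_addD: "lin_on R sm sc V \<phi> \<Longrightarrow> x \<in> V \<Longrightarrow> y \<in> V \<Longrightarrow> \<phi> (x + y) = \<phi> x + \<phi> y"
  by (auto simp: lin_on_def)

lemma lin_on_scaleD: "lin_on R sm sc V \<phi> \<Longrightarrow> x \<in> V \<Longrightarrow> f \<in> R \<Longrightarrow> \<phi> (sm f x) = sc f (\<phi> x)"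
  by (auto simp: lin_on_def)

lemma lin_on_mono: "lin_on R sm sc V \<phi> \<Longrightarrow> R' \<subseteq> R \<Longrightarrow> lin_on R' sm sc V \<phi>"
  by (auto simp: lin_on_def)

lemma mlin_on_mono: "mlin_on R sm sc V F \<Longrightarrow> R' \<subseteq> R \<Longrightarrow> mlin_on R' sm sc V F"
  by (auto simp: mlin_on_def intro: lin_on_mono)

section \<open>Inheritance of linearity by sums and list sums\<close>

lemma lin_on_zero:
  assumes "\<And>f. f \<in> R \<Longrightarrow> linear (sc f)"
  shows "lin_on R sm sc V (\<lambda>_. 0)"
  by (simp add: lin_on_def linear_0[OF assms])

lemma lin_on_add:
  assumes "\<And>f. f \<in> R \<Longrightarrow> linear (sc f)" "lin_on R sm sc V \<phi>" "lin_on R sm sc V \<psi>"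
  shows "lin_on R sm sc V (\<lambda>x. \<phi> x + \<psi> x)"
  using assms(2,3) by (simp add: lin_on_def linear_add[OF assms(1)] algebra_simps)

lemma lin_on_diff:
  assumes "\<And>f. f \<in> R \<Longrightarrow> linear (sc f)" "lin_on R sm sc V \<phi>" "lin_on R sm sc V \<psi>"
  shows "lin_on R sm sc V (\<lambda>x. \<phi> x - \<psi> x)"
  using assms(2,3) by (simp add: lin_on_def linear_diff[OF assms(1)] algebra_simps)

lemma lin_on_scaleR:
  assumes "\<And>f. f \<in> R \<Longrightarrow> linear (sc f)" "lin_on R sm sc V \<phi>"
  shows "lin_on R sm sc V (\<lambda>x. r *\<^sub>R \<phi> x)"
  using assms(2) by (simp add: lin_on_def linear_scale[OF assms(1)] scaleR_add_right)

lemma lin_on_asum: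
  assumes "\<And>f. f \<in> R \<Longrightarrow> linear (sc f)" "set ys \<subseteq> W"
    and "\<And>y ys. y \<in> W \<Longrightarrow> set ys \<subseteq> W \<Longrightarrow> lin_on R sm sc V (\<lambda>x. F x y ys)"
  shows "lin_on R sm sc V (\<lambda>x. asum ys (F x))"
  using assms(2,3)
proof (induction ys arbitrary: F)
  case Nil
  show ?case using lin_on_zero[OF assms(1)] by simp
next
  case (Cons z zs)
  show ?case unfolding asum.simps
    by (intro lin_on_diff assms(1) Cons.IH Cons.prems) (use Cons.prems in auto)
qed

lemma lin_on_ssum:
  assumes "\<And>f. f \<in> R \<Longrightarrow> linear (sc f)" "set ys \<subseteq> W"
    and "\<And>y ys. y \<in> W \<Longrightarrow> set ys \<subseteq> W \<Longrightarrow> lin_on R sm sc V (\<lambda>x. F x y ys)"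
  shows "lin_on R sm sc V (\<lambda>x. ssum ys (F x))"
  using assms(2,3)
proof (induction ys arbitrary: F)
  case Nil
  show ?case using lin_on_zero[OF assms(1)] by simp
next
  case (Cons z zs)
  show ?case unfolding ssum.simps
    by (intro lin_on_add assms(1) Cons.IH Cons.prems) (use Cons.prems in auto)
qed

lemma lin_on_dsum:
  assumes "\<And>f. f \<in> R \<Longrightarrow> linear (sc f)" "set ys \<subseteq> W" "\<And>y. y \<in> W \<Longrightarrow> \<eta> y \<in> W"
    and "\<And>ys. set ys \<subseteq> W \<Longrightarrow> lin_on R sm sc V (\<lambda>x. F x ys)"
  shows "lin_on R sm sc V (\<lambda>x. dsum ys \<eta> (F x))"
  using assms(2,4)
proof (induction ys arbitrary: F)
  case Nil
  show ?case using lin_on_zero[OF assms(1)] by simp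
next
  case (Cons z zs)
  show ?case unfolding dsum.simps
    by (intro lin_on_add assms(1) Cons.IH Cons.prems) (use Cons.prems assms(3) in auto)
qed

lemma mlin_on_add:
  assumes "\<And>f. f \<in> R \<Longrightarrow> linear (sc f)" "mlin_on R sm sc V F" "mlin_on R sm sc V G"
  shows "mlin_on R sm sc V (\<lambda>xs. F xs + G xs)"
proof (intro mlin_onI)
  fix us vs assume uv: "set us \<subseteq> V" "set vs \<subseteq> V"
  show "lin_on R sm sc V (\<lambda>x. F (us @ x # vs) + G (us @ x # vs))"
    by (rule lin_on_add[OF assms(1) mlin_onD[OF assms(2) uv] mlin_onD[OF assms(3) uv]])
qed

lemma mlin_on_diff:
  assumes "\<And>f. f \<in> R \<Longrightarrow> linear (sc f)" "mlin_on R sm sc V F" "mlin_on R sm sc V G"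
  shows "mlin_on R sm sc V (\<lambda>xs. F xs - G xs)"
proof (intro mlin_onI)
  fix us vs assume uv: "set us \<subseteq> V" "set vs \<subseteq> V"
  show "lin_on R sm sc V (\<lambda>x. F (us @ x # vs) - G (us @ x # vs))"
    by (rule lin_on_diff[OF assms(1) mlin_onD[OF assms(2) uv] mlin_onD[OF assms(3) uv]])
qed

lemma mlin_on_scaleR:
  assumes "\<And>f. f \<in> R \<Longrightarrow> linear (sc f)" "mlin_on R sm sc V F"
  shows "mlin_on R sm sc V (\<lambda>xs. r *\<^sub>R F xs)"
proof (intro mlin_onI)
  fix us vs assume uv: "set us \<subseteq> V" "set vs \<subseteq> V"
  show "lin_on R sm sc V (\<lambda>x. r *\<^sub>R F (us @ x # vs))"
    by (rule lin_on_scaleR[OF assms(1) mlin_onD[OF assms(2) uv]])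
qed

text \<open>The sign depends on the number of arguments only, which does not change while one of
  them varies.\<close>

lemma mlin_on_sign:
  assumes "\<And>f. f \<in> R \<Longrightarrow> linear (sc f)" "mlin_on R sm sc V F"
  shows "mlin_on R sm sc V (\<lambda>xs. (-1) ^ length xs *\<^sub>R F xs)"
proof (intro mlin_onI)
  fix us vs assume "set us \<subseteq> V" "set vs \<subseteq> V"
  from lin_on_scaleR[OF assms(1) mlin_onD[OF assms(2) this], of "(-1) ^ (Suc (length us + length vs))"]
  show "lin_on R sm sc V (\<lambda>x. (-1) ^ length (us @ x # vs) *\<^sub>R F (us @ x # vs))"
    by simp
qed

lemma mlin_on_Cons:
  assumes "mlin_on R sm sc V F" "x \<in> V"
  shows "mlin_on R sm sc V (\<lambda>xs. F (x # xs))"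
proof (intro mlin_onI)
  fix us vs assume "set us \<subseteq> V" "set vs \<subseteq> V"
  then show "lin_on R sm sc V (\<lambda>y. F (x # us @ y # vs))"
    using mlin_onD[OF assms(1), of "x # us" vs] assms(2) by simp
qed

lemma mlin_on_outer_asum:
  assumes "\<And>f. f \<in> R \<Longrightarrow> linear (sc f)" "set ys \<subseteq> W"
    and "\<And>y ys. y \<in> W \<Longrightarrow> set ys \<subseteq> W \<Longrightarrow> mlin_on R sm sc V (\<lambda>xs. F xs y ys)"
  shows "mlin_on R sm sc V (\<lambda>xs. asum ys (F xs))"
proof (intro mlin_onI)
  fix us vs assume uv: "set us \<subseteq> V" "set vs \<subseteq> V"
  show "lin_on R sm sc V (\<lambda>x. asum ys (F (us @ x # vs)))"
    by (rule lin_on_asum[OF assms(1) assms(2)]) (use mlin_onD[OF assms(3) uv] in auto)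
qed

lemma mlin_on_outer_dsum:
  assumes "\<And>f. f \<in> R \<Longrightarrow> linear (sc f)" "set ys \<subseteq> W" "\<And>y. y \<in> W \<Longrightarrow> \<eta> y \<in> W"
    and "\<And>ys. set ys \<subseteq> W \<Longrightarrow> mlin_on R sm sc V (\<lambda>xs. F xs ys)"
  shows "mlin_on R sm sc V (\<lambda>xs. dsum ys \<eta> (F xs))"
proof (intro mlin_onI)
  fix us vs assume uv: "set us \<subseteq> V" "set vs \<subseteq> V"
  show "lin_on R sm sc V (\<lambda>x. dsum ys \<eta> (F (us @ x # vs)))"
    by (rule lin_on_dsum[OF assms(1) assms(2) assms(3)]) (use mlin_onD[OF assms(4) uv] in auto)
qed

text \<open>The varying entry is either the selected one or part of the rest, hence one assumption
  for each case.\<close>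

lemma mlin_on_asum:
  assumes "\<And>f. f \<in> R \<Longrightarrow> linear (sc f)"
    and "\<And>y. y \<in> V \<Longrightarrow> mlin_on R sm sc V (F y)"
    and "\<And>ys. set ys \<subseteq> V \<Longrightarrow> lin_on R sm sc V (\<lambda>x. F x ys)"
  shows "mlin_on R sm sc V (\<lambda>xs. asum xs F)"
proof (intro mlin_onI)
  fix us vs assume uv: "set us \<subseteq> V" "set vs \<subseteq> V"
  have 1: "lin_on R sm sc V (\<lambda>x. F y (ws @ x # zs))" if "y \<in> V" "set ws \<subseteq> V" "set zs \<subseteq> V" for y ws zs
    using mlin_onD[OF assms(2)] that by simp
  have 2: "lin_on R sm sc V (\<lambda>x. F y (us @ x # ys))" if "y \<in> V" "set ys \<subseteq> V" for y ys
    using 1[of y us ys] that uv by simp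
  show "lin_on R sm sc V (\<lambda>x. asum (us @ x # vs) F)"
    unfolding asum_append asum.simps
    by (intro lin_on_add lin_on_scaleR lin_on_diff assms(1,3) lin_on_asum[OF assms(1) uv(1)]
        lin_on_asum[OF assms(1) uv(2)] 1 2) (use uv in auto)
qed

lemma mlin_on_ssum:
  assumes "\<And>f. f \<in> R \<Longrightarrow> linear (sc f)"
    and "\<And>y. y \<in> V \<Longrightarrow> mlin_on R sm sc V (F y)"
    and "\<And>ys. set ys \<subseteq> V \<Longrightarrow> lin_on R sm sc V (\<lambda>x. F x ys)"
  shows "mlin_on R sm sc V (\<lambda>xs. ssum xs F)"
proof (intro mlin_onI)
  fix us vs assume uv: "set us \<subseteq> V" "set vs \<subseteq> V"
  have 1: "lin_on R sm sc V (\<lambda>x. F y (ws @ x # zs))" if "y \<in> V" "set ws \<subseteq> V" "set zs \<subseteq> V" for y ws zs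
    using mlin_onD[OF assms(2)] that by simp
  have 2: "lin_on R sm sc V (\<lambda>x. F y (us @ x # ys))" if "y \<in> V" "set ys \<subseteq> V" for y ys
    using 1[of y us ys] that uv by simp
  show "lin_on R sm sc V (\<lambda>x. ssum (us @ x # vs) F)"
    unfolding ssum_append ssum.simps
    by (intro lin_on_add assms(1,3) lin_on_ssum[OF assms(1) uv(1)]
        lin_on_ssum[OF assms(1) uv(2)] 1 2) (use uv in auto)
qed

lemma mlin_on_dsum:
  assumes "\<And>f. f \<in> R \<Longrightarrow> linear (sc f)"
    and "mlin_on R sm sc V F" "\<And>y. y \<in> V \<Longrightarrow> \<eta> y \<in> V"
    and "\<And>x y. x \<in> V \<Longrightarrow> y \<in> V \<Longrightarrow> \<eta> (x + y) = \<eta> x + \<eta> y"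
    and "\<And>f x. f \<in> R \<Longrightarrow> x \<in> V \<Longrightarrow> \<eta> (sm f x) = sm f (\<eta> x)"
  shows "mlin_on R sm sc V (\<lambda>xs. dsum xs \<eta> F)"
proof (intro mlin_onI)
  fix us vs assume uv: "set us \<subseteq> V" "set vs \<subseteq> V"
  have 1: "lin_on R sm sc V (\<lambda>x. F (ws @ x # zs))" if "set ws \<subseteq> V" "set zs \<subseteq> V" for ws zs
    using mlin_onD[OF assms(2)] that by simp
  have 2: "lin_on R sm sc V (\<lambda>x. F (us @ x # ys))" if "set ys \<subseteq> V" for ys
    using 1[of us ys] that uv by simp
  have 3: "lin_on R sm sc V (\<lambda>x. F (us @ \<eta> x # vs))"
    using 1[OF uv] assms(3-5) by (simp add: lin_on_def)
  show "lin_on R sm sc V (\<lambda>x. dsum (us @ x # vs) \<eta> F)"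
    unfolding dsum_append dsum.simps
    by (intro lin_on_add assms(1) lin_on_dsum[OF assms(1) uv(1)]
        lin_on_dsum[OF assms(1) uv(2)] assms(3) 1 2 3) (use uv in auto)
qed

text \<open>The version for the bracket with a section and for its action on vector fields, which
  satisfy a Leibniz rule instead of being linear over functions.\<close>

lemma mlin_on_dsum_additive:
  assumes "mlin_on {} sm sc V F" "\<And>y. y \<in> V \<Longrightarrow> \<eta> y \<in> V"
    and "\<And>x y. x \<in> V \<Longrightarrow> y \<in> V \<Longrightarrow> \<eta> (x + y) = \<eta> x + \<eta> y"
  shows "mlin_on {} sm sc V (\<lambda>xs. dsum xs \<eta> F)"
  by (rule mlin_on_dsum[OF _ assms]) auto

section \<open>Inheritance of alternation and symmetry\<close>

lemma alt_on_zero: "alt_on V (\<lambda>_. 0)"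
  by (auto simp: alt_on_def)

lemma alt_on_scaleR:
  assumes "alt_on V F"
  shows "alt_on V (\<lambda>xs. r *\<^sub>R F xs)"
proof (intro alt_onI)
  fix us vs x y assume "set us \<subseteq> V" "set vs \<subseteq> V" "x \<in> V" "y \<in> V"
  from alt_onD[OF assms this]
  show "r *\<^sub>R F (us @ x # y # vs) = - (r *\<^sub>R F (us @ y # x # vs))" by simp
qed

lemma alt_on_add:
  assumes "alt_on V F" "alt_on V G"
  shows "alt_on V (\<lambda>xs. F xs + G xs)"
proof (intro alt_onI)
  fix us vs x y assume "set us \<subseteq> V" "set vs \<subseteq> V" "x \<in> V" "y \<in> V"
  from alt_onD[OF assms(1) this] alt_onD[OF assms(2) this]
  show "F (us @ x # y # vs) + G (us @ x # y # vs) = - (F (us @ y # x # vs) + G (us @ y # x # vs))"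
    by simp
qed

lemma alt_on_diff:
  assumes "alt_on V F" "alt_on V G"
  shows "alt_on V (\<lambda>xs. F xs - G xs)"
  using alt_on_add[OF assms(1) alt_on_scaleR[OF assms(2), of "-1"]] by simp

lemma alt_on_Cons:
  assumes "alt_on V F" "x \<in> V"
  shows "alt_on V (\<lambda>xs. F (x # xs))"
proof (intro alt_onI)
  fix us vs y z assume "set us \<subseteq> V" "set vs \<subseteq> V" "y \<in> V" "z \<in> V"
  with alt_onD[OF assms(1), of "x # us" vs y z] assms(2)
  show "F (x # us @ y # z # vs) = - F (x # us @ z # y # vs)" by simp
qed

lemma alt_on_outer_asum:
  assumes "set ys \<subseteq> W"
    and "\<And>y ys. y \<in> W \<Longrightarrow> set ys \<subseteq> W \<Longrightarrow> alt_on V (\<lambda>xs. F xs y ys)"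
  shows "alt_on V (\<lambda>xs. asum ys (F xs))"
  using assms
proof (induction ys arbitrary: F)
  case Nil
  show ?case using alt_on_zero by simp
next
  case (Cons z zs)
  show ?case unfolding asum.simps
    by (intro alt_on_diff Cons.IH Cons.prems) (use Cons.prems in auto)
qed

lemma alt_on_outer_ssum:
  assumes "set ys \<subseteq> W"
    and "\<And>y ys. y \<in> W \<Longrightarrow> set ys \<subseteq> W \<Longrightarrow> alt_on V (\<lambda>xs. F xs y ys)"
  shows "alt_on V (\<lambda>xs. ssum ys (F xs))"
  using assms
proof (induction ys arbitrary: F)
  case Nil
  show ?case using alt_on_zero by simp
next
  case (Cons z zs)
  show ?case unfolding ssum.simps
    by (intro alt_on_add Cons.IH Cons.prems) (use Cons.prems in auto)
qed

lemma alt_on_outer_dsum: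
  assumes "set ys \<subseteq> W" "\<And>y. y \<in> W \<Longrightarrow> \<eta> y \<in> W"
    and "\<And>ys. set ys \<subseteq> W \<Longrightarrow> alt_on V (\<lambda>xs. F xs ys)"
  shows "alt_on V (\<lambda>xs. dsum ys \<eta> (F xs))"
  using assms(1,3)
proof (induction ys arbitrary: F)
  case Nil
  show ?case using alt_on_zero by simp
next
  case (Cons z zs)
  show ?case unfolding dsum.simps
    by (intro alt_on_add Cons.IH Cons.prems) (use Cons.prems assms(2) in auto)
qed

text \<open>When one of the two exchanged neighbours is selected, its position shifts by one and the
  sign of \<open>asum\<close> changes; otherwise the sign comes from \<open>F\<close>.\<close>

lemma alt_on_asum:
  assumes "\<And>y. y \<in> V \<Longrightarrow> alt_on V (F y)"
  shows "alt_on V (\<lambda>xs. asum xs F)"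
proof (intro alt_onI)
  fix us vs x y assume uv: "set us \<subseteq> V" "set vs \<subseteq> V" "x \<in> V" "y \<in> V"
  have "asum us (\<lambda>z zs. F z (zs @ x # y # vs)) = asum us (\<lambda>z zs. - F z (zs @ y # x # vs))"
    by (rule asum_cong[OF uv(1)]) (rule alt_onD[OF assms]; use uv in auto)
  moreover have "asum vs (\<lambda>z zs. F z (us @ x # y # zs)) = asum vs (\<lambda>z zs. - F z (us @ y # x # zs))"
    by (rule asum_cong[OF uv(2)]) (rule alt_onD[OF assms]; use uv in auto)
  ultimately show "asum (us @ x # y # vs) F = - asum (us @ y # x # vs) F"
    by (simp add: asum_append asum_minus algebra_simps)
qed

lemma alt_on_dsum:
  assumes "alt_on V F" "\<And>y. y \<in> V \<Longrightarrow> \<eta> y \<in> V"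
  shows "alt_on V (\<lambda>xs. dsum xs \<eta> F)"
proof (intro alt_onI)
  fix us vs x y assume uv: "set us \<subseteq> V" "set vs \<subseteq> V" "x \<in> V" "y \<in> V"
  have "dsum us \<eta> (\<lambda>zs. F (zs @ x # y # vs)) = dsum us \<eta> (\<lambda>zs. - F (zs @ y # x # vs))"
    by (rule dsum_cong[OF uv(1) assms(2)]) (assumption | rule alt_onD[OF assms(1)] | use uv in auto)+
  moreover have "dsum vs \<eta> (\<lambda>zs. F (us @ x # y # zs)) = dsum vs \<eta> (\<lambda>zs. - F (us @ y # x # zs))"
    by (rule dsum_cong[OF uv(2) assms(2)]) (assumption | rule alt_onD[OF assms(1)] | use uv in auto)+
  moreover have "F (us @ \<eta> x # y # vs) = - F (us @ y # \<eta> x # vs)"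
    "F (us @ x # \<eta> y # vs) = - F (us @ \<eta> y # x # vs)"
    by (rule alt_onD[OF assms(1)]; use uv assms(2) in simp)+
  ultimately show "dsum (us @ x # y # vs) \<eta> F = - dsum (us @ y # x # vs) \<eta> F"
    by (simp add: dsum_append dsum_minus algebra_simps)
qed

lemma symm_on_zero: "symm_on V (\<lambda>_. 0)"
  by (auto simp: symm_on_def)

lemma symm_on_add:
  assumes "symm_on V F" "symm_on V G"
  shows "symm_on V (\<lambda>xs. F xs + G xs)"
proof (intro symm_onI)
  fix us vs x y assume "set us \<subseteq> V" "set vs \<subseteq> V" "x \<in> V" "y \<in> V"
  from symm_onD[OF assms(1) this] symm_onD[OF assms(2) this]
  show "F (us @ x # y # vs) + G (us @ x # y # vs) = F (us @ y # x # vs) + G (us @ y # x # vs)"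
    by simp
qed

lemma symm_on_diff:
  assumes "symm_on V F" "symm_on V G"
  shows "symm_on V (\<lambda>xs. F xs - G xs)"
proof (intro symm_onI)
  fix us vs x y assume "set us \<subseteq> V" "set vs \<subseteq> V" "x \<in> V" "y \<in> V"
  from symm_onD[OF assms(1) this] symm_onD[OF assms(2) this]
  show "F (us @ x # y # vs) - G (us @ x # y # vs) = F (us @ y # x # vs) - G (us @ y # x # vs)"
    by simp
qed

lemma symm_on_scaleR:
  assumes "symm_on V F"
  shows "symm_on V (\<lambda>xs. r *\<^sub>R F xs)"
proof (intro symm_onI)
  fix us vs x y assume "set us \<subseteq> V" "set vs \<subseteq> V" "x \<in> V" "y \<in> V"
  from symm_onD[OF assms this]
  show "r *\<^sub>R F (us @ x # y # vs) = r *\<^sub>R F (us @ y # x # vs)" by simp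
qed

lemma symm_on_sign:
  assumes "symm_on V F"
  shows "symm_on V (\<lambda>xs. (-1) ^ length xs *\<^sub>R F xs)"
proof (intro symm_onI)
  fix us vs x y assume "set us \<subseteq> V" "set vs \<subseteq> V" "x \<in> V" "y \<in> V"
  from symm_onD[OF assms this]
  show "(-1) ^ length (us @ x # y # vs) *\<^sub>R F (us @ x # y # vs) =
      (-1) ^ length (us @ y # x # vs) *\<^sub>R F (us @ y # x # vs)" by simp
qed

lemma symm_on_Cons:
  assumes "symm_on V F" "x \<in> V"
  shows "symm_on V (\<lambda>xs. F (x # xs))"
proof (intro symm_onI)
  fix us vs y z assume "set us \<subseteq> V" "set vs \<subseteq> V" "y \<in> V" "z \<in> V"
  with symm_onD[OF assms(1), of "x # us" vs y z] assms(2)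
  show "F (x # us @ y # z # vs) = F (x # us @ z # y # vs)" by simp
qed

lemma symm_on_outer_asum:
  assumes "set ys \<subseteq> W"
    and "\<And>y ys. y \<in> W \<Longrightarrow> set ys \<subseteq> W \<Longrightarrow> symm_on V (\<lambda>xs. F xs y ys)"
  shows "symm_on V (\<lambda>xs. asum ys (F xs))"
  using assms
proof (induction ys arbitrary: F)
  case Nil
  show ?case using symm_on_zero by simp
next
  case (Cons z zs)
  show ?case unfolding asum.simps
    by (intro symm_on_diff Cons.IH Cons.prems) (use Cons.prems in auto)
qed

lemma symm_on_outer_dsum:
  assumes "set ys \<subseteq> W" "\<And>y. y \<in> W \<Longrightarrow> \<eta> y \<in> W"
    and "\<And>ys. set ys \<subseteq> W \<Longrightarrow> symm_on V (\<lambda>xs. F xs ys)"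
  shows "symm_on V (\<lambda>xs. dsum ys \<eta> (F xs))"
  using assms(1,3)
proof (induction ys arbitrary: F)
  case Nil
  show ?case using symm_on_zero by simp
next
  case (Cons z zs)
  show ?case unfolding dsum.simps
    by (intro symm_on_add Cons.IH Cons.prems) (use Cons.prems assms(2) in auto)
qed

lemma symm_on_ssum:
  assumes "\<And>y. y \<in> V \<Longrightarrow> symm_on V (F y)"
  shows "symm_on V (\<lambda>xs. ssum xs F)"
proof (intro symm_onI)
  fix us vs x y assume uv: "set us \<subseteq> V" "set vs \<subseteq> V" "x \<in> V" "y \<in> V"
  have "ssum us (\<lambda>z zs. F z (zs @ x # y # vs)) = ssum us (\<lambda>z zs. F z (zs @ y # x # vs))"
    by (rule ssum_cong[OF uv(1)]) (rule symm_onD[OF assms]; use uv in auto)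
  moreover have "ssum vs (\<lambda>z zs. F z (us @ x # y # zs)) = ssum vs (\<lambda>z zs. F z (us @ y # x # zs))"
    by (rule ssum_cong[OF uv(2)]) (rule symm_onD[OF assms]; use uv in auto)
  ultimately show "ssum (us @ x # y # vs) F = ssum (us @ y # x # vs) F"
    by (simp add: ssum_append algebra_simps)
qed

lemma symm_on_dsum:
  assumes "symm_on V F" "\<And>y. y \<in> V \<Longrightarrow> \<eta> y \<in> V"
  shows "symm_on V (\<lambda>xs. dsum xs \<eta> F)"
proof (intro symm_onI)
  fix us vs x y assume uv: "set us \<subseteq> V" "set vs \<subseteq> V" "x \<in> V" "y \<in> V"
  have "dsum us \<eta> (\<lambda>zs. F (zs @ x # y # vs)) = dsum us \<eta> (\<lambda>zs. F (zs @ y # x # vs))"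
    by (rule dsum_cong[OF uv(1) assms(2)]) (assumption | rule symm_onD[OF assms(1)] | use uv in auto)+
  moreover have "dsum vs \<eta> (\<lambda>zs. F (us @ x # y # zs)) = dsum vs \<eta> (\<lambda>zs. F (us @ y # x # zs))"
    by (rule dsum_cong[OF uv(2) assms(2)]) (assumption | rule symm_onD[OF assms(1)] | use uv in auto)+
  moreover have "F (us @ \<eta> x # y # vs) = F (us @ y # \<eta> x # vs)"
    "F (us @ x # \<eta> y # vs) = F (us @ \<eta> y # x # vs)"
    by (rule symm_onD[OF assms(1)]; use uv assms(2) in simp)+
  ultimately show "dsum (us @ x # y # vs) \<eta> F = dsum (us @ y # x # vs) \<eta> F"
    by (simp add: dsum_append algebra_simps)
qed

section \<open>Cochains and the vertical degree\<close>

text \<open>\<open>c as bs xs\<close> stands for \<open>c\<^sub>k(as | bs)(xs)\<close> with \<open>k = length bs\<close>. Cochains that vanish outside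
  bidegree \<open>(p, q)\<close> need no reference to \<open>k\<close>, \<open>p\<close> and \<open>q\<close>.\<close>

type_synonym ('g, 'x) raw = "'g list \<Rightarrow> 'g list \<Rightarrow> 'x list \<Rightarrow> 'g"

text \<open>The sign \<open>(-1)\<^sup>k\<close> in the two contractions is the one in the definition of \<open>\<delta>\<close>: it makes
  Cartan's formula \<open>\<iota>\<^sub>\<alpha> \<delta> + \<delta> \<iota>\<^sub>\<alpha> = \<L>\<^sub>\<alpha>\<close> hold.\<close>

definition contr :: "'g \<Rightarrow> ('g::real_vector, 'x) raw \<Rightarrow> ('g, 'x) raw" where
  "contr a c as bs xs = (-1) ^ length bs *\<^sub>R c (a # as) bs xs"

definition core_contr :: "('x \<Rightarrow> 'g) \<Rightarrow> ('g::real_vector, 'x) raw \<Rightarrow> ('g, 'x) raw" where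
  "core_contr \<theta> c as bs xs = (-1) ^ length bs *\<^sub>R asum xs (\<lambda>x ys. c as (\<theta> x # bs) ys)"

lemma contr_add: "contr a (c + d) = contr a c + contr a d"
  by (auto simp: contr_def fun_eq_iff scaleR_add_right)

lemma contr_scaleR: "contr a (r *\<^sub>R c) = r *\<^sub>R contr a c"
  by (auto simp: contr_def fun_eq_iff scaleR_fun_def)

lemma core_contr_add: "core_contr \<theta> (c + d) = core_contr \<theta> c + core_contr \<theta> d"
  by (auto simp: core_contr_def fun_eq_iff asum_add scaleR_add_right)

text \<open>\<open>conn1\<close> and \<open>conn2\<close> are the components of degrees \<open>0\<close> and \<open>1\<close> of \<open>\<delta> (C, v) = 0\<close>.\<close>

locale ideal_conn =
  fixes S K :: "'g::real_vector set" and V :: "'x::ab_group_add set"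
    and br :: "'g \<Rightarrow> 'g \<Rightarrow> 'g" and act :: "'g \<Rightarrow> 'x \<Rightarrow> 'x" and rh :: "'g \<Rightarrow> 'x"
    and C :: "'g \<Rightarrow> 'x \<Rightarrow> 'g" and v :: "'g \<Rightarrow> 'g"
    and R :: "'f set" and smS :: "'f \<Rightarrow> 'g \<Rightarrow> 'g" and smV :: "'f \<Rightarrow> 'x \<Rightarrow> 'x"
  assumes subspace_S: "subspace S" and subspace_K: "subspace K" and K_S: "K \<subseteq> S"
    and zero_V: "0 \<in> V"
    and linear_smS: "f \<in> R \<Longrightarrow> linear (smS f)"
    and br_S: "a \<in> S \<Longrightarrow> b \<in> S \<Longrightarrow> br a b \<in> S"
    and br_K: "a \<in> S \<Longrightarrow> b \<in> K \<Longrightarrow> br a b \<in> K"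
    and br_add: "a \<in> S \<Longrightarrow> b \<in> S \<Longrightarrow> b' \<in> S \<Longrightarrow> br a (b + b') = br a b + br a b'"
    and br_scaleR: "a \<in> S \<Longrightarrow> b \<in> S \<Longrightarrow> br a (r *\<^sub>R b) = r *\<^sub>R br a b"
    and act_V: "a \<in> S \<Longrightarrow> x \<in> V \<Longrightarrow> act a x \<in> V"
    and act_add: "a \<in> S \<Longrightarrow> x \<in> V \<Longrightarrow> y \<in> V \<Longrightarrow> act a (x + y) = act a x + act a y"
    and rh_V: "a \<in> S \<Longrightarrow> rh a \<in> V"
    and rh_add: "a \<in> S \<Longrightarrow> b \<in> S \<Longrightarrow> rh (a + b) = rh a + rh b"
    and rh_K: "a \<in> K \<Longrightarrow> rh a = 0"
    and C_K: "a \<in> S \<Longrightarrow> x \<in> V \<Longrightarrow> C a x \<in> K"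
    and C_lin: "a \<in> S \<Longrightarrow> lin_on R smV smS V (C a)"
    and v_K: "a \<in> S \<Longrightarrow> v a \<in> K"
    and v_lin: "lin_on R smS smS S v"
    and v_id: "a \<in> K \<Longrightarrow> v a = a"
    and conn1: "a \<in> S \<Longrightarrow> b \<in> S \<Longrightarrow> x \<in> V \<Longrightarrow>
      br a (C b x) - C b (act a x) - (br b (C a x) - C a (act b x)) = C (br a b) x"
    and conn2: "a \<in> S \<Longrightarrow> b \<in> S \<Longrightarrow> br a (v b) - v (br a b) = C a (rh b)"
begin

lemma K_inS: "a \<in> K \<Longrightarrow> a \<in> S"
  using K_S by auto

lemma v_S: "a \<in> S \<Longrightarrow> v a \<in> S"
  using v_K K_inS by auto

lemma C_S: "a \<in> S \<Longrightarrow> x \<in> V \<Longrightarrow> C a x \<in> S"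
  using C_K K_inS by auto

lemma br_minus: "a \<in> S \<Longrightarrow> b \<in> S \<Longrightarrow> br a (- b) = - br a b"
  using br_scaleR[of a b "-1"] by simp

lemma br_diff: "a \<in> S \<Longrightarrow> b \<in> S \<Longrightarrow> b' \<in> S \<Longrightarrow> br a (b - b') = br a b - br a b'"
  using br_add[of a b "- b'"] by (simp add: br_minus subspace_neg[OF subspace_S])

lemma br_zero: "a \<in> S \<Longrightarrow> br a 0 = 0"
  using br_scaleR[of a 0 0] subspace_0[OF subspace_S] by simp

text \<open>The conditions on symmetric arguments and vector fields, together with values in the
  ideals. Nothing is said about the alternating arguments, which obey a Leibniz rule.
  \<open>Q\<close> is \<open>R\<close> for Weil cochains and empty for what \<open>wdelta\<close>
  produces.\<close>

definition tensorial :: "'f set \<Rightarrow> ('g, 'x) raw \<Rightarrow> bool" where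
  "tensorial Q c \<longleftrightarrow> Q \<subseteq> R \<and>
     (\<forall>as bs xs. set as \<subseteq> S \<longrightarrow> set bs \<subseteq> S \<longrightarrow> set xs \<subseteq> V \<longrightarrow> c as bs xs \<in> K) \<and>
     (\<forall>as xs. set as \<subseteq> S \<longrightarrow> set xs \<subseteq> V \<longrightarrow>
       symm_on S (\<lambda>bs. c as bs xs) \<and> mlin_on Q smS smS S (\<lambda>bs. c as bs xs)) \<and>
     (\<forall>as bs. set as \<subseteq> S \<longrightarrow> set bs \<subseteq> S \<longrightarrow>
       alt_on V (c as bs) \<and> mlin_on Q smV smS V (c as bs))"

lemma goodI:
  assumes "Q \<subseteq> R"
    and "\<And>as bs xs. set as \<subseteq> S \<Longrightarrow> set bs \<subseteq> S \<Longrightarrow> set xs \<subseteq> V \<Longrightarrow> c as bs xs \<in> K"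
    and "\<And>as xs. set as \<subseteq> S \<Longrightarrow> set xs \<subseteq> V \<Longrightarrow> symm_on S (\<lambda>bs. c as bs xs)"
    and "\<And>as xs. set as \<subseteq> S \<Longrightarrow> set xs \<subseteq> V \<Longrightarrow> mlin_on Q smS smS S (\<lambda>bs. c as bs xs)"
    and "\<And>as bs. set as \<subseteq> S \<Longrightarrow> set bs \<subseteq> S \<Longrightarrow> alt_on V (\<lambda>xs. c as bs xs)"
    and "\<And>as bs. set as \<subseteq> S \<Longrightarrow> set bs \<subseteq> S \<Longrightarrow> mlin_on Q smV smS V (\<lambda>xs. c as bs xs)"
  shows "tensorial Q c"
  using assms unfolding tensorial_def by blast

lemma tensorial_R: "tensorial Q c \<Longrightarrow> Q \<subseteq> R"
  by (simp add: tensorial_def)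

lemma tensorial_K: "tensorial Q c \<Longrightarrow> set as \<subseteq> S \<Longrightarrow> set bs \<subseteq> S \<Longrightarrow> set xs \<subseteq> V \<Longrightarrow> c as bs xs \<in> K"
  unfolding tensorial_def by blast

lemma tensorial_S: "tensorial Q c \<Longrightarrow> set as \<subseteq> S \<Longrightarrow> set bs \<subseteq> S \<Longrightarrow> set xs \<subseteq> V \<Longrightarrow> c as bs xs \<in> S"
  using tensorial_K K_inS by blast

lemma tensorial_symm: "tensorial Q c \<Longrightarrow> set as \<subseteq> S \<Longrightarrow> set xs \<subseteq> V \<Longrightarrow> symm_on S (\<lambda>bs. c as bs xs)"
  unfolding tensorial_def by blast

lemma tensorial_mlinS:
  "tensorial Q c \<Longrightarrow> set as \<subseteq> S \<Longrightarrow> set xs \<subseteq> V \<Longrightarrow> mlin_on Q smS smS S (\<lambda>bs. c as bs xs)"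
  unfolding tensorial_def by blast

lemma tensorial_alt: "tensorial Q c \<Longrightarrow> set as \<subseteq> S \<Longrightarrow> set bs \<subseteq> S \<Longrightarrow> alt_on V (\<lambda>xs. c as bs xs)"
  unfolding tensorial_def by blast

lemma tensorial_mlinV:
  "tensorial Q c \<Longrightarrow> set as \<subseteq> S \<Longrightarrow> set bs \<subseteq> S \<Longrightarrow> mlin_on Q smV smS V (\<lambda>xs. c as bs xs)"
  unfolding tensorial_def by blast

lemma tensorial_linS: "tensorial Q c \<Longrightarrow> set as \<subseteq> S \<Longrightarrow> set bs \<subseteq> S \<Longrightarrow> set xs \<subseteq> V \<Longrightarrow>
    lin_on Q smS smS S (\<lambda>b. c as (b # bs) xs)"
  using mlin_onD[OF tensorial_mlinS, of Q c as xs "[]" bs] by simp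

lemma tensorial_linV: "tensorial Q c \<Longrightarrow> set as \<subseteq> S \<Longrightarrow> set bs \<subseteq> S \<Longrightarrow> set xs \<subseteq> V \<Longrightarrow>
    lin_on Q smV smS V (\<lambda>x. c as bs (x # xs))"
  using mlin_onD[OF tensorial_mlinV, of Q c as bs "[]" xs] by simp

lemma tensorial_mono:
  assumes "tensorial Q c" "Q' \<subseteq> Q"
  shows "tensorial Q' c"
proof (rule goodI)
  show "Q' \<subseteq> R" using assms tensorial_R by blast
qed (use assms in \<open>auto intro: tensorial_K tensorial_symm tensorial_alt mlin_on_mono[OF tensorial_mlinS]
  mlin_on_mono[OF tensorial_mlinV]\<close>)

lemma tensorial_add:
  assumes "tensorial Q c" "tensorial Q d"
  shows "tensorial Q (c + d)"
proof -
  have l: "\<And>f. f \<in> Q \<Longrightarrow> linear (smS f)" using tensorial_R[OF assms(1)] linear_smS by blast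
  show ?thesis
    unfolding plus_fun_def
    by (rule goodI; intro tensorial_R[OF assms(1)] subspace_add[OF subspace_K] symm_on_add
        mlin_on_add[OF l] alt_on_add tensorial_K[OF assms(1)] tensorial_K[OF assms(2)]
        tensorial_symm[OF assms(1)] tensorial_symm[OF assms(2)]
        tensorial_mlinS[OF assms(1)] tensorial_mlinS[OF assms(2)]
        tensorial_alt[OF assms(1)] tensorial_alt[OF assms(2)]
        tensorial_mlinV[OF assms(1)] tensorial_mlinV[OF assms(2)])
qed

lemma tensorial_scaleR:
  assumes "tensorial Q c"
  shows "tensorial Q (r *\<^sub>R c)"
proof -
  have l: "\<And>f. f \<in> Q \<Longrightarrow> linear (smS f)" using tensorial_R[OF assms(1)] linear_smS by blast
  show ?thesis
    unfolding scaleR_fun_def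
    by (rule goodI; intro tensorial_R[OF assms(1)] subspace_scale[OF subspace_K] symm_on_scaleR
        mlin_on_scaleR[OF l] alt_on_scaleR tensorial_K[OF assms(1)]
        tensorial_symm[OF assms(1)] tensorial_mlinS[OF assms(1)] tensorial_alt[OF assms(1)] tensorial_mlinV[OF assms(1)])
qed

lemma tensorial_diff: "tensorial Q c \<Longrightarrow> tensorial Q d \<Longrightarrow> tensorial Q (c - d)"
  using tensorial_add[OF _ tensorial_scaleR[of Q d "-1"], of c] by simp

lemma tensorial_contr:
  assumes c: "tensorial Q c" and a: "a \<in> S"
  shows "tensorial Q (contr a c)"
proof -
  have l: "\<And>f. f \<in> Q \<Longrightarrow> linear (smS f)" using tensorial_R[OF c] linear_smS by blast
  have a': "set as \<subseteq> S \<Longrightarrow> set (a # as) \<subseteq> S" for as using a by simp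
  show ?thesis
    unfolding contr_def[abs_def]
    by (rule goodI; intro tensorial_R[OF c] subspace_scale[OF subspace_K] symm_on_sign mlin_on_sign[OF l]
        mlin_on_scaleR[OF l] alt_on_scaleR tensorial_K[OF c] tensorial_symm[OF c] tensorial_mlinS[OF c] tensorial_alt[OF c]
        tensorial_mlinV[OF c] a')
qed

lemma tensorial_core_contr:
  assumes c: "tensorial Q c" and \<theta>: "\<And>x. x \<in> V \<Longrightarrow> \<theta> x \<in> S" "lin_on Q smV smS V \<theta>"
  shows "tensorial Q (core_contr \<theta> c)"
proof -
  have l: "\<And>f. f \<in> Q \<Longrightarrow> linear (smS f)" using tensorial_R[OF c] linear_smS by blast
  have b: "set (\<theta> x # bs) \<subseteq> S" if "x \<in> V" "set bs \<subseteq> S" for x bs using \<theta>(1) that by simp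
  show ?thesis
    unfolding core_contr_def[abs_def]
  proof (rule goodI, goal_cases)
    case 1 show ?case by (rule tensorial_R[OF c])
  next
    case (2 as bs xs)
    then show ?case
      by (intro subspace_scale[OF subspace_K] asum_in[OF subspace_K, where V = V] tensorial_K[OF c] b)
  next
    case (3 as xs)
    have "symm_on S (\<lambda>bs. c as (\<theta> x # bs) ys)" if "x \<in> V" "set ys \<subseteq> V" for x ys
      by (rule symm_on_Cons[OF tensorial_symm[OF c]]) (use 3 that \<theta> in auto)
    then show ?case
      by (intro symm_on_sign symm_on_outer_asum[OF 3(2)])
  next
    case (4 as xs)
    have "mlin_on Q smS smS S (\<lambda>bs. c as (\<theta> x # bs) ys)" if "x \<in> V" "set ys \<subseteq> V" for x ys
      by (rule mlin_on_Cons[OF tensorial_mlinS[OF c]]) (use 4 that \<theta> in auto)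
    then show ?case
      by (intro mlin_on_sign[OF l] mlin_on_outer_asum[OF l 4(2)])
  next
    case (5 as bs)
    then show ?case
      by (intro alt_on_scaleR alt_on_asum tensorial_alt[OF c] b)
  next
    case (6 as bs)
    have "lin_on Q smV smS V (\<lambda>x. c as (\<theta> x # bs) ys)" if "set ys \<subseteq> V" for ys
      using tensorial_linS[OF c 6 that] \<theta> by (simp add: lin_on_def)
    then show ?case
      using 6 by (intro mlin_on_scaleR[OF l] mlin_on_asum[OF l] tensorial_mlinV[OF c] b)
  qed
qed

text \<open>The derivation \<open>N\<close> of the overview. Its first summand uses up a vector
  field, because the projection of an alternating argument is a one-form with values in the
  symmetric slots.\<close>

definition vdeg :: "('g, 'x) raw \<Rightarrow> ('g, 'x) raw" where
  "vdeg c as bs xs = asum as (\<lambda>a as. asum xs (\<lambda>x xs. c as (C a x # bs) xs))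
     + dsum bs v (\<lambda>bs. c as bs xs)"

lemma vdeg_add: "vdeg (c + d) = vdeg c + vdeg d"
  by (auto simp: vdeg_def fun_eq_iff lsum_simps)

lemma vdeg_scaleR: "vdeg (r *\<^sub>R c) = r *\<^sub>R vdeg c"
  by (auto simp: vdeg_def fun_eq_iff lsum_simps scaleR_fun_def scaleR_add_right)

lemma vdeg_diff: "vdeg (c - d) = vdeg c - vdeg d"
  by (auto simp: vdeg_def fun_eq_iff lsum_simps)

text \<open>The extra summand is the term of \<open>vdeg\<close> in which \<open>a\<close> itself is
  projected. For the later entries the minus sign of \<open>asum\<close> is absorbed by the sign of
  \<open>contr\<close>, which sees one more symmetric argument.\<close>

lemma contr_vdeg: "contr a (vdeg c) = vdeg (contr a c) + core_contr (C a) c"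
  by (auto simp: contr_def vdeg_def core_contr_def fun_eq_iff lsum_simps dsum_sign scaleR_add_right
      scaleR_diff_right)

text \<open>Any scalars in \<open>R\<close> survive, since \<open>v\<close> and, in its vector
  field, \<open>C a\<close> are linear over them.\<close>

lemma tensorial_vdeg:
  assumes c: "tensorial Q c"
  shows "tensorial Q (vdeg c)"
proof -
  have l: "\<And>f. f \<in> Q \<Longrightarrow> linear (smS f)" using tensorial_R[OF c] linear_smS by blast
  have b: "set (C a x # bs) \<subseteq> S" if "x \<in> V" "a \<in> S" "set bs \<subseteq> S" for a x bs using C_S that by simp
  have vl: "v (x + y) = v x + v y" if "x \<in> S" "y \<in> S" for x y
    using v_lin that by (simp add: lin_on_def)
  have vs: "v (smS f x) = smS f (v x)" if "f \<in> Q" "x \<in> S" for f x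
    using v_lin that tensorial_R[OF c] by (auto simp: lin_on_def)
  have Cl: "lin_on Q smV smS V (C a)" if "a \<in> S" for a
    using lin_on_mono[OF C_lin[OF that] tensorial_R[OF c]] .
  show ?thesis
    unfolding vdeg_def[abs_def]
  proof (rule goodI, goal_cases)
    case 1 show ?case by (rule tensorial_R[OF c])
  next
    case (2 as bs xs)
    then show ?case
      by (intro subspace_add[OF subspace_K] asum_in[OF subspace_K 2(1)] asum_in[OF subspace_K 2(3)]
          dsum_in[OF subspace_K 2(2)] tensorial_K[OF c] b v_S)
  next
    case (3 as xs)
    have "symm_on S (\<lambda>bs. c as (C a x # bs) ys)" if "a \<in> S" "set as \<subseteq> S" "x \<in> V" "set ys \<subseteq> V" for a as x ys
      by (rule symm_on_Cons[OF tensorial_symm[OF c]]) (use that C_S in auto)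
    then show ?case using 3
      by (intro symm_on_add symm_on_outer_asum[OF 3(1)] symm_on_outer_asum[OF 3(2)] symm_on_dsum
          tensorial_symm[OF c] v_S)
  next
    case (4 as xs)
    have "mlin_on Q smS smS S (\<lambda>bs. c as (C a x # bs) ys)"
      if "a \<in> S" "set as \<subseteq> S" "x \<in> V" "set ys \<subseteq> V" for a as x ys
      by (rule mlin_on_Cons[OF tensorial_mlinS[OF c]]) (use that C_S in auto)
    then show ?case using 4
      by (intro mlin_on_add[OF l] mlin_on_outer_asum[OF l 4(1)] mlin_on_outer_asum[OF l 4(2)]
          mlin_on_dsum[OF l] tensorial_mlinS[OF c] v_S vl vs)
  next
    case (5 as bs)
    then show ?case
      by (intro alt_on_add alt_on_outer_asum[OF 5(1)] alt_on_asum alt_on_outer_dsum[OF 5(2)]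
        tensorial_alt[OF c] b v_S)
  next
    case (6 as bs)
    have "lin_on Q smV smS V (\<lambda>x. c as (C a x # bs) ys)" if "a \<in> S" "set as \<subseteq> S" "set ys \<subseteq> V" for a as ys
      using tensorial_linS[OF c that(2) 6(2) that(3)] Cl[OF that(1)] C_S[OF that(1)] by (simp add: lin_on_def)
    then show ?case
      using 6 by (intro mlin_on_add[OF l] mlin_on_outer_asum[OF l 6(1)] mlin_on_asum[OF l]
          mlin_on_outer_dsum[OF l 6(2)] tensorial_mlinV[OF c] b v_S)
  qed
qed

text \<open>The Lie derivative acting on all arguments, the alternating ones included. The one in
  the usual formula for \<delta> is \<open>wlie0\<close>; the difference of the two supplies the
  bracket terms of that formula.\<close>

definition wlie :: "'g \<Rightarrow> ('g, 'x) raw \<Rightarrow> ('g, 'x) raw" where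
  "wlie a c as bs xs = br a (c as bs xs) - dsum as (br a) (\<lambda>as. c as bs xs)
     - dsum bs (br a) (\<lambda>bs. c as bs xs) - dsum xs (act a) (\<lambda>xs. c as bs xs)"

text \<open>Cartan's formula serves as the definition of \<open>\<delta>\<close>; on alternating cochains it agrees with
  the usual one by \<open>wdelta_koszul\<close>.\<close>

fun wdelta :: "('g, 'x) raw \<Rightarrow> ('g, 'x) raw" where
  "wdelta c [] bs xs = - ((-1) ^ length bs *\<^sub>R ssum bs (\<lambda>b bs. c [] bs (rh b # xs)))"
| "wdelta c (a # as) bs xs = (-1) ^ length bs *\<^sub>R (wlie a c as bs xs - wdelta (contr a c) as bs xs)"

text \<open>Only additivity is claimed: taken separately, the summands of \<open>wlie\<close> are
  not linear over functions, since the bracket with \<open>a\<close> is not.\<close>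

lemma tensorial_wlie:
  assumes c: "tensorial {} c" and a: "a \<in> S"
  shows "tensorial {} (wlie a c)"
proof -
  have l: "\<And>f. f \<in> {} \<Longrightarrow> linear (smS f)" by simp
  show ?thesis
    unfolding wlie_def[abs_def]
  proof (rule goodI, goal_cases)
    case 1 show ?case by simp
  next
    case (2 as bs xs)
    then show ?case
      by (intro subspace_diff[OF subspace_K] dsum_in[OF subspace_K, where V = V]
          dsum_in[OF subspace_K, where V = S] tensorial_K[OF c] br_K br_S act_V a)
  next
    case (3 as xs)
    have "symm_on S (\<lambda>bs. br a (c as bs xs))"
    proof (intro symm_onI)
      fix us vs x y assume "set us \<subseteq> S" "set vs \<subseteq> S" "x \<in> S" "y \<in> S"
      from symm_onD[OF tensorial_symm[OF c 3] this]
      show "br a (c as (us @ x # y # vs) xs) = br a (c as (us @ y # x # vs) xs)" by simp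
    qed
    then show ?case using 3
      by (intro symm_on_diff symm_on_outer_dsum[OF 3(1)] symm_on_outer_dsum[OF 3(2)] symm_on_dsum
          tensorial_symm[OF c] br_S act_V a)
  next
    case (4 as xs)
    have "mlin_on {} smS smS S (\<lambda>bs. br a (c as bs xs))"
    proof (intro mlin_onI)
      fix us vs assume uv: "set us \<subseteq> S" "set vs \<subseteq> S"
      have "c as (us @ x # vs) xs \<in> S" if "x \<in> S" for x
        by (rule tensorial_S[OF c]) (use uv 4 that in auto)
      with mlin_onD[OF tensorial_mlinS[OF c 4] uv] a
      show "lin_on {} smS smS S (\<lambda>x. br a (c as (us @ x # vs) xs))"
        by (simp add: lin_on_def br_add)
    qed
    then show ?case using 4
      by (intro mlin_on_diff[OF l] mlin_on_outer_dsum[OF l 4(1)] mlin_on_outer_dsum[OF l 4(2)]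
          mlin_on_dsum_additive tensorial_mlinS[OF c] br_S act_V a br_add)
  next
    case (5 as bs)
    have "alt_on V (\<lambda>xs. br a (c as bs xs))"
    proof (intro alt_onI)
      fix us vs x y assume uv: "set us \<subseteq> V" "set vs \<subseteq> V" "x \<in> V" "y \<in> V"
      have "c as bs (us @ y # x # vs) \<in> S"
        by (rule tensorial_S[OF c]) (use uv 5 in auto)
      with alt_onD[OF tensorial_alt[OF c 5] uv] a
      show "br a (c as bs (us @ x # y # vs)) = - br a (c as bs (us @ y # x # vs))"
        by (simp add: br_minus)
    qed
    then show ?case using 5
      by (intro alt_on_diff alt_on_outer_dsum[OF 5(1)] alt_on_outer_dsum[OF 5(2)] alt_on_dsum
        tensorial_alt[OF c] br_S act_V a)
  next
    case (6 as bs)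
    have "mlin_on {} smV smS V (\<lambda>xs. br a (c as bs xs))"
    proof (intro mlin_onI)
      fix us vs assume uv: "set us \<subseteq> V" "set vs \<subseteq> V"
      have "c as bs (us @ x # vs) \<in> S" if "x \<in> V" for x
        by (rule tensorial_S[OF c]) (use uv 6 that in auto)
      with mlin_onD[OF tensorial_mlinV[OF c 6] uv] a
      show "lin_on {} smV smS V (\<lambda>x. br a (c as bs (us @ x # vs)))"
        by (simp add: lin_on_def br_add)
    qed
    then show ?case using 6
      by (intro mlin_on_diff[OF l] mlin_on_outer_dsum[OF l 6(1)] mlin_on_outer_dsum[OF l 6(2)]
          mlin_on_dsum_additive tensorial_mlinV[OF c] br_S act_V a act_add)
  qed
qed

end

section \<open>The vertical degree commutes with the differential\<close>

lemma ssum_sign: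
  fixes xs :: "'x list"
  shows "ssum xs (\<lambda>y ys. (-1) ^ length ys *\<^sub>R F y ys) = - ((-1) ^ length xs *\<^sub>R ssum xs F)"
proof -
  have "ssum xs (\<lambda>y ys. (-1) ^ length ys *\<^sub>R F y ys) = ssum xs (\<lambda>y ys. (- ((-1) ^ length xs)) *\<^sub>R F y ys)"
  proof (rule ssum_cong[where V = UNIV])
    fix y and ys :: "'x list" assume "Suc (length ys) = length xs"
    then have "(-1) ^ length xs = - ((-1 :: real) ^ length ys)" by (metis power_Suc mult_minus1)
    then show "(-1) ^ length ys *\<^sub>R F y ys = (- ((-1) ^ length xs)) *\<^sub>R F y ys" by simp
  qed simp
  then show ?thesis unfolding ssum_scaleR by simp
qed

text \<open>Symmetry allows the modified entry to be moved to the front.\<close>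

lemma dsum_eq_ssum:
  assumes "symm_on S F" "set xs \<subseteq> S" "\<And>y. y \<in> S \<Longrightarrow> \<phi> y \<in> S"
  shows "dsum xs \<phi> F = ssum xs (\<lambda>y ys. F (\<phi> y # ys))"
  using assms(1,2)
proof (induction xs arbitrary: F)
  case (Cons x xs)
  have "dsum xs \<phi> (\<lambda>ys. F (x # ys)) = ssum xs (\<lambda>y ys. F (x # \<phi> y # ys))"
    using Cons by (intro Cons.IH symm_on_Cons) auto
  also have "\<dots> = ssum xs (\<lambda>y ys. F (\<phi> y # x # ys))"
    using Cons.prems symm_onD[OF Cons.prems(1), of "[]" _ x] assms(3)
    by (intro ssum_cong[where V = S]) auto
  finally show ?case by simp
qed simp

lemma dsum_fun_diff:
  fixes F :: "'x::ab_group_add list \<Rightarrow> 'v::real_vector"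
  assumes "mlin_on {} sm sc S F" "set xs \<subseteq> S"
    and "\<And>y. y \<in> S \<Longrightarrow> \<phi> y \<in> S" "\<And>y. y \<in> S \<Longrightarrow> \<psi> y \<in> S" "\<And>y. y \<in> S \<Longrightarrow> \<phi> y - \<psi> y \<in> S"
  shows "dsum xs \<phi> F - dsum xs \<psi> F = dsum xs (\<lambda>y. \<phi> y - \<psi> y) F"
  using assms(1,2)
proof (induction xs arbitrary: F)
  case (Cons x xs)
  have "dsum xs \<phi> (\<lambda>ys. F (x # ys)) - dsum xs \<psi> (\<lambda>ys. F (x # ys)) =
      dsum xs (\<lambda>y. \<phi> y - \<psi> y) (\<lambda>ys. F (x # ys))"
    using Cons by (intro Cons.IH mlin_on_Cons) auto
  moreover
  \<comment> \<open>Additivity speaks of sums in the carrier, so \<open>\<phi> x\<close> is written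
    as the difference plus \<open>\<psi> x\<close>.\<close>
  have "F (((\<phi> x - \<psi> x) + \<psi> x) # xs) = F ((\<phi> x - \<psi> x) # xs) + F (\<psi> x # xs)"
    using lin_on_addD[OF mlin_onD[OF Cons.prems(1), of "[]" xs], of "\<phi> x - \<psi> x" "\<psi> x"]
      Cons.prems assms(4,5) by (simp del: diff_add_cancel)
  then have "F (\<phi> x # xs) = F ((\<phi> x - \<psi> x) # xs) + F (\<psi> x # xs)" by simp
  ultimately show ?case by (simp add: algebra_simps)
qed simp

lemma dsum_ident: "dsum xs (\<lambda>x. x) F = of_nat (length xs) *\<^sub>R F xs"
  by (induction xs arbitrary: F) (auto simp: algebra_simps)

context ideal_conn
begin

lemma tensorial_zeroV:
  assumes "tensorial Q c" "set as \<subseteq> S" "set bs \<subseteq> S" "set xs \<subseteq> V"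
  shows "c as bs (0 # xs) = 0"
  using lin_on_addD[OF tensorial_linV[OF assms] zero_V zero_V] by simp

lemma tensorial_zeroS:
  assumes "tensorial Q c" "set as \<subseteq> S" "set bs \<subseteq> S" "set xs \<subseteq> V"
  shows "c as (0 # bs) xs = 0"
  using lin_on_addD[OF tensorial_linS[OF assms], of 0 0] subspace_0[OF subspace_S] by simp

lemma tensorial_diffS:
  assumes "tensorial Q c" "set as \<subseteq> S" "set bs \<subseteq> S" "set xs \<subseteq> V" "x \<in> S" "y \<in> S"
  shows "c as ((x - y) # bs) xs = c as (x # bs) xs - c as (y # bs) xs"
  using lin_on_addD[OF tensorial_linS[OF assms(1-4)] subspace_diff[OF subspace_S assms(5,6)] assms(6)]
  by simp

lemma br_asum:
  assumes "a \<in> S" "set xs \<subseteq> W" "\<And>y ys. y \<in> W \<Longrightarrow> set ys \<subseteq> W \<Longrightarrow> F y ys \<in> S"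
  shows "br a (asum xs F) = asum xs (\<lambda>y ys. br a (F y ys))"
  using assms(2,3)
proof (induction xs arbitrary: F)
  case (Cons x xs)
  have "asum xs (\<lambda>y ys. F y (x # ys)) \<in> S"
    using Cons.prems by (intro asum_in[OF subspace_S, where V = W]) auto
  moreover have "br a (asum xs (\<lambda>y ys. F y (x # ys))) = asum xs (\<lambda>y ys. br a (F y (x # ys)))"
    using Cons.prems by (intro Cons.IH) auto
  ultimately show ?case using Cons.prems assms(1) by (simp add: br_diff)
qed (use assms(1) in \<open>simp add: br_zero\<close>)

lemma br_dsum:
  assumes "a \<in> S" "set xs \<subseteq> W" "\<And>y. y \<in> W \<Longrightarrow> \<phi> y \<in> W" "\<And>ys. set ys \<subseteq> W \<Longrightarrow> F ys \<in> S"
  shows "br a (dsum xs \<phi> F) = dsum xs \<phi> (\<lambda>ys. br a (F ys))"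
  using assms(2,4)
proof (induction xs arbitrary: F)
  case (Cons x xs)
  have "dsum xs \<phi> (\<lambda>ys. F (x # ys)) \<in> S"
    using Cons.prems by (intro dsum_in[OF subspace_S, where V = W] assms(3)) auto
  moreover have "br a (dsum xs \<phi> (\<lambda>ys. F (x # ys))) = dsum xs \<phi> (\<lambda>ys. br a (F (x # ys)))"
    using Cons.prems by (intro Cons.IH) auto
  moreover have "F (\<phi> x # xs) \<in> S"
    using Cons.prems assms(3) by auto
  ultimately show ?case using assms(1) by (simp add: br_add)
qed (use assms(1) in \<open>simp add: br_zero\<close>)

text \<open>This and the next rules say that each operator evaluates its cochain on carrier lists
  only, so that identities valid on the carrier can be used inside it.\<close>

lemma vdeg_cong:
  assumes "\<And>as bs xs. set as \<subseteq> S \<Longrightarrow> set bs \<subseteq> S \<Longrightarrow> set xs \<subseteq> V \<Longrightarrow> c as bs xs = d as bs xs"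
    and "set as \<subseteq> S" "set bs \<subseteq> S" "set xs \<subseteq> V"
  shows "vdeg c as bs xs = vdeg d as bs xs"
proof -
  have "asum as (\<lambda>a as. asum xs (\<lambda>x xs. c as (C a x # bs) xs)) =
      asum as (\<lambda>a as. asum xs (\<lambda>x xs. d as (C a x # bs) xs))"
    by (intro asum_cong[OF assms(2)] asum_cong[OF assms(4)] assms(1)) (use C_S assms in auto)
  moreover have "dsum bs v (\<lambda>bs. c as bs xs) = dsum bs v (\<lambda>bs. d as bs xs)"
    by (intro dsum_cong[OF assms(3)] assms(1)) (use v_S assms in auto)
  ultimately show ?thesis by (simp add: vdeg_def)
qed

lemma core_contr_cong:
  assumes "\<And>as bs xs. set as \<subseteq> S \<Longrightarrow> set bs \<subseteq> S \<Longrightarrow> set xs \<subseteq> V \<Longrightarrow> c as bs xs = d as bs xs"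
    and "\<And>x. x \<in> V \<Longrightarrow> \<theta> x \<in> S" "set as \<subseteq> S" "set bs \<subseteq> S" "set xs \<subseteq> V"
  shows "core_contr \<theta> c as bs xs = core_contr \<theta> d as bs xs"
proof -
  have "asum xs (\<lambda>x xs. c as (\<theta> x # bs) xs) = asum xs (\<lambda>x xs. d as (\<theta> x # bs) xs)"
    by (intro asum_cong[OF assms(5)] assms(1)) (use assms in auto)
  then show ?thesis by (simp add: core_contr_def)
qed

lemma contr_cong:
  assumes "\<And>as bs xs. set as \<subseteq> S \<Longrightarrow> set bs \<subseteq> S \<Longrightarrow> set xs \<subseteq> V \<Longrightarrow> c as bs xs = d as bs xs"
    and "a \<in> S" "set as \<subseteq> S" "set bs \<subseteq> S" "set xs \<subseteq> V"
  shows "contr a c as bs xs = contr a d as bs xs"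
  using assms(1)[of "a # as" bs xs] assms(2-) by (simp add: contr_def)

lemma wlie_cong:
  assumes "\<And>as bs xs. set as \<subseteq> S \<Longrightarrow> set bs \<subseteq> S \<Longrightarrow> set xs \<subseteq> V \<Longrightarrow> c as bs xs = d as bs xs"
    and a: "a \<in> S" and "set as \<subseteq> S" "set bs \<subseteq> S" "set xs \<subseteq> V"
  shows "wlie a c as bs xs = wlie a d as bs xs"
proof -
  have "c as bs xs = d as bs xs" by (intro assms)
  moreover have "dsum as (br a) (\<lambda>as. c as bs xs) = dsum as (br a) (\<lambda>as. d as bs xs)"
    by (intro dsum_cong[OF assms(3)] assms(1) br_S a) (use assms in auto)
  moreover have "dsum bs (br a) (\<lambda>bs. c as bs xs) = dsum bs (br a) (\<lambda>bs. d as bs xs)"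
    by (intro dsum_cong[OF assms(4)] assms(1) br_S a) (use assms in auto)
  moreover have "dsum xs (act a) (\<lambda>xs. c as bs xs) = dsum xs (act a) (\<lambda>xs. d as bs xs)"
    by (intro dsum_cong[OF assms(5)] assms(1) act_V a) (use assms in auto)
  ultimately show ?thesis by (simp add: wlie_def)
qed

lemma wdelta_cong:
  assumes "\<And>as bs xs. set as \<subseteq> S \<Longrightarrow> set bs \<subseteq> S \<Longrightarrow> set xs \<subseteq> V \<Longrightarrow> c as bs xs = d as bs xs"
    and "set as \<subseteq> S" "set bs \<subseteq> S" "set xs \<subseteq> V"
  shows "wdelta c as bs xs = wdelta d as bs xs"
  using assms
proof (induction as arbitrary: c d)
  case Nil
  have "ssum bs (\<lambda>b bs. c [] bs (rh b # xs)) = ssum bs (\<lambda>b bs. d [] bs (rh b # xs))"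
    by (intro ssum_cong[OF Nil(3)] Nil(1)) (use Nil rh_V in auto)
  then show ?case by simp
next
  case (Cons a as)
  have "wlie a c as bs xs = wlie a d as bs xs"
    by (intro wlie_cong Cons.prems) (use Cons.prems in auto)
  moreover have "wdelta (contr a c) as bs xs = wdelta (contr a d) as bs xs"
    by (intro Cons.IH contr_cong Cons.prems) (use Cons.prems in auto)
  ultimately show ?case by simp
qed

lemma wlie_add:
  assumes "tensorial Q c" "tensorial Q d" "a \<in> S" "set as \<subseteq> S" "set bs \<subseteq> S" "set xs \<subseteq> V"
  shows "wlie a (c + d) as bs xs = wlie a c as bs xs + wlie a d as bs xs"
  using br_add[OF assms(3) tensorial_S[OF assms(1,4,5,6)] tensorial_S[OF assms(2,4,5,6)]]
  by (simp add: wlie_def dsum_add)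

lemma wlie_scaleR:
  assumes "tensorial Q c" "a \<in> S" "set as \<subseteq> S" "set bs \<subseteq> S" "set xs \<subseteq> V"
  shows "wlie a (r *\<^sub>R c) as bs xs = r *\<^sub>R wlie a c as bs xs"
  using br_scaleR[OF assms(2) tensorial_S[OF assms(1,3,4,5)]]
  by (simp add: wlie_def scaleR_fun_def dsum_scaleR scaleR_diff_right)

lemma wdelta_add:
  assumes "tensorial Q c" "tensorial Q d" "set as \<subseteq> S" "set bs \<subseteq> S" "set xs \<subseteq> V"
  shows "wdelta (c + d) as bs xs = wdelta c as bs xs + wdelta d as bs xs"
  using assms(1-3)
proof (induction as arbitrary: c d)
  case Nil
  then show ?case by (simp add: ssum_add scaleR_add_right)
next
  case (Cons a as)
  then have "wdelta (contr a c + contr a d) as bs xs = wdelta (contr a c) as bs xs + wdelta (contr a d) as bs xs"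
    by (intro Cons.IH tensorial_contr) auto
  moreover have "wlie a (c + d) as bs xs = wlie a c as bs xs + wlie a d as bs xs"
    using Cons.prems by (intro wlie_add assms(4,5)) auto
  ultimately show ?case
    unfolding wdelta.simps contr_add by (simp only: scaleR_add_right scaleR_diff_right) simp
qed

lemma wdelta_scaleR:
  assumes "tensorial Q c" "set as \<subseteq> S" "set bs \<subseteq> S" "set xs \<subseteq> V"
  shows "wdelta (r *\<^sub>R c) as bs xs = r *\<^sub>R wdelta c as bs xs"
  using assms(1-2)
proof (induction as arbitrary: c)
  case Nil
  then show ?case by (simp add: scaleR_fun_def ssum_scaleR)
next
  case (Cons a as)
  then have "wdelta (r *\<^sub>R contr a c) as bs xs = r *\<^sub>R wdelta (contr a c) as bs xs"
    by (intro Cons.IH tensorial_contr) auto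
  moreover have "wlie a (r *\<^sub>R c) as bs xs = r *\<^sub>R wlie a c as bs xs"
    using Cons.prems by (intro wlie_scaleR assms(3,4)) auto
  ultimately show ?case
    unfolding wdelta.simps contr_scaleR by (simp add: scaleR_diff_right mult.commute)
qed

lemma wdelta_minus:
  assumes "tensorial Q c" "set as \<subseteq> S" "set bs \<subseteq> S" "set xs \<subseteq> V"
  shows "wdelta (- c) as bs xs = - wdelta c as bs xs"
  using wdelta_scaleR[OF assms, of "-1"] by simp

section \<open>Commutators of contractions, Lie derivatives and the differential\<close>

lemma wlie_core_contr:
  assumes c: "tensorial {} c" and a: "a \<in> S" and \<theta>: "\<And>x. x \<in> V \<Longrightarrow> \<theta> x \<in> S"
    and carr: "set as \<subseteq> S" "set bs \<subseteq> S" "set xs \<subseteq> V"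
  shows "wlie a (core_contr \<theta> c) as bs xs - core_contr \<theta> (wlie a c) as bs xs =
    core_contr (\<lambda>x. br a (\<theta> x) - \<theta> (act a x)) c as bs xs"
proof -
  have in_S: "asum xs (\<lambda>x ys. c as (\<theta> x # bs) ys) \<in> S"
    by (intro asum_in[OF subspace_S carr(3)] tensorial_S[OF c]) (use \<theta> carr in auto)
  have 1: "br a (asum xs (\<lambda>x ys. c as (\<theta> x # bs) ys)) = asum xs (\<lambda>x ys. br a (c as (\<theta> x # bs) ys))"
    by (intro br_asum[OF a carr(3)] tensorial_S[OF c]) (use \<theta> carr in auto)
  have 2: "asum xs (\<lambda>x ys. c as ((br a (\<theta> x) - \<theta> (act a x)) # bs) ys) =
     asum xs (\<lambda>x ys. c as (br a (\<theta> x) # bs) ys - c as (\<theta> (act a x) # bs) ys)"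
    by (intro asum_cong[OF carr(3)] tensorial_diffS[OF c]) (use \<theta> carr act_V a br_S in auto)
  show ?thesis
    unfolding wlie_def core_contr_def dsum_sign dsum_scaleR dsum_asum dsum_asum_commute br_scaleR[OF a in_S] 1 2
    by (simp add: lsum_simps algebra_simps)
qed

lemma core_contr_theta_diff:
  assumes c: "tensorial {} c" and \<theta>: "\<And>x. x \<in> V \<Longrightarrow> \<theta> x \<in> S" and \<eta>: "\<And>x. x \<in> V \<Longrightarrow> \<eta> x \<in> S"
    and carr: "set as \<subseteq> S" "set bs \<subseteq> S" "set xs \<subseteq> V"
    and \<zeta>: "\<And>x. x \<in> V \<Longrightarrow> \<zeta> x = \<theta> x - \<eta> x"
  shows "core_contr \<theta> c as bs xs - core_contr \<eta> c as bs xs = core_contr \<zeta> c as bs xs"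
proof -
  have "asum xs (\<lambda>x ys. c as (\<zeta> x # bs) ys) =
     asum xs (\<lambda>x ys. c as (\<theta> x # bs) ys - c as (\<eta> x # bs) ys)"
    by (intro asum_cong[OF carr(3)]) (use \<theta> \<eta> \<zeta> carr tensorial_diffS[OF c] in auto)
  then show ?thesis by (simp add: core_contr_def lsum_simps scaleR_diff_right)
qed

text \<open>The minus sign comes from the additional symmetric argument that
  \<open>core_contr\<close> creates.\<close>

lemma contr_core_contr: "contr b (core_contr \<theta> c) = - core_contr \<theta> (contr b c)"
  by (auto simp: contr_def core_contr_def fun_eq_iff asum_scaleR asum_minus)

lemma contr_wdelta: "contr a (wdelta c) = wlie a c - wdelta (contr a c)"
  by (auto simp: contr_def fun_eq_iff)

text \<open>The term of \<open>wlie\<close> that brackets the head \<open>b\<close> has no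
  counterpart in the Lie derivative of \<open>contr b c\<close>; it is the contraction with
  \<open>br a b\<close>.\<close>

lemma contr_wlie:
  assumes c: "tensorial Q c" and a: "a \<in> S" and b: "b \<in> S"
    and carr: "set as \<subseteq> S" "set bs \<subseteq> S" "set xs \<subseteq> V"
  shows "contr b (wlie a c) as bs xs = (wlie a (contr b c) - contr (br a b) c) as bs xs"
proof -
  have "c (b # as) bs xs \<in> S"
    by (rule tensorial_S[OF c]) (use b carr in auto)
  then have "br a ((-1) ^ length bs *\<^sub>R c (b # as) bs xs) = (-1) ^ length bs *\<^sub>R br a (c (b # as) bs xs)"
    by (intro br_scaleR a)
  then show ?thesis
    unfolding contr_def wlie_def minus_apply dsum_sign dsum_scaleR by (simp add: algebra_simps)
qed

text \<open>Undoes a contraction: an identity at \<open>b # as\<close> follows from the one for the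
  contractions at \<open>as\<close>, which is the shape of the inductions below.\<close>

lemma Cons_contr: "f (b # as) bs xs = (-1) ^ length bs *\<^sub>R contr b f as bs xs"
  by (simp add: contr_def)

lemma C_add: "a \<in> S \<Longrightarrow> lin_on {} smV smS V (C a)"
  by (rule lin_on_mono[OF C_lin]) auto

text \<open>Without alternating arguments \<open>vdeg\<close> is the derivation induced by
  \<open>v\<close>, so the commutator with \<open>wlie a\<close> is that of \<open>br a\<close> and
  \<open>v\<close> at one symmetric position, which \<open>conn2\<close> evaluates to
  \<open>C a (rh b)\<close>. On the right-hand side this is the term of
  \<open>wdelta (core_contr (C a) c)\<close> in which \<open>C a\<close> consumes the inserted
  \<open>rh b\<close>; the double insertions cancel.\<close>

lemma wlie_vdeg_Nil:
  assumes c: "tensorial {} c" and a: "a \<in> S" and carr: "set bs \<subseteq> S" "set xs \<subseteq> V"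
  shows "wlie a (vdeg c) [] bs xs - vdeg (wlie a c) [] bs xs =
    core_contr (C a) (wdelta c) [] bs xs + wdelta (core_contr (C a) c) [] bs xs"
proof -
  let ?F = "\<lambda>bs. c [] bs xs"
  have 1: "br a (dsum bs v ?F) = dsum bs v (\<lambda>bs. br a (?F bs))"
    by (intro br_dsum[OF a carr(1)] tensorial_S[OF c]) (use v_S carr in auto)
  have 2: "dsum bs (br a \<circ> v) ?F - dsum bs (v \<circ> br a) ?F = dsum bs (\<lambda>y. (br a \<circ> v) y - (v \<circ> br a) y) ?F"
    by (rule dsum_fun_diff[OF tensorial_mlinS[OF c]])
      (use carr a br_S v_S subspace_diff[OF subspace_S] in auto)
  have 3: "dsum bs (\<lambda>y. (br a \<circ> v) y - (v \<circ> br a) y) ?F = dsum bs (\<lambda>b. C a (rh b)) ?F"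
    by (rule dsum_fun_cong[OF carr(1)]) (use a conn2 in auto)
  have 4: "dsum bs (\<lambda>b. C a (rh b)) ?F = ssum bs (\<lambda>b bs. c [] (C a (rh b) # bs) xs)"
    by (rule dsum_eq_ssum[OF tensorial_symm[OF c] carr(1)]) (use C_S rh_V a carr in auto)
  have "wlie a (vdeg c) [] bs xs - vdeg (wlie a c) [] bs xs =
     dsum bs v (\<lambda>bs. dsum bs (br a) ?F) - dsum bs (br a) (\<lambda>bs. dsum bs v ?F)"
    by (simp add: wlie_def vdeg_def 1 lsum_simps dsum_dsum_commute[of xs])
  also have "\<dots> = ssum bs (\<lambda>b bs. c [] (C a (rh b) # bs) xs)"
    by (simp only: dsum_dsum_diff 2 3 4)
  finally have L: "wlie a (vdeg c) [] bs xs - vdeg (wlie a c) [] bs xs = \<dots>" .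
  have "core_contr (C a) (wdelta c) [] bs xs =
      asum xs (\<lambda>x ys. c [] bs (rh (C a x) # ys) + ssum bs (\<lambda>b bs. c [] (C a x # bs) (rh b # ys)))"
    by (simp add: core_contr_def lsum_simps scaleR_add_right)
  \<comment> \<open>\<open>C a x\<close> lies in the ideals, so the anchor kills it and the vector
    field \<open>rh (C a x)\<close> is zero.\<close>
  also have "\<dots> = asum xs (\<lambda>x ys. ssum bs (\<lambda>b bs. c [] (C a x # bs) (rh b # ys)))"
    by (rule asum_cong[OF carr(2)]) (use rh_K C_K a tensorial_zeroV[OF c] carr in auto)
  finally have R1: "core_contr (C a) (wdelta c) [] bs xs = \<dots>" .
  have "wdelta (core_contr (C a) c) [] bs xs =
      ssum bs (\<lambda>b bs. c [] (C a (rh b) # bs) xs - asum xs (\<lambda>y ys. c [] (C a y # bs) (rh b # ys)))"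
    by (simp add: core_contr_def ssum_sign del: asum.simps) (simp add: lsum_simps)
  then show ?thesis using L R1 by (simp add: lsum_simps ssum_asum_commute)
qed

text \<open>This is where the connection has to be multiplicative: the base case of the induction is
  \<open>conn2\<close>, and the induction step uses \<open>conn1\<close>.\<close>

lemma wlie_vdeg:
  assumes c: "tensorial {} c" and a: "a \<in> S" and carr: "set as \<subseteq> S" "set bs \<subseteq> S" "set xs \<subseteq> V"
  shows "wlie a (vdeg c) as bs xs - vdeg (wlie a c) as bs xs =
    core_contr (C a) (wdelta c) as bs xs + wdelta (core_contr (C a) c) as bs xs"
  using c carr(1)
proof (induction as arbitrary: c)
  case Nil
  then show ?case using wlie_vdeg_Nil a carr by blast
next
  case (Cons b as)
  note c = Cons.prems(1)
  have b: "b \<in> S" and as: "set as \<subseteq> S" using Cons.prems by auto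
  note carr = as \<open>set bs \<subseteq> S\<close> \<open>set xs \<subseteq> V\<close>
  have gb: "tensorial {} (contr b c)" by (rule tensorial_contr[OF c b])
  have gkb: "tensorial {} (core_contr (C b) c)" by (rule tensorial_core_contr[OF c]) (use C_S C_add b in auto)
  have gka: "tensorial {} (core_contr (C a) (contr b c))" by (rule tensorial_core_contr[OF gb]) (use C_S C_add a in auto)
  \<comment> \<open>Facts \<open>1\<close> to \<open>4\<close> contract the four terms of the claim
    with \<open>b\<close>. Up to the induction hypothesis for \<open>contr b c\<close>, what remains
    is that the commutator of \<open>wlie a\<close> with \<open>core_contr (C b)\<close>, minus the
    same with \<open>a\<close> and \<open>b\<close> exchanged, is
    \<open>core_contr (C (br a b))\<close>. This is \<open>conn1\<close>, assembled in
    \<open>5\<close> to \<open>7\<close>.\<close>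
  have "contr b (wlie a (vdeg c)) as bs xs = wlie a (contr b (vdeg c)) as bs xs - contr (br a b) (vdeg c) as bs xs"
    using contr_wlie[OF tensorial_vdeg[OF c] a b carr] by simp
  also have "wlie a (contr b (vdeg c)) as bs xs = wlie a (vdeg (contr b c)) as bs xs + wlie a (core_contr (C b) c) as bs xs"
    unfolding contr_vdeg by (rule wlie_add[OF tensorial_vdeg[OF gb] gkb a carr])
  finally have 1: "contr b (wlie a (vdeg c)) as bs xs = wlie a (vdeg (contr b c)) as bs xs
      + wlie a (core_contr (C b) c) as bs xs - vdeg (contr (br a b) c) as bs xs - core_contr (C (br a b)) c as bs xs"
    by (simp add: contr_vdeg)
  have "vdeg (contr b (wlie a c)) as bs xs = vdeg (wlie a (contr b c) - contr (br a b) c) as bs xs"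
    by (rule vdeg_cong[OF contr_wlie[OF c a b] carr])
  then have 2: "contr b (vdeg (wlie a c)) as bs xs = vdeg (wlie a (contr b c)) as bs xs
      - vdeg (contr (br a b) c) as bs xs + core_contr (C b) (wlie a c) as bs xs"
    by (simp add: contr_vdeg vdeg_diff)
  have 3: "contr b (core_contr (C a) (wdelta c)) as bs xs =
      core_contr (C a) (wdelta (contr b c)) as bs xs - core_contr (C a) (wlie b c) as bs xs"
    by (simp add: contr_core_contr contr_wdelta core_contr_def lsum_simps scaleR_diff_right)
  have "wdelta (contr b (core_contr (C a) c)) as bs xs = - wdelta (core_contr (C a) (contr b c)) as bs xs"
    unfolding contr_core_contr by (rule wdelta_minus[OF gka carr])
  then have 4: "contr b (wdelta (core_contr (C a) c)) as bs xs =
      wlie b (core_contr (C a) c) as bs xs + wdelta (core_contr (C a) (contr b c)) as bs xs"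
    by (simp add: contr_wdelta)
  have 5: "wlie a (core_contr (C b) c) as bs xs - core_contr (C b) (wlie a c) as bs xs =
      core_contr (\<lambda>x. br a (C b x) - C b (act a x)) c as bs xs"
    by (rule wlie_core_contr[OF c a _ carr]) (use C_S b in auto)
  have 6: "wlie b (core_contr (C a) c) as bs xs - core_contr (C a) (wlie b c) as bs xs =
      core_contr (\<lambda>x. br b (C a x) - C a (act b x)) c as bs xs"
    by (rule wlie_core_contr[OF c b _ carr]) (use C_S a in auto)
  have 7: "core_contr (\<lambda>x. br a (C b x) - C b (act a x)) c as bs xs -
      core_contr (\<lambda>x. br b (C a x) - C a (act b x)) c as bs xs = core_contr (C (br a b)) c as bs xs"
    by (rule core_contr_theta_diff[OF c _ _ carr])
      (use a b in \<open>auto simp: conn1 C_S br_S act_V intro!: subspace_diff[OF subspace_S]\<close>)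
  have "contr b (wlie a (vdeg c)) as bs xs - contr b (vdeg (wlie a c)) as bs xs =
    contr b (core_contr (C a) (wdelta c)) as bs xs + contr b (wdelta (core_contr (C a) c)) as bs xs"
    using Cons.IH[OF gb as] 5 6 7 unfolding 1 2 3 4 by (simp add: algebra_simps)
  then show ?case
    unfolding Cons_contr[of _ b as] by (simp flip: scaleR_diff_right scaleR_add_right)
qed

text \<open>After contraction with \<open>b\<close>, Cartan's formula and \<open>contr_vdeg\<close>
  reduce the two sides to the induction hypothesis for \<open>contr b c\<close> and the identity
  \<open>wlie_vdeg\<close>.\<close>

lemma vdeg_wdelta:
  assumes c: "tensorial {} c" and carr: "set as \<subseteq> S" "set bs \<subseteq> S" "set xs \<subseteq> V"
  shows "vdeg (wdelta c) as bs xs = wdelta (vdeg c) as bs xs"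
  using c carr(1)
proof (induction as arbitrary: c)
  case Nil
  \<comment> \<open>The only obstruction is the term where \<open>v\<close> hits the argument that
    is fed to the anchor; there \<open>rh (v b) = 0\<close>.\<close>
  have "ssum bs (\<lambda>b bs. c [] bs (rh (v b) # xs) + dsum bs v (\<lambda>bs. c [] bs (rh b # xs))) =
     ssum bs (\<lambda>b bs. dsum bs v (\<lambda>bs. c [] bs (rh b # xs)))"
    by (rule ssum_cong[OF carr(2)]) (use v_K rh_K tensorial_zeroV[OF Nil(1)] carr in auto)
  then show ?case
    by (simp add: vdeg_def dsum_minus dsum_sign dsum_ssum)
next
  case (Cons b as)
  note c = Cons.prems(1)
  have b: "b \<in> S" and as: "set as \<subseteq> S" using Cons.prems by auto
  note carr = as \<open>set bs \<subseteq> S\<close> \<open>set xs \<subseteq> V\<close>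
  have gb: "tensorial {} (contr b c)" by (rule tensorial_contr[OF c b])
  have gkb: "tensorial {} (core_contr (C b) c)" by (rule tensorial_core_contr[OF c]) (use C_S C_add b in auto)
  have "contr b (vdeg (wdelta c)) as bs xs = vdeg (wlie b c) as bs xs - vdeg (wdelta (contr b c)) as bs xs + core_contr (C b) (wdelta c) as bs xs"
    by (simp add: contr_vdeg contr_wdelta vdeg_diff)
  moreover have "contr b (wdelta (vdeg c)) as bs xs = wlie b (vdeg c) as bs xs - wdelta (vdeg (contr b c)) as bs xs - wdelta (core_contr (C b) c) as bs xs"
    using wdelta_add[OF tensorial_vdeg[OF gb] gkb carr] by (simp add: contr_wdelta contr_vdeg)
  moreover have "wlie b (vdeg c) as bs xs =
      core_contr (C b) (wdelta c) as bs xs + wdelta (core_contr (C b) c) as bs xs + vdeg (wlie b c) as bs xs"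
    using wlie_vdeg[OF c b carr] by (simp only: diff_eq_eq)
  ultimately have "contr b (vdeg (wdelta c)) as bs xs = contr b (wdelta (vdeg c)) as bs xs"
    using Cons.IH[OF gb as] by simp
  then show ?case unfolding Cons_contr[of _ b as] by simp
qed

end

section \<open>The horizontal projection\<close>

context ideal_conn
begin

definition hmap :: "'g \<Rightarrow> 'g" where
  "hmap b = b - v b"

text \<open>The projection \<open>\<alpha> \<mapsto> \<alpha> - C \<alpha>\<close> is applied to one argument after the other;
  \<open>hproj_expand\<close> multiplies this out into the sum over shuffles.\<close>

fun hproj :: "('g, 'x) raw \<Rightarrow> ('g, 'x) raw" where
  "hproj c [] bs xs = c [] (map hmap bs) xs"
| "hproj c (a # as) bs xs = (-1) ^ length bs *\<^sub>R hproj (contr a c - core_contr (C a) c) as bs xs"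

lemma hmap_S: "b \<in> S \<Longrightarrow> hmap b \<in> S"
  unfolding hmap_def by (intro subspace_diff[OF subspace_S] v_S)

lemma v_hmap: "b \<in> S \<Longrightarrow> v (hmap b) = 0"
proof -
  assume b: "b \<in> S"
  have "v (hmap b + v b) = v (hmap b) + v (v b)"
    by (rule lin_on_addD[OF v_lin]) (use b hmap_S v_S in auto)
  then show ?thesis using b v_id[OF v_K[OF b]] by (simp add: hmap_def)
qed

lemma set_map_hmap: "set bs \<subseteq> S \<Longrightarrow> set (map hmap bs) \<subseteq> S"
  using hmap_S by auto

lemma hproj_cong:
  assumes "\<And>as bs xs. set as \<subseteq> S \<Longrightarrow> set bs \<subseteq> S \<Longrightarrow> set xs \<subseteq> V \<Longrightarrow> c as bs xs = d as bs xs"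
    and "set as \<subseteq> S" "set bs \<subseteq> S" "set xs \<subseteq> V"
  shows "hproj c as bs xs = hproj d as bs xs"
  using assms
proof (induction as arbitrary: c d)
  case Nil
  then show ?case using set_map_hmap by simp
next
  case (Cons a as)
  have "hproj (contr a c - core_contr (C a) c) as bs xs = hproj (contr a d - core_contr (C a) d) as bs xs"
  proof (rule Cons.IH)
    fix as' bs' xs' assume "set as' \<subseteq> S" "set bs' \<subseteq> S" "set xs' \<subseteq> V"
    then show "(contr a c - core_contr (C a) c) as' bs' xs' = (contr a d - core_contr (C a) d) as' bs' xs'"
      using contr_cong[of c d a as' bs' xs'] core_contr_cong[of c d "C a" as' bs' xs'] Cons.prems C_S by simp
  qed (use Cons.prems in auto)
  then show ?case by simp
qed

lemma hproj_add: "hproj (c + d) as bs xs = hproj c as bs xs + hproj d as bs xs"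
proof (induction as arbitrary: c d)
  case (Cons a as)
  have "contr a (c + d) - core_contr (C a) (c + d) = (contr a c - core_contr (C a) c) + (contr a d - core_contr (C a) d)"
    by (simp add: contr_add core_contr_add)
  then show ?case by (simp only: hproj.simps Cons.IH scaleR_add_right)
qed simp

lemma tensorial_core_contrC: "tensorial Q c \<Longrightarrow> a \<in> S \<Longrightarrow> tensorial Q (core_contr (C a) c)"
  by (rule tensorial_core_contr) (use C_S C_lin lin_on_mono tensorial_R in blast)+

text \<open>In \<open>core_contr \<theta> (vdeg c)\<close> the inserted value
  \<open>\<theta> x\<close> is itself counted, once since it is vertical; in
  \<open>vdeg (core_contr \<theta> c)\<close> it is not. All other terms agree.\<close>

lemma vdeg_core_contr:
  assumes c: "tensorial {} c" and \<theta>: "\<And>x. x \<in> V \<Longrightarrow> \<theta> x \<in> K"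
    and carr: "set as \<subseteq> S" "set bs \<subseteq> S" "set xs \<subseteq> V"
  shows "vdeg (core_contr \<theta> c) as bs xs = core_contr \<theta> (vdeg c) as bs xs - core_contr \<theta> c as bs xs"
proof -
  let ?s = "(-1) ^ length bs :: real"
  have \<theta>S: "\<theta> x \<in> S" if "x \<in> V" for x using \<theta>[OF that] K_inS by blast
  \<comment> \<open>Both orders of the operators insert \<open>C a\<close> and \<theta> at two
    vector fields. The symmetric slots do not see the order, but choosing the vector fields in the
    other order costs a sign.\<close>
  have 1: "asum xs (\<lambda>x ys. asum ys (\<lambda>y zs. c as (C a y # \<theta> x # bs) zs)) =
      - asum xs (\<lambda>x ys. asum ys (\<lambda>y zs. c as (\<theta> y # C a x # bs) zs))"
    if "a \<in> S" "set as \<subseteq> S" for a as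
  proof -
    have "asum xs (\<lambda>x ys. asum ys (\<lambda>y zs. c as (C a y # \<theta> x # bs) zs)) =
        asum xs (\<lambda>x ys. asum ys (\<lambda>y zs. c as (\<theta> x # C a y # bs) zs))"
    proof (rule asum_cong[OF carr(3)], rule asum_cong[where V = V])
      fix x ys y zs assume "x \<in> V" "y \<in> V" "set zs \<subseteq> V"
      then show "c as (C a y # \<theta> x # bs) zs = c as (\<theta> x # C a y # bs) zs"
        using symm_onD[OF tensorial_symm[OF c], of as zs "[]" bs "C a y" "\<theta> x"] that carr \<theta>S C_S by simp
    qed
    then show ?thesis
      by (subst (asm) asum_asum_swap) simp
  qed
  have "asum as (\<lambda>a as. asum xs (\<lambda>x ys. asum ys (\<lambda>y zs. c as (C a y # \<theta> x # bs) zs))) =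
     asum as (\<lambda>a as. - asum xs (\<lambda>x ys. asum ys (\<lambda>y zs. c as (\<theta> y # C a x # bs) zs)))"
    by (rule asum_cong[OF carr(1)]) (use 1 in auto)
  then have 2: "asum xs (\<lambda>x ys. asum as (\<lambda>a as. asum ys (\<lambda>y zs. c as (C a y # \<theta> x # bs) zs))) =
     - asum as (\<lambda>a as. asum xs (\<lambda>x ys. asum ys (\<lambda>y zs. c as (\<theta> y # C a x # bs) zs)))"
    by (subst asum_asum_commute[symmetric]) (simp only: asum_minus)
  have 3: "asum xs (\<lambda>x ys. c as (v (\<theta> x) # bs) ys) = asum xs (\<lambda>x ys. c as (\<theta> x # bs) ys)"
    by (rule asum_cong[OF carr(3)]) (use \<theta> v_id in auto)
  have "core_contr \<theta> (vdeg c) as bs xs = ?s *\<^sub>R (asum xs (\<lambda>x ys. asum as (\<lambda>a as. asum ys (\<lambda>y zs. c as (C a y # \<theta> x # bs) zs)))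
      + asum xs (\<lambda>x ys. c as (v (\<theta> x) # bs) ys) + asum xs (\<lambda>x ys. dsum bs v (\<lambda>bs. c as (\<theta> x # bs) ys)))"
    by (simp add: core_contr_def vdeg_def lsum_simps scaleR_add_right)
  moreover have "vdeg (core_contr \<theta> c) as bs xs = ?s *\<^sub>R (- asum as (\<lambda>a as. asum xs (\<lambda>x ys. asum ys (\<lambda>y zs. c as (\<theta> y # C a x # bs) zs)))
      + asum xs (\<lambda>x ys. dsum bs v (\<lambda>bs. c as (\<theta> x # bs) ys)))"
    by (simp add: core_contr_def vdeg_def lsum_simps dsum_sign dsum_asum_commute scaleR_add_right scaleR_diff_right)
  ultimately show ?thesis
    unfolding 2 3 by (simp add: core_contr_def scaleR_add_right scaleR_diff_right)
qed

text \<open>The extra terms of \<open>contr_vdeg\<close> and \<open>vdeg_core_contr\<close> cancel,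
  so \<open>vdeg\<close> commutes with each step \<open>contr a c - core_contr (C a) c\<close> of
  the projection. It thus reaches the case without alternating arguments, where it applies
  \<open>v\<close> to some \<open>hmap b\<close> and gives zero.\<close>

lemma hproj_vdeg:
  assumes c: "tensorial {} c" and carr: "set as \<subseteq> S" "set bs \<subseteq> S" "set xs \<subseteq> V"
  shows "hproj (vdeg c) as bs xs = 0"
  using c carr(1)
proof (induction as arbitrary: c)
  case Nil
  have "dsum (map hmap bs) v (\<lambda>bs. c [] bs xs) = ssum (map hmap bs) (\<lambda>b bs. c [] (v b # bs) xs)"
    by (rule dsum_eq_ssum[OF tensorial_symm[OF Nil(1)] set_map_hmap[OF carr(2)]]) (use carr v_S in auto)
  also have "\<dots> = ssum (map hmap bs) (\<lambda>_ _. 0)"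
  proof (rule ssum_cong[where V = "hmap ` S"])
    fix y ys assume "y \<in> hmap ` S" "set ys \<subseteq> hmap ` S"
    moreover from this have "set ys \<subseteq> S" using hmap_S by blast
    ultimately show "c [] (v y # ys) xs = 0"
      using v_hmap tensorial_zeroS[OF Nil(1), of "[]" ys xs] carr by auto
  qed (use carr in auto)
  finally show ?case by (simp add: vdeg_def)
next
  case (Cons a as)
  have "hproj (contr a (vdeg c) - core_contr (C a) (vdeg c)) as bs xs = hproj (vdeg (contr a c - core_contr (C a) c)) as bs xs"
  proof (rule hproj_cong)
    fix as' bs' xs' assume "set as' \<subseteq> S" "set bs' \<subseteq> S" "set xs' \<subseteq> V"
    from vdeg_core_contr[OF Cons.prems(1) _ this, of "C a"]
    show "(contr a (vdeg c) - core_contr (C a) (vdeg c)) as' bs' xs' = vdeg (contr a c - core_contr (C a) c) as' bs' xs'"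
      using Cons.prems C_K by (simp add: contr_vdeg vdeg_diff)
  qed (use Cons.prems carr in auto)
  also have "\<dots> = 0"
    by (intro Cons.IH tensorial_diff tensorial_contr tensorial_core_contrC) (use Cons.prems in simp_all)
  finally show ?case by simp
qed

text \<open>Cochains that vanish on at least \<open>r\<close> vertical arguments. On those that vanish on \<open>r + 1\<close> of them,
  \<open>vdeg\<close> acts as multiplication by \<open>r\<close> up to cochains vanishing on \<open>r\<close> of them.\<close>

definition horizontal :: "nat \<Rightarrow> ('g, 'x) raw \<Rightarrow> bool" where
  "horizontal r c \<longleftrightarrow> (\<forall>as ks bs xs. set as \<subseteq> S \<longrightarrow> set ks \<subseteq> K \<longrightarrow> set bs \<subseteq> S \<longrightarrow> set xs \<subseteq> V \<longrightarrow>
     length ks = r \<longrightarrow> c as (ks @ bs) xs = 0)"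

lemma horD: "horizontal r c \<Longrightarrow> set as \<subseteq> S \<Longrightarrow> set ks \<subseteq> K \<Longrightarrow> set bs \<subseteq> S \<Longrightarrow> set xs \<subseteq> V \<Longrightarrow>
    length ks = r \<Longrightarrow> c as (ks @ bs) xs = 0"
  unfolding horizontal_def by blast

lemma horizontal_1: "horizontal 1 c \<Longrightarrow> set as \<subseteq> S \<Longrightarrow> k \<in> K \<Longrightarrow> set bs \<subseteq> S \<Longrightarrow> set xs \<subseteq> V \<Longrightarrow> c as (k # bs) xs = 0"
  using horD[of 1 c as "[k]" bs xs] by simp

text \<open>Each entry of \<open>ks\<close> contributes one copy, because \<open>v\<close> fixes it.
  Projecting any other argument would produce one vertical argument more than the length of
  \<open>ks\<close>, where \<open>c\<close> vanishes.\<close>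

lemma vdeg_horizontal:
  assumes c: "tensorial {} c" "horizontal (Suc (length ks)) c"
    and carr: "set as \<subseteq> S" "set ks \<subseteq> K" "set bs \<subseteq> S" "set xs \<subseteq> V"
  shows "vdeg c as (ks @ bs) xs = real (length ks) *\<^sub>R c as (ks @ bs) xs"
proof -
  have ksS: "set ks \<subseteq> S" using carr K_S by auto
  have 1: "asum as (\<lambda>a as. asum xs (\<lambda>x xs. c as (C a x # ks @ bs) xs)) =
      asum as (\<lambda>a as. asum xs (\<lambda>x xs. 0))"
  proof (rule asum_cong[OF carr(1)], rule asum_cong[OF carr(4)])
    fix a as x xs assume "a \<in> S" "set as \<subseteq> S" "x \<in> V" "set xs \<subseteq> V"
    then show "c as (C a x # ks @ bs) xs = 0"
      using horD[OF c(2), of as "C a x # ks" bs xs] carr C_K by simp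
  qed
  have 2: "dsum ks v (\<lambda>ys. c as (ys @ bs) xs) = dsum ks (\<lambda>x. x) (\<lambda>ys. c as (ys @ bs) xs)"
    by (rule dsum_fun_cong[OF carr(2)]) (use v_id in auto)
  have sy: "symm_on S (\<lambda>ys. c as (ks @ ys) xs)"
  proof (rule symm_onI)
    fix us vs x y assume "set us \<subseteq> S" "set vs \<subseteq> S" "x \<in> S" "y \<in> S"
    then show "c as (ks @ us @ x # y # vs) xs = c as (ks @ us @ y # x # vs) xs"
      using symm_onD[OF tensorial_symm[OF c(1) carr(1,4)], of "ks @ us" vs x y] ksS by simp
  qed
  have "dsum bs v (\<lambda>ys. c as (ks @ ys) xs) = ssum bs (\<lambda>y ys. c as (ks @ v y # ys) xs)"
    by (rule dsum_eq_ssum[OF sy carr(3)]) (use v_S in auto)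
  also have "\<dots> = ssum bs (\<lambda>_ _. 0)"
  proof (rule ssum_cong[OF carr(3)])
    fix y ys assume "y \<in> S" "set ys \<subseteq> S"
    then show "c as (ks @ v y # ys) xs = 0"
      using horD[OF c(2), of as "ks @ [v y]" ys xs] carr v_K by simp
  qed
  finally show ?thesis by (simp add: vdeg_def dsum_append 1 2 dsum_ident)
qed

text \<open>On \<open>r\<close> vertical arguments \<open>vdeg\<close> is multiplication by
  \<open>r\<close>, so subtracting its \<open>r\<close>-th part leaves zero.\<close>

lemma horizontal_step:
  assumes c: "tensorial {} c" "horizontal (Suc r) c" and r: "r > 0"
  shows "horizontal r (c - (1 / real r) *\<^sub>R vdeg c)"
  unfolding horizontal_def
proof (intro allI impI)
  fix as ks bs xs
  assume carr: "set as \<subseteq> S" "set ks \<subseteq> K" "set bs \<subseteq> S" "set xs \<subseteq> V" and l: "length ks = r"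
  show "(c - (1 / real r) *\<^sub>R vdeg c) as (ks @ bs) xs = 0"
    using vdeg_horizontal[OF c(1) _ carr] c(2) l r by (simp add: scaleR_fun_def)
qed

text \<open>If \<open>c\<close> vanishes on \<open>r + 1\<close> vertical arguments, then on
  \<open>r\<close> of them \<open>r\<close> times the value of \<open>c\<close> equals that of
  \<open>vdeg c\<close>, which is zero. So the bound descends until \<open>r = 1\<close>.\<close>

lemma horizontal_ker:
  assumes c: "tensorial {} c" "horizontal (Suc r) c"
    and vdeg: "\<And>as bs xs. set as \<subseteq> S \<Longrightarrow> set bs \<subseteq> S \<Longrightarrow> set xs \<subseteq> V \<Longrightarrow> vdeg c as bs xs = 0"
  shows "horizontal 1 c"
  using c(2)
proof (induction r)
  case (Suc r)
  have "horizontal (Suc r) c"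
    unfolding horizontal_def
  proof (intro allI impI)
    fix as ks bs xs
    assume carr: "set as \<subseteq> S" "set ks \<subseteq> K" "set bs \<subseteq> S" "set xs \<subseteq> V" and l: "length ks = Suc r"
    then have "set (ks @ bs) \<subseteq> S" using K_S by auto
    from vdeg[OF carr(1) this carr(4)] show "c as (ks @ bs) xs = 0"
      using vdeg_horizontal[OF c(1) _ carr] Suc.prems l by (simp del: of_nat_Suc)
  qed
  then show ?case by (rule Suc.IH)
qed simp

lemma vdeg_of_horizontal:
  assumes c: "tensorial {} c" "horizontal 1 c" and carr: "set as \<subseteq> S" "set bs \<subseteq> S" "set xs \<subseteq> V"
  shows "vdeg c as bs xs = 0"
  using vdeg_horizontal[OF c(1), of "[]" as bs xs] c(2) carr by simp

text \<open>\<open>horizontal_step\<close> is iterated while the corrections are collected in a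
  single \<open>e\<close>. The class \<open>W\<close> is kept abstract: it serves to remember the
  Leibniz rule and the degrees, none of which matters for the descent.\<close>

lemma horizontal_decomp:
  assumes W: "\<And>c. W c \<Longrightarrow> tensorial {} c" "\<And>c d. W c \<Longrightarrow> W d \<Longrightarrow> W (c + d)"
      "\<And>c r. W c \<Longrightarrow> W (r *\<^sub>R c)" "\<And>c. W c \<Longrightarrow> W (vdeg c)"
    and c: "W c" "horizontal (Suc r) c"
  shows "\<exists>e. W e \<and> horizontal 1 (c - vdeg e)"
  using c
proof (induction r arbitrary: c)
  case 0
  \<comment> \<open>\<open>c\<close> is already horizontal and \<open>e\<close> is zero, written as
    a multiple of \<open>c\<close> because this makes membership in \<open>W\<close>
    immediate.\<close>
  have "W (0 *\<^sub>R c)" using 0 W(3) by blast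
  moreover have "c - vdeg (0 *\<^sub>R c) = c" using vdeg_scaleR[of 0 c] by simp
  ultimately show ?case using 0 by (metis One_nat_def)
next
  case (Suc r)
  let ?c = "c - (1 / real (Suc r)) *\<^sub>R vdeg c"
  have W': "W (c + (- (1 / real (Suc r))) *\<^sub>R vdeg c)"
    by (intro W(2,3,4) Suc.prems)
  then have "W ?c" by simp
  moreover have "horizontal (Suc r) ?c"
    by (rule horizontal_step) (use Suc.prems W in auto)
  ultimately obtain e where e: "W e" "horizontal 1 (?c - vdeg e)" using Suc.IH by blast
  \<comment> \<open>The correction made at this level and the one from the induction hypothesis are
    both images of \<open>vdeg\<close> and are merged.\<close>
  have "?c - vdeg e = c - vdeg ((1 / real (Suc r)) *\<^sub>R c + e)"
    unfolding vdeg_add vdeg_scaleR by (simp add: algebra_simps)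
  then have "horizontal 1 (c - vdeg ((1 / real (Suc r)) *\<^sub>R c + e))" using e(2) by (simp only:)
  moreover have "W ((1 / real (Suc r)) *\<^sub>R c + e)"
    by (intro W(2,3) Suc.prems e)
  ultimately show ?case by blast
qed

text \<open>Each \<open>b\<close> is \<open>hmap b + v b\<close>, and the summand with the vertical
  argument \<open>v b\<close> vanishes.\<close>

lemma horizontal_map_hmap:
  assumes c: "tensorial {} c" "horizontal 1 c" and carr: "set as \<subseteq> S" "set us \<subseteq> S" "set bs \<subseteq> S" "set xs \<subseteq> V"
  shows "c as (us @ map hmap bs) xs = c as (us @ bs) xs"
  using carr(2,3)
proof (induction bs arbitrary: us)
  case (Cons b bs)
  then have b: "b \<in> S" "hmap b \<in> S" "v b \<in> S" using hmap_S v_S by auto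
  have m: "set (map hmap bs) \<subseteq> S" using Cons.prems set_map_hmap by simp
  have "c as (us @ (hmap b + v b) # map hmap bs) xs = c as (us @ hmap b # map hmap bs) xs + c as (us @ v b # map hmap bs) xs"
    by (rule lin_on_addD[OF mlin_onD[OF tensorial_mlinS[OF c(1) carr(1,4)] Cons.prems(1) m] b(2,3)])
  moreover have "c as (us @ v b # map hmap bs) xs = c as (v b # us @ map hmap bs) xs"
    using symm_on_move[OF tensorial_symm[OF c(1) carr(1,4)], of "[]" us "map hmap bs" "v b"] Cons.prems m b by simp
  moreover have "c as (v b # us @ map hmap bs) xs = 0"
    by (rule horizontal_1[OF c(2)]) (use carr Cons.prems m b v_K in auto)
  moreover have "c as ((us @ [b]) @ map hmap bs) xs = c as ((us @ [b]) @ bs) xs"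
    by (rule Cons.IH) (use Cons.prems in auto)
  moreover have "hmap b + v b = b" by (simp add: hmap_def)
  ultimately show ?case by simp
qed simp

text \<open>The values of \<open>C a\<close> lie in the ideals, so every
  \<open>core_contr (C a)\<close> vanishes and only the contractions are left.\<close>

lemma hproj_horizontal:
  assumes c: "tensorial {} c" "horizontal 1 c" and carr: "set as \<subseteq> S" "set bs \<subseteq> S" "set xs \<subseteq> V"
  shows "hproj c as bs xs = c as bs xs"
  using c carr(1)
proof (induction as arbitrary: c)
  case Nil
  then show ?case using horizontal_map_hmap[OF Nil(1,2), of "[]" "[]"] carr by simp
next
  case (Cons a as)
  have "hproj (contr a c - core_contr (C a) c) as bs xs = hproj (contr a c) as bs xs"
  proof (rule hproj_cong)
    fix as' bs' xs' assume carr': "set as' \<subseteq> S" "set bs' \<subseteq> S" "set xs' \<subseteq> V"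
    have "asum xs' (\<lambda>x ys. c as' (C a x # bs') ys) = asum xs' (\<lambda>_ _. 0)"
      by (rule asum_cong[OF carr'(3)]) (use horizontal_1[OF Cons.prems(2)] carr' C_K Cons.prems in auto)
    then show "(contr a c - core_contr (C a) c) as' bs' xs' = contr a c as' bs' xs'"
      by (simp add: core_contr_def)
  qed (use Cons.prems carr in auto)
  also have "\<dots> = contr a c as bs xs"
  proof (rule Cons.IH)
    show "horizontal 1 (contr a c)"
      unfolding horizontal_def
    proof (intro allI impI)
      fix as ks bs xs
      assume "set as \<subseteq> S" "set ks \<subseteq> K" "set bs \<subseteq> S" "set xs \<subseteq> V" "length ks = 1"
      then show "contr a c as (ks @ bs) xs = 0"
        using horD[OF Cons.prems(2), of "a # as" ks bs xs] Cons.prems(3) by (simp add: contr_def)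
    qed
  qed (use Cons.prems tensorial_contr in auto)
  finally show ?case by (simp add: contr_def)
qed

text \<open>\<open>wdelta\<close> recurses on the alternating arguments, so all properties are
  proved together for one list \<open>as\<close>, with the cochain generalised.\<close>

lemma tensorial_wdelta:
  assumes c: "tensorial {} c"
  shows "tensorial {} (wdelta c)"
proof -
  have l: "\<And>f. f \<in> {} \<Longrightarrow> linear (smS f)" by simp
  have "(\<forall>bs xs. set bs \<subseteq> S \<longrightarrow> set xs \<subseteq> V \<longrightarrow> wdelta c as bs xs \<in> K) \<and>
     (\<forall>xs. set xs \<subseteq> V \<longrightarrow>
       symm_on S (\<lambda>bs. wdelta c as bs xs) \<and> mlin_on {} smS smS S (\<lambda>bs. wdelta c as bs xs)) \<and>
     (\<forall>bs. set bs \<subseteq> S \<longrightarrow>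
       alt_on V (\<lambda>xs. wdelta c as bs xs) \<and> mlin_on {} smV smS V (\<lambda>xs. wdelta c as bs xs))"
    if "set as \<subseteq> S" for as
    using c that
  proof (induction as arbitrary: c)
    case Nil
    note c = Nil(1)
    have in1: "set (rh b # xs) \<subseteq> V" if "b \<in> S" "set xs \<subseteq> V" for b xs using that rh_V by auto
    have e: "set ([] :: 'g list) \<subseteq> S" by simp
    have e': "set ([] :: 'x list) \<subseteq> V" by simp
    have K: "wdelta c [] bs xs \<in> K" if "set bs \<subseteq> S" "set xs \<subseteq> V" for bs xs
      unfolding wdelta.simps using that
      by (intro subspace_neg[OF subspace_K] subspace_scale[OF subspace_K]
        ssum_in[OF subspace_K, where V = S] tensorial_K[OF c e] in1)
    have sy: "symm_on S (\<lambda>bs. wdelta c [] bs xs)" if "set xs \<subseteq> V" for xs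
    proof -
      have "symm_on S (\<lambda>bs. (-1) *\<^sub>R ((-1) ^ length bs *\<^sub>R ssum bs (\<lambda>b bs. c [] bs (rh b # xs))))"
        using that by (intro symm_on_scaleR symm_on_sign symm_on_ssum tensorial_symm[OF c e] in1)
      then show ?thesis by simp
    qed
    have ml: "mlin_on {} smS smS S (\<lambda>bs. wdelta c [] bs xs)" if xs: "set xs \<subseteq> V" for xs
    proof -
      have 1: "lin_on {} smS smS S (\<lambda>b. c [] bs (rh b # xs))" if "set bs \<subseteq> S" for bs
        using tensorial_linV[OF c e that xs] rh_V by (simp add: lin_on_def rh_add)
      have "mlin_on {} smS smS S (\<lambda>bs. (-1) *\<^sub>R ((-1) ^ length bs *\<^sub>R ssum bs (\<lambda>b bs. c [] bs (rh b # xs))))"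
        using xs by (intro mlin_on_scaleR[OF l] mlin_on_sign[OF l] mlin_on_ssum[OF l]
          tensorial_mlinS[OF c e] in1 1)
      then show ?thesis by simp
    qed
    have al: "alt_on V (\<lambda>xs. wdelta c [] bs xs)" if bs: "set bs \<subseteq> S" for bs
    proof -
      have "alt_on V (\<lambda>xs. c [] bs (rh b # xs))" if "b \<in> S" "set bs \<subseteq> S" for b bs
        by (rule alt_on_Cons[OF tensorial_alt[OF c e that(2)] rh_V[OF that(1)]])
      then have "alt_on V (\<lambda>xs. (-1) *\<^sub>R ((-1) ^ length bs *\<^sub>R ssum bs (\<lambda>b bs. c [] bs (rh b # xs))))"
        by (intro alt_on_scaleR alt_on_outer_ssum[OF bs])
      then show ?thesis by simp
    qed
    have mV: "mlin_on {} smV smS V (\<lambda>xs. wdelta c [] bs xs)" if bs: "set bs \<subseteq> S" for bs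
    proof -
      have m: "mlin_on {} smV smS V (\<lambda>xs. c [] bs (rh b # xs))" if "b \<in> S" "set bs \<subseteq> S" for b bs
        by (rule mlin_on_Cons[OF tensorial_mlinV[OF c e that(2)] rh_V[OF that(1)]])
      have "mlin_on {} smV smS V (\<lambda>xs. ssum bs (\<lambda>b bs. c [] bs (rh b # xs)))"
      proof (rule mlin_onI)
        fix us vs assume uv: "set us \<subseteq> V" "set vs \<subseteq> V"
        show "lin_on {} smV smS V (\<lambda>x. ssum bs (\<lambda>b bs. c [] bs (rh b # us @ x # vs)))"
          by (rule lin_on_ssum[OF l bs]) (use mlin_onD[OF m uv] in auto)
      qed
      then have "mlin_on {} smV smS V (\<lambda>xs. (-1) *\<^sub>R ((-1) ^ length bs *\<^sub>R ssum bs (\<lambda>b bs. c [] bs (rh b # xs))))"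
        by (intro mlin_on_scaleR[OF l])
      then show ?thesis by simp
    qed
    show ?case using K sy ml al mV by blast
  next
    case (Cons a as)
    then have a: "a \<in> S" and as: "set as \<subseteq> S" by auto
    note L = tensorial_wlie[OF Cons.prems(1) a]
    note IH = Cons.IH[OF tensorial_contr[OF Cons.prems(1) a] as]
    have K: "wdelta c (a # as) bs xs \<in> K" if "set bs \<subseteq> S" "set xs \<subseteq> V" for bs xs
      unfolding wdelta.simps using IH that
      by (intro subspace_scale[OF subspace_K] subspace_diff[OF subspace_K] tensorial_K[OF L as]) blast+
    have sy: "symm_on S (\<lambda>bs. wdelta c (a # as) bs xs)" if "set xs \<subseteq> V" for xs
      unfolding wdelta.simps using IH that
      by (intro symm_on_sign symm_on_diff tensorial_symm[OF L as]) blast+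
    have ml: "mlin_on {} smS smS S (\<lambda>bs. wdelta c (a # as) bs xs)" if "set xs \<subseteq> V" for xs
      unfolding wdelta.simps using IH that
      by (intro mlin_on_sign[OF l] mlin_on_diff[OF l] tensorial_mlinS[OF L as]) blast+
    have al: "alt_on V (\<lambda>xs. wdelta c (a # as) bs xs)" if "set bs \<subseteq> S" for bs
      unfolding wdelta.simps using IH that
      by (intro alt_on_scaleR alt_on_diff tensorial_alt[OF L as]) blast+
    have mV: "mlin_on {} smV smS V (\<lambda>xs. wdelta c (a # as) bs xs)" if "set bs \<subseteq> S" for bs
      unfolding wdelta.simps using IH that
      by (intro mlin_on_scaleR[OF l] mlin_on_diff[OF l] tensorial_mlinV[OF L as]) blast+
    show ?case using K sy ml al mV by blast
  qed
  then show ?thesis unfolding tensorial_def by blast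
qed

text \<open>\<open>P\<close> describes the lengths at which \<open>c\<close> may be nonzero. The
  differential evaluates \<open>c\<close> at two shapes only: one alternating argument fewer, or one
  symmetric argument fewer and one vector field more.\<close>

lemma wdelta_support:
  assumes "\<And>as bs xs. \<not> P (length as) (length bs) (length xs) \<Longrightarrow> c as bs xs = 0" and "set as \<subseteq> S"
    and "as \<noteq> [] \<Longrightarrow> \<not> P (length as - 1) (length bs) (length xs)"
    and "bs \<noteq> [] \<Longrightarrow> \<not> P (length as) (length bs - 1) (Suc (length xs))"
  shows "wdelta c as bs xs = 0"
  using assms
proof (induction as arbitrary: c P)
  case Nil
  have "ssum bs (\<lambda>b bs. c [] bs (rh b # xs)) = ssum bs (\<lambda>_ _. 0)"
  proof (rule ssum_cong[where V = UNIV])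
    fix y and ys :: "'g list" assume "Suc (length ys) = length bs"
    then have "bs \<noteq> []" "length ys = length bs - 1" by auto
    then show "c [] ys (rh y # xs) = 0" using Nil(4) by (intro Nil(1)) simp
  qed simp
  then show ?case by simp
next
  case (Cons a as)
  have 1: "wdelta (contr a c) as bs xs = 0"
  \<comment> \<open>The contraction has already used one alternating argument, so its support is
    shifted by one.\<close>
  proof (rule Cons.IH[of "\<lambda>n. P (Suc n)"])
    fix as bs :: "'g list" and xs :: "'x list" assume "\<not> P (Suc (length as)) (length bs) (length xs)"
    then show "contr a c as bs xs = 0" using Cons.prems(1)[of "a # as" bs xs] by (simp add: contr_def)
  qed (use Cons.prems in auto)
  have z: "c as' bs' xs' = 0"
    if "length as' = length as" "length bs' = length bs" "length xs' = length xs" for as' bs' xs'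
    by (rule Cons.prems(1)) (use that Cons.prems in auto)
  have "dsum bs (br a) (\<lambda>bs. c as bs xs) = dsum bs (br a) (\<lambda>_. 0)"
    "dsum as (br a) (\<lambda>as. c as bs xs) = dsum as (br a) (\<lambda>_. 0)"
    "dsum xs (act a) (\<lambda>xs. c as bs xs) = dsum xs (act a) (\<lambda>_. 0)"
    by (rule dsum_cong[where V = UNIV]; simp add: z)+
  then have "wlie a c as bs xs = 0"
    using Cons.prems by (simp add: wlie_def br_zero z)
  then show ?case using 1 by simp
qed

lemma vdeg_support:
  assumes "\<And>as bs xs. length bs > p \<Longrightarrow> c as bs xs = 0" and "length bs > p"
  shows "vdeg c as bs xs = 0"
proof -
  have "dsum bs v (\<lambda>bs. c as bs xs) = dsum bs v (\<lambda>_. 0)"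
    by (rule dsum_cong[where V = UNIV]) (use assms in auto)
  then show ?thesis using assms by (simp add: vdeg_def)
qed

text \<open>\<open>u\<close> is the horizontal representative of \<open>c\<close> modulo the image
  of \<open>vdeg\<close>. It is returned together with \<open>W u\<close>, from which membership of
  the projection among the Weil cochains will follow.\<close>

theorem hproj_wdelta:
  assumes W: "\<And>c. W c \<Longrightarrow> tensorial {} c" "\<And>c d. W c \<Longrightarrow> W d \<Longrightarrow> W (c + d)"
      "\<And>c r. W c \<Longrightarrow> W (r *\<^sub>R c)" "\<And>c. W c \<Longrightarrow> W (vdeg c)"
    and c: "W c" and p: "\<And>as bs xs. length bs > p \<Longrightarrow> c as bs xs = 0"
  shows "\<exists>u. W u \<and> horizontal 1 u \<and>
    (\<forall>as bs xs. set as \<subseteq> S \<longrightarrow> set bs \<subseteq> S \<longrightarrow> set xs \<subseteq> V \<longrightarrow>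
       hproj c as bs xs = u as bs xs \<and> hproj (wdelta c) as bs xs = wdelta u as bs xs)"
proof -
  \<comment> \<open>The bound on the number of symmetric arguments starts the descent:
    \<open>c\<close> vanishes on \<open>p + 1\<close> vertical arguments because it vanishes on
    \<open>p + 1\<close> symmetric ones.\<close>
  define W' where "W' c \<longleftrightarrow> W c \<and> (\<forall>as bs xs. length bs > p \<longrightarrow> c as bs xs = 0)" for c
  have W': "\<And>c. W' c \<Longrightarrow> tensorial {} c" "\<And>c d. W' c \<Longrightarrow> W' d \<Longrightarrow> W' (c + d)"
      "\<And>c r. W' c \<Longrightarrow> W' (r *\<^sub>R c)" "\<And>c. W' c \<Longrightarrow> W' (vdeg c)" "W' c"
    using W c p vdeg_support[where p = p] unfolding W'_def by (simp_all add: scaleR_fun_def)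
  have "horizontal (Suc p) c"
    unfolding horizontal_def using p by auto
  from horizontal_decomp[where W = W', OF W' this] obtain e where e: "W' e" "horizontal 1 (c - vdeg e)" by blast
  define u where "u = c - vdeg e"
  have "W' (c + (-1) *\<^sub>R vdeg e)" using W' e by blast
  then have u: "W' u" "horizontal 1 u" using e by (simp_all add: u_def)
  have cu: "c = u + vdeg e" by (simp add: u_def)
  have g: "tensorial {} c" "tensorial {} u" "tensorial {} e" using W' u e by blast+
  have dlu: "hproj (wdelta u) as bs xs = wdelta u as bs xs" if "set as \<subseteq> S" "set bs \<subseteq> S" "set xs \<subseteq> V" for as bs xs
  proof (rule hproj_horizontal[OF tensorial_wdelta[OF g(2)] _ that])
    show "horizontal 1 (wdelta u)"
    proof (rule horizontal_ker[OF tensorial_wdelta[OF g(2)]])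
      \<comment> \<open>The differential can raise the number of symmetric arguments by one, hence
        \<open>p + 2\<close> instead of \<open>p + 1\<close>.\<close>
      show "horizontal (Suc (Suc p)) (wdelta u)"
        unfolding horizontal_def
      proof (intro allI impI)
        fix as ks bs :: "'g list" and xs :: "'x list"
        assume "set as \<subseteq> S" "length ks = Suc (Suc p)"
        then show "wdelta u as (ks @ bs) xs = 0"
          using u(1) by (intro wdelta_support[of "\<lambda>_ m _. m \<le> p"]) (auto simp: W'_def)
      qed
    next
      fix as bs xs assume carr: "set as \<subseteq> S" "set bs \<subseteq> S" "set xs \<subseteq> V"
      \<comment> \<open>\<open>vdeg u\<close> vanishes on the carrier only, so it is compared with
        the zero cochain, written as a multiple of \<open>u\<close>, by congruence.\<close>
      have "wdelta (vdeg u) as bs xs = wdelta (0 *\<^sub>R u) as bs xs"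
        by (rule wdelta_cong[OF _ carr]) (simp add: vdeg_of_horizontal[OF g(2) u(2)])
      also have "\<dots> = 0" using wdelta_scaleR[OF g(2) carr, of 0] by simp
      finally show "vdeg (wdelta u) as bs xs = 0" using vdeg_wdelta[OF g(2) carr] by simp
    qed
  qed
  have "hproj c as bs xs = u as bs xs \<and> hproj (wdelta c) as bs xs = wdelta u as bs xs"
    if carr: "set as \<subseteq> S" "set bs \<subseteq> S" "set xs \<subseteq> V" for as bs xs
  proof
    show "hproj c as bs xs = u as bs xs"
      unfolding cu hproj_add using hproj_vdeg[OF g(3) carr] hproj_horizontal[OF g(2) u(2) carr] by simp
    have "hproj (wdelta c) as bs xs = hproj (wdelta u + vdeg (wdelta e)) as bs xs"
    proof (rule hproj_cong[OF _ carr])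
      fix as bs xs assume carr: "set as \<subseteq> S" "set bs \<subseteq> S" "set xs \<subseteq> V"
      show "wdelta c as bs xs = (wdelta u + vdeg (wdelta e)) as bs xs"
        using wdelta_add[OF g(2) tensorial_vdeg[OF g(3)] carr] vdeg_wdelta[OF g(3) carr] by (simp add: cu)
    qed
    then show "hproj (wdelta c) as bs xs = wdelta u as bs xs"
      unfolding hproj_add using hproj_vdeg[OF tensorial_wdelta[OF g(3)] carr] dlu[OF carr] by simp
  qed
  then show ?thesis using u by (auto simp: W'_def)
qed

end

section \<open>Shuffles and permutations\<close>

lemma omit_0 [simp]: "omit 0 (x # xs) = xs"
  by (simp add: omit_def)

lemma omit_Suc [simp]: "omit (Suc i) (x # xs) = x # omit i xs"
  by (simp add: omit_def)

lemma length_omit: "i < length xs \<Longrightarrow> length (omit i xs) = length xs - 1"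
  by (auto simp: omit_def)

lemma nth_omit:
  "i < length xs \<Longrightarrow> j < length xs - 1 \<Longrightarrow> omit i xs ! j = (if j < i then xs ! j else xs ! Suc j)"
  by (auto simp: omit_def nth_append min_def)

lemma asum_index: "asum xs F = (\<Sum>i<length xs. (-1) ^ i *\<^sub>R F (xs ! i) (omit i xs))"
proof (induction xs arbitrary: F)
  case (Cons x xs)
  have "asum (x # xs) F = F x xs - (\<Sum>i<length xs. (-1) ^ i *\<^sub>R F (xs ! i) (x # omit i xs))"
    by (simp add: Cons.IH)
  also have "\<dots> = (\<Sum>i<length (x # xs). (-1) ^ i *\<^sub>R F ((x # xs) ! i) (omit i (x # xs)))"
    unfolding length_Cons sum.lessThan_Suc_shift by (simp add: sum_negf)
  finally show ?case .
qed simp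

lemma ssum_index: "ssum xs F = (\<Sum>i<length xs. F (xs ! i) (omit i xs))"
proof (induction xs arbitrary: F)
  case (Cons x xs)
  then show ?case unfolding length_Cons sum.lessThan_Suc_shift by simp
qed simp

lemma dsum_index: "dsum xs \<phi> F = (\<Sum>i<length xs. F (xs[i := \<phi> (xs ! i)]))"
proof (induction xs arbitrary: F)
  case (Cons x xs)
  then show ?case unfolding length_Cons sum.lessThan_Suc_shift by simp
qed simp

section \<open>Antisymmetrisation and the dotted wedge product\<close>

definition perm_sum :: "'x list \<Rightarrow> ('x list \<Rightarrow> 'v::real_vector) \<Rightarrow> 'v" where
  "perm_sum xs \<Phi> = (\<Sum>\<sigma> | \<sigma> permutes {..<length xs}.
     real_of_int (sign \<sigma>) *\<^sub>R \<Phi> (map (\<lambda>i. xs ! \<sigma> i) [0..<length xs]))"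

text \<open>\<open>permutation_insert i j p\<close> is known from the Laplace expansion of
  determinants: it sends \<open>i\<close> to \<open>j\<close> and is \<open>p\<close> on the
  renumbered rest. The factor is the cofactor sign.\<close>

lemma sign_permutation_insert:
  assumes "p permutes {..<n}" "i < Suc n" "j < Suc n"
  shows "real_of_int (sign (permutation_insert i j p)) = (-1) ^ (i + j) * real_of_int (sign p)"
  using signof_permutation_insert[of p n i j, where 'a = real] assms by (simp add: lessThan_atLeast0)

lemma permutation_insert_image:
  assumes "i < Suc n" "j < Suc n"
  shows "{p. p permutes {..<Suc n} \<and> p i = j} = permutation_insert i j ` {q. q permutes {..<n}}"
  using permutation_fix[OF assms] by (simp only: lessThan_atLeast0)

lemma permutation_insert_inj:
  assumes "i < Suc n" "j < Suc n"
  shows "inj_on (permutation_insert i j) {q. q permutes {..<n}}"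
  using permutation_insert_inj_on[OF assms] by (simp only: lessThan_atLeast0)

lemma perm_sum_Nil [simp]: "perm_sum [] \<Phi> = \<Phi> []"
proof -
  have "{\<sigma>. \<sigma> permutes {..<0::nat}} = {id}" by auto
  then show ?thesis by (simp add: perm_sum_def)
qed

text \<open>An expansion along the first place: permutations are grouped by the entry they put
  there. The empty list is excluded because its only permutation contributes
  \<open>\<Phi> []\<close>, whereas an empty \<open>asum\<close> is zero.\<close>

lemma perm_sum_rec:
  assumes "xs \<noteq> []"
  shows "perm_sum xs \<Phi> = asum xs (\<lambda>x ys. perm_sum ys (\<lambda>zs. \<Phi> (x # zs)))"
proof -
  obtain n where n: "length xs = Suc n" using assms by (cases xs) auto
  let ?t = "\<lambda>\<sigma>. real_of_int (sign \<sigma>) *\<^sub>R \<Phi> (map (\<lambda>i. xs ! \<sigma> i) [0..<Suc n])"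
  have fin: "finite {\<sigma>. \<sigma> permutes {..<Suc n}}" by (simp add: finite_permutations)
  have "perm_sum xs \<Phi> = (\<Sum>\<sigma> | \<sigma> permutes {..<Suc n}. ?t \<sigma>)"
    by (simp add: perm_sum_def n)
  also have "\<dots> = (\<Sum>s<Suc n. \<Sum>\<sigma> | \<sigma> \<in> {\<sigma>. \<sigma> permutes {..<Suc n}} \<and> \<sigma> 0 = s. ?t \<sigma>)"
  proof (rule sum.group[symmetric])
    show "(\<lambda>\<sigma>. \<sigma> 0) ` {\<sigma>. \<sigma> permutes {..<Suc n}} \<subseteq> {..<Suc n}"
      using permutes_in_image by fastforce
  qed (use fin in auto)
  also have "\<dots> = (\<Sum>s<Suc n. (-1) ^ s *\<^sub>R perm_sum (omit s xs) (\<lambda>zs. \<Phi> (xs ! s # zs)))"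
  proof (rule sum.cong[OF refl])
    fix s assume "s \<in> {..<Suc n}"
    then have s: "s < Suc n" by simp
    have lo: "length (omit s xs) = n" using s n by (simp add: length_omit)
    have "(\<Sum>\<sigma> | \<sigma> \<in> {\<sigma>. \<sigma> permutes {..<Suc n}} \<and> \<sigma> 0 = s. ?t \<sigma>) =
        (\<Sum>\<tau> | \<tau> permutes {..<n}. ?t (permutation_insert 0 s \<tau>))"
      using permutation_insert_image[of 0 n s] s sum.reindex[OF permutation_insert_inj[of 0 n s], of ?t]
      by simp
    also have "\<dots> = (\<Sum>\<tau> | \<tau> permutes {..<n}. (-1) ^ s *\<^sub>R (real_of_int (sign \<tau>) *\<^sub>R
        \<Phi> (xs ! s # map (\<lambda>i. omit s xs ! \<tau> i) [0..<n])))"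
    proof (rule sum.cong[OF refl])
      fix \<tau> assume "\<tau> \<in> {\<tau>. \<tau> permutes {..<n}}"
      then have \<tau>: "\<tau> permutes {..<n}" by simp
      have "map (\<lambda>i. xs ! permutation_insert 0 s \<tau> i) [0..<Suc n] =
          xs ! permutation_insert 0 s \<tau> 0 # map (\<lambda>i. xs ! permutation_insert 0 s \<tau> (Suc i)) [0..<n]"
        by (simp only: upt_conv_Cons[OF zero_less_Suc] list.map map_Suc_upt[symmetric] map_map o_def)
      also have "\<dots> = xs ! s # map (\<lambda>i. omit s xs ! \<tau> i) [0..<n]"
      proof -
        have "xs ! permutation_insert 0 s \<tau> (Suc i) = omit s xs ! \<tau> i" if "i < n" for i
        proof -
          have "\<tau> i < n" using permutes_in_image[OF \<tau>, of i] that by simp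
          then show ?thesis using s n by (simp add: permutation_insert_expand nth_omit)
        qed
        then show ?thesis by simp
      qed
      finally show "?t (permutation_insert 0 s \<tau>) = (-1) ^ s *\<^sub>R (real_of_int (sign \<tau>) *\<^sub>R
        \<Phi> (xs ! s # map (\<lambda>i. omit s xs ! \<tau> i) [0..<n]))"
        using sign_permutation_insert[OF \<tau>, of 0 s] s by simp
    qed
    also have "\<dots> = (-1) ^ s *\<^sub>R perm_sum (omit s xs) (\<lambda>zs. \<Phi> (xs ! s # zs))"
      by (simp add: perm_sum_def lo scaleR_sum_right)
    finally show "(\<Sum>\<sigma> | \<sigma> \<in> {\<sigma>. \<sigma> permutes {..<Suc n}} \<and> \<sigma> 0 = s. ?t \<sigma>) = \<dots>" .
  qed
  finally show ?thesis by (simp add: asum_index n)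
qed

text \<open>Moving the selected entry back to its place cancels its sign, so all terms are
  equal.\<close>

lemma asum_alt:
  assumes "alt_on V \<Phi>" "set xs \<subseteq> V"
  shows "asum xs (\<lambda>x ys. \<Phi> (x # ys)) = real (length xs) *\<^sub>R \<Phi> xs"
  using assms
proof (induction xs arbitrary: \<Phi>)
  case (Cons x xs)
  have "asum xs (\<lambda>y ys. \<Phi> (y # x # ys)) = asum xs (\<lambda>y ys. - \<Phi> (x # y # ys))"
  proof (rule asum_cong[where V = V])
    fix y ys assume "y \<in> V" "set ys \<subseteq> V"
    then show "\<Phi> (y # x # ys) = - \<Phi> (x # y # ys)"
      using alt_onD[OF Cons.prems(1), of "[]" ys y x] Cons.prems by simp
  qed (use Cons.prems in auto)
  also have "\<dots> = - (real (length xs) *\<^sub>R \<Phi> (x # xs))"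
    unfolding asum_minus
    using Cons.IH[OF alt_on_Cons[OF Cons.prems(1), of x]] Cons.prems by simp
  finally show ?case by (simp add: algebra_simps)
qed simp

lemma perm_sum_alt:
  assumes "alt_on V \<Phi>" "set xs \<subseteq> V"
  shows "perm_sum xs \<Phi> = fact (length xs) *\<^sub>R \<Phi> xs"
  using assms
proof (induction "length xs" arbitrary: xs \<Phi>)
  case (Suc n)
  then have "perm_sum xs \<Phi> = asum xs (\<lambda>x ys. perm_sum ys (\<lambda>zs. \<Phi> (x # zs)))"
    by (intro perm_sum_rec) auto
  also have "\<dots> = asum xs (\<lambda>x ys. fact n *\<^sub>R \<Phi> (x # ys))"
  proof (rule asum_cong[where V = V])
    fix x ys assume x: "x \<in> V" "set ys \<subseteq> V" "Suc (length ys) = length xs"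
    then have n: "n = length ys" using Suc.hyps(2) by simp
    show "perm_sum ys (\<lambda>zs. \<Phi> (x # zs)) = fact n *\<^sub>R \<Phi> (x # ys)"
      using Suc.hyps(1)[OF n alt_on_Cons[OF Suc.prems(1), of x]] x n by simp
  qed (use Suc.prems in auto)
  also have "\<dots> = fact n *\<^sub>R (real (length xs) *\<^sub>R \<Phi> xs)"
    using asum_alt[OF Suc.prems] by (simp only: asum_scaleR)
  finally show ?case using Suc.hyps(2)[symmetric] by (simp add: mult.commute)
qed simp

text \<open>The dotted wedge without normalisation: the forms choose their vector fields one after
  the other, and the remaining fields keep their order.\<close>

primrec dwedge :: "('x \<Rightarrow> 'g) list \<Rightarrow> ('g list \<Rightarrow> 'x list \<Rightarrow> 'v::real_vector) \<Rightarrow> 'x list \<Rightarrow> 'v" where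
  "dwedge [] G xs = G [] xs"
| "dwedge (\<theta> # \<theta>s) G xs = asum xs (\<lambda>x ys. dwedge \<theta>s (\<lambda>gs. G (\<theta> x # gs)) ys)"

text \<open>Once the forms have taken their vector fields, all arrangements of the others give the
  same signed value. Their number is the factorial that \<open>dot_wedge\<close> divides by.\<close>

lemma perm_sum_dwedge:
  assumes "length \<theta>s \<le> length xs" "set xs \<subseteq> V" "\<And>gs. length gs = length \<theta>s \<Longrightarrow> set gs \<subseteq> W \<Longrightarrow> alt_on V (G gs)"
    and "\<And>\<theta> x. \<theta> \<in> set \<theta>s \<Longrightarrow> x \<in> V \<Longrightarrow> \<theta> x \<in> W"
  shows "perm_sum xs (\<lambda>zs. G (map2 (\<lambda>\<theta> x. \<theta> x) \<theta>s zs) (drop (length \<theta>s) zs)) =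
    fact (length xs - length \<theta>s) *\<^sub>R dwedge \<theta>s G xs"
  using assms
proof (induction \<theta>s arbitrary: xs G)
  case Nil
  then show ?case using perm_sum_alt[of V "G []" xs] by simp
next
  case (Cons \<theta> \<theta>s)
  have "perm_sum xs (\<lambda>zs. G (map2 (\<lambda>\<theta> x. \<theta> x) (\<theta> # \<theta>s) zs) (drop (length (\<theta> # \<theta>s)) zs)) =
     asum xs (\<lambda>x ys. perm_sum ys (\<lambda>zs. G (\<theta> x # map2 (\<lambda>\<theta> x. \<theta> x) \<theta>s zs) (drop (length \<theta>s) zs)))"
    using Cons.prems(1) by (subst perm_sum_rec) auto
  also have "\<dots> = asum xs (\<lambda>x ys. fact (length xs - length (\<theta> # \<theta>s)) *\<^sub>R dwedge \<theta>s (\<lambda>gs. G (\<theta> x # gs)) ys)"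
  proof (rule asum_cong[OF Cons.prems(2)])
    fix x ys assume x: "x \<in> V" "set ys \<subseteq> V" "Suc (length ys) = length xs"
    have "perm_sum ys (\<lambda>zs. G (\<theta> x # map2 (\<lambda>\<theta> x. \<theta> x) \<theta>s zs) (drop (length \<theta>s) zs)) =
        fact (length ys - length \<theta>s) *\<^sub>R dwedge \<theta>s (\<lambda>gs. G (\<theta> x # gs)) ys"
      by (rule Cons.IH) (use x Cons.prems in auto)
    then show "perm_sum ys (\<lambda>zs. G (\<theta> x # map2 (\<lambda>\<theta> x. \<theta> x) \<theta>s zs) (drop (length \<theta>s) zs)) =
        fact (length xs - length (\<theta> # \<theta>s)) *\<^sub>R dwedge \<theta>s (\<lambda>gs. G (\<theta> x # gs)) ys"
      using x(3) by (metis diff_Suc_Suc length_Cons)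
  qed
  finally show ?case by (simp add: asum_scaleR)
qed

lemma scale_sec_const: "scale_sec (\<lambda>_. r) s = r *\<^sub>R s"
  by (simp add: scale_sec_def scaleR_fun_def)

lemma dot_wedge_dwedge:
  assumes "length xs = m + length \<theta>s" "set xs \<subseteq> V"
    and "\<And>gs. length gs = length \<theta>s \<Longrightarrow> set gs \<subseteq> W \<Longrightarrow> alt_on V (\<gamma> gs)"
    and "\<And>\<theta> x. \<theta> \<in> set \<theta>s \<Longrightarrow> x \<in> V \<Longrightarrow> \<theta> x \<in> W"
  shows "dot_wedge m \<gamma> \<theta>s [] xs = dwedge \<theta>s \<gamma> xs"
proof -
  let ?l = "length \<theta>s"
  have "map (\<lambda>i. (\<theta>s ! i) (xs ! \<sigma> i)) [0..<?l] =
      map2 (\<lambda>\<theta> x. \<theta> x) \<theta>s (map (\<lambda>i. xs ! \<sigma> i) [0..<length xs])" for \<sigma>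
    by (rule nth_equalityI) (use assms(1) in auto)
  moreover have "map (\<lambda>i. xs ! \<sigma> i) [?l..<?l + m] = drop ?l (map (\<lambda>i. xs ! \<sigma> i) [0..<length xs])" for \<sigma>
    by (rule nth_equalityI) (use assms(1) in auto)
  ultimately have "dot_wedge m \<gamma> \<theta>s [] xs = (1 / fact m) *\<^sub>R
      perm_sum xs (\<lambda>zs. \<gamma> (map2 (\<lambda>\<theta> x. \<theta> x) \<theta>s zs) (drop ?l zs))"
    by (simp add: dot_wedge_def perm_sum_def scale_sec_const assms(1) Let_def add.commute)
  also have "\<dots> = dwedge \<theta>s \<gamma> xs"
    using perm_sum_dwedge[of \<theta>s xs V W \<gamma>] assms by simp
  finally show ?thesis .
qed

text \<open>If the head goes to the second block, the \<open>a\<close> entries of the first block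
  are moved past it, hence the sign \<open>(-1) ^ a\<close>; if it opens the first block, nothing
  moves.\<close>

primrec shuffle_sum :: "'g list \<Rightarrow> nat \<Rightarrow> ('g list \<Rightarrow> 'g list \<Rightarrow> 'v::real_vector) \<Rightarrow> 'v" where
  "shuffle_sum [] a G = (if a = 0 then G [] [] else 0)"
| "shuffle_sum (x # xs) a G = (case a of 0 \<Rightarrow> 0 | Suc b \<Rightarrow> shuffle_sum xs b (\<lambda>J. G (x # J)))
     + (-1) ^ a *\<^sub>R shuffle_sum xs a (\<lambda>J L. G J (x # L))"

lemma shuffle_sum_gt: "length xs < a \<Longrightarrow> shuffle_sum xs a G = 0"
  by (induction xs arbitrary: a G) (auto split: nat.split)

text \<open>A shuffle is increasing on both blocks, so the smallest value stands at the beginning of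
  one of them.\<close>

lemma shuffles_zero_index:
  assumes "\<sigma> \<in> shuffles a b" "0 < a + b"
  shows "(0 < a \<and> \<sigma> 0 = 0) \<or> (0 < b \<and> \<sigma> a = 0)"
proof -
  have p: "\<sigma> permutes {..<a + b}" and m: "strict_mono_on {..<a} \<sigma>" "strict_mono_on {a..<a + b} \<sigma>"
    using assms(1) by (auto simp: shuffles_def)
  obtain i where i: "i < a + b" "\<sigma> i = 0"
    using permutes_image[OF p] assms(2) by (metis imageE lessThan_iff)
  show ?thesis
  proof (cases "i < a")
    case True
    have "i = 0"
    proof (rule ccontr)
      assume "i \<noteq> 0"
      then have "\<sigma> 0 < \<sigma> i" using True by (intro strict_mono_onD[OF m(1)]) auto
      then show False using i by simp
    qed
    then show ?thesis using i True by auto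
  next
    case False
    have "i = a"
    proof (rule ccontr)
      assume "i \<noteq> a"
      then have "\<sigma> a < \<sigma> i" using False i by (intro strict_mono_onD[OF m(2)]) auto
      then show False using i by simp
    qed
    then show ?thesis using i by auto
  qed
qed

lemma permutation_insert_0:
  "permutation_insert i 0 \<tau> j = (if j < i then Suc (\<tau> j) else if j = i then 0 else Suc (\<tau> (j - 1)))"
  by (simp add: permutation_insert_expand)

lemma shuffles_insert_left:
  assumes "\<tau> permutes {..<a + b}"
  shows "permutation_insert 0 0 \<tau> \<in> shuffles (Suc a) b \<longleftrightarrow> \<tau> \<in> shuffles a b"
proof -
  let ?\<sigma> = "permutation_insert 0 0 \<tau>"
  have p: "?\<sigma> permutes {..<Suc a + b}"
    using permutation_insert_image[of 0 "a + b" 0] assms by (auto simp: set_eq_iff)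
  have s: "?\<sigma> 0 = 0" "?\<sigma> (Suc i) = Suc (\<tau> i)" for i by (simp_all add: permutation_insert_0)
  have 1: "strict_mono_on {..<Suc a} ?\<sigma> \<longleftrightarrow> strict_mono_on {..<a} \<tau>"
  proof
    assume m: "strict_mono_on {..<Suc a} ?\<sigma>"
    show "strict_mono_on {..<a} \<tau>"
      by (rule strict_mono_onI) (use s strict_mono_onD[OF m, of "Suc _" "Suc _"] in auto)
  next
    assume m: "strict_mono_on {..<a} \<tau>"
    show "strict_mono_on {..<Suc a} ?\<sigma>"
    proof (rule strict_mono_onI)
      fix r t assume "r \<in> {..<Suc a}" "t \<in> {..<Suc a}" "r < t"
      then show "?\<sigma> r < ?\<sigma> t"
        using strict_mono_onD[OF m, of "r - 1" "t - 1"] by (cases r; cases t) (auto simp: s)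
    qed
  qed
  have 2: "strict_mono_on {Suc a..<Suc a + b} ?\<sigma> \<longleftrightarrow> strict_mono_on {a..<a + b} \<tau>"
  proof
    assume m: "strict_mono_on {Suc a..<Suc a + b} ?\<sigma>"
    show "strict_mono_on {a..<a + b} \<tau>"
      by (rule strict_mono_onI) (use s strict_mono_onD[OF m, of "Suc _" "Suc _"] in auto)
  next
    assume m: "strict_mono_on {a..<a + b} \<tau>"
    show "strict_mono_on {Suc a..<Suc a + b} ?\<sigma>"
    proof (rule strict_mono_onI)
      fix r t assume "r \<in> {Suc a..<Suc a + b}" "t \<in> {Suc a..<Suc a + b}" "r < t"
      then show "?\<sigma> r < ?\<sigma> t"
        using strict_mono_onD[OF m, of "r - 1" "t - 1"] by (cases r; cases t) (auto simp: s)
    qed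
  qed
  show ?thesis using p assms 1 2 by (simp add: shuffles_def)
qed

lemma shuffles_insert_right:
  assumes "\<tau> permutes {..<a + b}"
  shows "permutation_insert a 0 \<tau> \<in> shuffles a (Suc b) \<longleftrightarrow> \<tau> \<in> shuffles a b"
proof -
  let ?\<sigma> = "permutation_insert a 0 \<tau>"
  have p: "?\<sigma> permutes {..<a + Suc b}"
    using permutation_insert_image[of a "a + b" 0] assms by (auto simp: set_eq_iff)
  have s: "?\<sigma> a = 0" "i < a \<Longrightarrow> ?\<sigma> i = Suc (\<tau> i)" "a \<le> i \<Longrightarrow> ?\<sigma> (Suc i) = Suc (\<tau> i)" for i
    by (simp_all add: permutation_insert_0)
  have 1: "strict_mono_on {..<a} ?\<sigma> \<longleftrightarrow> strict_mono_on {..<a} \<tau>"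
    by (simp add: strict_mono_on_def s)
  have 2: "strict_mono_on {a..<a + Suc b} ?\<sigma> \<longleftrightarrow> strict_mono_on {a..<a + b} \<tau>"
  proof
    assume m: "strict_mono_on {a..<a + Suc b} ?\<sigma>"
    show "strict_mono_on {a..<a + b} \<tau>"
    proof (rule strict_mono_onI)
      fix r t assume "r \<in> {a..<a + b}" "t \<in> {a..<a + b}" "r < t"
      then show "\<tau> r < \<tau> t"
        using strict_mono_onD[OF m, of "Suc r" "Suc t"] s(3)[of r] s(3)[of t] by simp
    qed
  next
    assume m: "strict_mono_on {a..<a + b} \<tau>"
    show "strict_mono_on {a..<a + Suc b} ?\<sigma>"
    proof (rule strict_mono_onI)
      fix r t assume rt: "r \<in> {a..<a + Suc b}" "t \<in> {a..<a + Suc b}" "r < t"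
      then obtain t' where t': "t = Suc t'" "a \<le> t'" by (cases t) auto
      show "?\<sigma> r < ?\<sigma> t"
      proof (cases "r = a")
        case True
        then show ?thesis using t' s by simp
      next
        case False
        then obtain r' where r': "r = Suc r'" "a \<le> r'" using rt by (cases r) auto
        then show ?thesis using strict_mono_onD[OF m, of r' t'] rt t' s by auto
      qed
    qed
  qed
  show ?thesis using p assms 1 2 by (simp add: shuffles_def)
qed

text \<open>The shuffles are split according to the block that contains the value 0. Deleting it
  leaves a shuffle of the shorter list by \<open>shuffles_insert_left\<close> or
  \<open>shuffles_insert_right\<close>, which matches the recursion of
  \<open>shuffle_sum\<close>.\<close>

lemma sum_shuffles:
  assumes "length xs = a + b"
  shows "(\<Sum>\<sigma>\<in>shuffles a b. real_of_int (sign \<sigma>) *\<^sub>R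
      G (map (\<lambda>i. xs ! \<sigma> i) [0..<a]) (map (\<lambda>i. xs ! \<sigma> i) [a..<a + b])) = shuffle_sum xs a G"
  using assms
proof (induction xs arbitrary: a b G)
  case Nil
  have "shuffles 0 0 = {id}" by (auto simp: shuffles_def strict_mono_on_def)
  then show ?case using Nil by simp
next
  case (Cons x xs)
  let ?t = "\<lambda>a b G (xs :: 'a list) \<sigma>. real_of_int (sign \<sigma>) *\<^sub>R
      G (map (\<lambda>i. xs ! \<sigma> i) [0..<a]) (map (\<lambda>i. xs ! \<sigma> i) [a..<a + b])"
  let ?A = "{\<sigma> \<in> shuffles a b. 0 < a \<and> \<sigma> 0 = 0}"
  let ?B = "{\<sigma> \<in> shuffles a b. 0 < b \<and> \<sigma> a = 0}"
  have fin: "finite (shuffles a b)"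
    by (rule finite_subset[OF _ finite_permutations[of "{..<a + b}"]]) (auto simp: shuffles_def)
  have "\<sigma> \<in> ?A \<union> ?B" if "\<sigma> \<in> shuffles a b" for \<sigma>
  proof -
    have "0 < a + b" using Cons.prems by (metis length_Cons zero_less_Suc)
    from shuffles_zero_index[OF that this] that show ?thesis by simp
  qed
  then have "shuffles a b = ?A \<union> ?B" by blast
  moreover have "?A \<inter> ?B = {}"
  proof -
    have False if "\<sigma> permutes {..<a + b}" "\<sigma> 0 = 0" "\<sigma> a = 0" "0 < a" for \<sigma>
      using permutes_inj[OF that(1)] that(2-4) by (metis injD less_numeral_extra(3))
    then show ?thesis by (auto simp: shuffles_def)
  qed
  ultimately have "sum (?t a b G (x # xs)) (shuffles a b) =
      sum (?t a b G (x # xs)) ?A + sum (?t a b G (x # xs)) ?B"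
    using fin by (metis (no_types, lifting) finite_Un sum.union_disjoint)
  moreover have "sum (?t a b G (x # xs)) ?A =
      (case a of 0 \<Rightarrow> 0 | Suc a' \<Rightarrow> shuffle_sum xs a' (\<lambda>J. G (x # J)))"
  proof (cases a)
    case (Suc a')
    have n: "length xs = a' + b" using Cons.prems Suc by simp
    have A: "?A = permutation_insert 0 0 ` shuffles a' b"
    proof -
      have "?A = {\<sigma> \<in> {p. p permutes {..<Suc (a' + b)} \<and> p 0 = 0}. \<sigma> \<in> shuffles a b}"
        using Suc by (auto simp: shuffles_def)
      also have "\<dots> = permutation_insert 0 0 ` shuffles a' b"
        unfolding permutation_insert_image[of 0 "a' + b" 0, simplified]
        using shuffles_insert_left[of _ a' b] Suc by (auto simp: shuffles_def)
      finally show ?thesis .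
    qed
    have inj: "inj_on (permutation_insert 0 0) (shuffles a' b)"
      by (rule inj_on_subset[OF permutation_insert_inj[of 0 "a' + b" 0]]) (auto simp: shuffles_def)
    have "sum (?t a b G (x # xs)) ?A = (\<Sum>\<tau>\<in>shuffles a' b. ?t a b G (x # xs) (permutation_insert 0 0 \<tau>))"
      unfolding A sum.reindex[OF inj] by simp
    also have "\<dots> = sum (?t a' b (\<lambda>J. G (x # J)) xs) (shuffles a' b)"
    proof (rule sum.cong[OF refl])
      fix \<tau> assume "\<tau> \<in> shuffles a' b"
      then have p: "\<tau> permutes {..<a' + b}" by (simp add: shuffles_def)
      have "map (\<lambda>i. (x # xs) ! permutation_insert 0 0 \<tau> i) [0..<a] = x # map (\<lambda>i. xs ! \<tau> i) [0..<a']"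
        unfolding Suc upt_conv_Cons[OF zero_less_Suc] list.map map_Suc_upt[symmetric] map_map o_def
        by (simp add: permutation_insert_0)
      moreover have "map (\<lambda>i. (x # xs) ! permutation_insert 0 0 \<tau> i) [a..<a + b] = map (\<lambda>i. xs ! \<tau> i) [a'..<a' + b]"
        unfolding Suc add_Suc map_Suc_upt[symmetric] map_map o_def by (simp add: permutation_insert_0)
      ultimately show "?t a b G (x # xs) (permutation_insert 0 0 \<tau>) = ?t a' b (\<lambda>J. G (x # J)) xs \<tau>"
        using sign_permutation_insert[OF p, of 0 0] by simp
    qed
    also have "\<dots> = shuffle_sum xs a' (\<lambda>J. G (x # J))"
      by (rule Cons.IH[OF n])
    finally show ?thesis using Suc by simp
  qed simp
  moreover have "sum (?t a b G (x # xs)) ?B = (-1) ^ a *\<^sub>R shuffle_sum xs a (\<lambda>J L. G J (x # L))"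
  proof (cases b)
    case 0
    then show ?thesis using Cons.prems shuffle_sum_gt[of xs a] by simp
  next
    case (Suc b')
    have n: "length xs = a + b'" using Cons.prems Suc by simp
    have B: "?B = permutation_insert a 0 ` shuffles a b'"
    proof -
      have "?B = {\<sigma> \<in> {p. p permutes {..<Suc (a + b')} \<and> p a = 0}. \<sigma> \<in> shuffles a b}"
        using Suc by (auto simp: shuffles_def)
      also have "\<dots> = permutation_insert a 0 ` shuffles a b'"
        unfolding permutation_insert_image[of a "a + b'" 0, simplified]
        using shuffles_insert_right[of _ a b'] Suc by (auto simp: shuffles_def)
      finally show ?thesis .
    qed
    have inj: "inj_on (permutation_insert a 0) (shuffles a b')"
      by (rule inj_on_subset[OF permutation_insert_inj[of a "a + b'" 0]]) (auto simp: shuffles_def)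
    have "sum (?t a b G (x # xs)) ?B = (\<Sum>\<tau>\<in>shuffles a b'. ?t a b G (x # xs) (permutation_insert a 0 \<tau>))"
      unfolding B sum.reindex[OF inj] by simp
    also have "\<dots> = (\<Sum>\<tau>\<in>shuffles a b'. (-1) ^ a *\<^sub>R ?t a b' (\<lambda>J L. G J (x # L)) xs \<tau>)"
    proof (rule sum.cong[OF refl])
      fix \<tau> assume "\<tau> \<in> shuffles a b'"
      then have p: "\<tau> permutes {..<a + b'}" by (simp add: shuffles_def)
      have "map (\<lambda>i. (x # xs) ! permutation_insert a 0 \<tau> i) [0..<a] = map (\<lambda>i. xs ! \<tau> i) [0..<a]"
        by (simp add: permutation_insert_0)
      moreover have "map (\<lambda>i. (x # xs) ! permutation_insert a 0 \<tau> i) [a..<a + b] = x # map (\<lambda>i. xs ! \<tau> i) [a..<a + b']"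
      proof -
        have "[a..<a + b] = a # map Suc [a..<a + b']"
          unfolding Suc map_Suc_upt by (simp add: upt_conv_Cons)
        then show ?thesis by (simp add: permutation_insert_0)
      qed
      moreover have "real_of_int (sign (permutation_insert a 0 \<tau>)) = (-1) ^ a * real_of_int (sign \<tau>)"
        using sign_permutation_insert[OF p, of a 0] by simp
      ultimately show "?t a b G (x # xs) (permutation_insert a 0 \<tau>) =
          (-1) ^ a *\<^sub>R ?t a b' (\<lambda>J L. G J (x # L)) xs \<tau>"
        by (simp only: scaleR_scaleR)
    qed
    also have "\<dots> = (-1) ^ a *\<^sub>R shuffle_sum xs a (\<lambda>J L. G J (x # L))"
      using Cons.IH[OF n, of "\<lambda>J L. G J (x # L)"] by (simp only: scaleR_sum_right[symmetric])
    finally show ?thesis .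
  qed
  ultimately show ?case by simp
qed

lemma shuffle_sum_add: "shuffle_sum xs a (\<lambda>J L. F J L + G J L) = shuffle_sum xs a F + shuffle_sum xs a G"
  by (induction xs arbitrary: a F G) (auto split: nat.split simp: scaleR_add_right)

lemma shuffle_sum_scaleR: "shuffle_sum xs a (\<lambda>J L. r *\<^sub>R F J L) = r *\<^sub>R shuffle_sum xs a F"
  by (induction xs arbitrary: a F) (auto split: nat.split simp: scaleR_add_right)

lemma shuffle_sum_cong:
  assumes "set xs \<subseteq> S"
    and "\<And>J L. set J \<subseteq> S \<Longrightarrow> set L \<subseteq> S \<Longrightarrow> length J = a \<Longrightarrow> F J L = G J L"
  shows "shuffle_sum xs a F = shuffle_sum xs a G"
  using assms
proof (induction xs arbitrary: a F G)
  case (Cons x xs)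
  have 1: "shuffle_sum xs b (\<lambda>J. F (x # J)) = shuffle_sum xs b (\<lambda>J. G (x # J))" if "a = Suc b" for b
    by (rule Cons.IH) (use Cons.prems that in auto)
  have 2: "shuffle_sum xs a (\<lambda>J L. F J (x # L)) = shuffle_sum xs a (\<lambda>J L. G J (x # L))"
    by (rule Cons.IH) (use Cons.prems in auto)
  show ?case using 1 2 by (auto split: nat.split)
qed auto

lemma dwedge_add: "dwedge \<theta>s (\<lambda>gs xs. F gs xs + G gs xs) xs = dwedge \<theta>s F xs + dwedge \<theta>s G xs"
  by (induction \<theta>s arbitrary: F G xs) (auto simp: asum_add)

lemma dwedge_scaleR: "dwedge \<theta>s (\<lambda>gs xs. r *\<^sub>R F gs xs) xs = r *\<^sub>R dwedge \<theta>s F xs"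
  by (induction \<theta>s arbitrary: F xs) (auto simp: asum_scaleR)

lemma dwedge_cong:
  assumes "set xs \<subseteq> V" "\<And>\<theta> x. \<theta> \<in> set \<theta>s \<Longrightarrow> x \<in> V \<Longrightarrow> \<theta> x \<in> W"
    and "\<And>gs ys. set gs \<subseteq> W \<Longrightarrow> set ys \<subseteq> V \<Longrightarrow> length gs = length \<theta>s \<Longrightarrow> F gs ys = G gs ys"
  shows "dwedge \<theta>s F xs = dwedge \<theta>s G xs"
  using assms
proof (induction \<theta>s arbitrary: xs F G)
  case (Cons \<theta> \<theta>s)
  have "dwedge \<theta>s (\<lambda>gs. F (\<theta> x # gs)) ys = dwedge \<theta>s (\<lambda>gs. G (\<theta> x # gs)) ys"
    if "x \<in> V" "set ys \<subseteq> V" for x ys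
    by (rule Cons.IH) (use Cons.prems that in auto)
  then show ?case unfolding dwedge.simps by (rule asum_cong[OF Cons.prems(1)])
qed simp

text \<open>The last choice of a vector field is moved in front of those made by the forms, with one
  sign for each of them.\<close>

lemma dwedge_asum_swap:
  "dwedge \<theta>s (\<lambda>gs ys. asum ys (F gs)) xs =
    (-1) ^ length \<theta>s *\<^sub>R asum xs (\<lambda>x ys. dwedge \<theta>s (\<lambda>gs. F gs x) ys)"
proof (induction \<theta>s arbitrary: F xs)
  case (Cons \<theta> \<theta>s)
  have "dwedge (\<theta> # \<theta>s) (\<lambda>gs ys. asum ys (F gs)) xs =
      (-1) ^ length \<theta>s *\<^sub>R asum xs (\<lambda>x ys. asum ys (\<lambda>y. dwedge \<theta>s (\<lambda>gs. F (\<theta> x # gs) y)))"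
    by (simp add: Cons.IH asum_scaleR)
  also have "\<dots> = - ((-1) ^ length \<theta>s *\<^sub>R asum xs (\<lambda>x ys. asum ys (\<lambda>y. dwedge \<theta>s (\<lambda>gs. F (\<theta> y # gs) x))))"
    by (subst asum_asum_swap) simp
  finally show ?case by simp
next
  case Nil
  have "(\<lambda>x. dwedge [] (\<lambda>gs. F gs x)) = F []" by (simp add: fun_eq_iff)
  then show ?case by simp
qed

context ideal_conn
begin

text \<open>Each alternating argument is either kept, and goes to \<open>L\<close>, or projected,
  and goes to \<open>J\<close>. With \<alpha> at the head these cases are \<open>D\<close> and
  \<open>E\<close>, which are the two summands in the recursion of
  \<open>shuffle_sum\<close>.\<close>

lemma hproj_expand:
  assumes c: "tensorial {} c" and carr: "set as \<subseteq> S" "set bs \<subseteq> S" "set xs \<subseteq> V"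
  shows "hproj c as bs xs = (\<Sum>a\<le>length as. (-1) ^ a *\<^sub>R
    shuffle_sum as a (\<lambda>J L. dwedge (map C J) (\<lambda>gs ys. c L (map hmap bs @ gs) ys) xs))"
  using c carr(1)
proof (induction as arbitrary: c)
  case Nil
  then show ?case by simp
next
  case (Cons \<alpha> as)
  note c = Cons.prems(1)
  have \<alpha>: "\<alpha> \<in> S" and as: "set as \<subseteq> S" using Cons.prems by auto
  let ?s = "(-1) ^ length bs :: real"
  let ?hb = "map hmap bs"
  have hb: "set ?hb \<subseteq> S" by (rule set_map_hmap[OF carr(2)])
  define D where "D J L = dwedge (map C J) (\<lambda>gs ys. c (\<alpha> # L) (?hb @ gs) ys) xs" for J L
  define E where "E J L = dwedge (C \<alpha> # map C J) (\<lambda>gs ys. c L (?hb @ gs) ys) xs" for J L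
  \<comment> \<open>The contractions are evaluated at \<open>a\<close> additional symmetric
    arguments, hence \<open>(-1) ^ a\<close>. For \<open>E\<close> this sign is cancelled by moving
    the choice made by \<open>C \<alpha>\<close> in front of the other \<open>a\<close>.\<close>
  have inner: "dwedge (map C J) (\<lambda>gs ys. (contr \<alpha> c - core_contr (C \<alpha>) c) L (?hb @ gs) ys) xs =
      ?s *\<^sub>R ((-1) ^ a *\<^sub>R D J L + (- 1) *\<^sub>R E J L)"
    if J: "set J \<subseteq> S" "set L \<subseteq> S" "length J = a" for J L a
  proof -
    let ?F = "\<lambda>gs y zs. c L (?hb @ C \<alpha> y # gs) zs"
    have "dwedge (map C J) (\<lambda>gs ys. (contr \<alpha> c - core_contr (C \<alpha>) c) L (?hb @ gs) ys) xs =
      dwedge (map C J) (\<lambda>gs ys. (?s * (-1) ^ a) *\<^sub>R (c (\<alpha> # L) (?hb @ gs) ys + (-1) *\<^sub>R asum ys (?F gs))) xs"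
    proof (rule dwedge_cong[OF carr(3), where W = S])
      fix gs ys assume g: "set gs \<subseteq> S" "set ys \<subseteq> V" "length gs = length (map C J)"
      have "asum ys (\<lambda>y zs. c L (C \<alpha> y # ?hb @ gs) zs) = asum ys (?F gs)"
      proof (rule asum_cong[OF g(2)])
        fix y zs assume "y \<in> V" "set zs \<subseteq> V"
        then show "c L (C \<alpha> y # ?hb @ gs) zs = ?F gs y zs"
          using symm_on_move[OF tensorial_symm[OF c J(2)], of zs "[]" ?hb gs "C \<alpha> y"] hb g C_S[OF \<alpha>] by simp
      qed
      then show "(contr \<alpha> c - core_contr (C \<alpha>) c) L (?hb @ gs) ys =
          (?s * (-1) ^ a) *\<^sub>R (c (\<alpha> # L) (?hb @ gs) ys + (-1) *\<^sub>R asum ys (?F gs))"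
        using g J by (simp add: contr_def core_contr_def power_add scaleR_diff_right)
    qed (use C_S J in auto)
    also have "\<dots> = (?s * (-1) ^ a) *\<^sub>R (D J L + (-1) *\<^sub>R dwedge (map C J) (\<lambda>gs ys. asum ys (?F gs)) xs)"
      by (simp only: dwedge_scaleR dwedge_add D_def)
    also have "dwedge (map C J) (\<lambda>gs ys. asum ys (?F gs)) xs = (-1) ^ a *\<^sub>R E J L"
      using J by (simp add: dwedge_asum_swap E_def)
    finally show ?thesis by (simp add: scaleR_diff_right)
  qed
  have "hproj c (\<alpha> # as) bs xs = ?s *\<^sub>R (\<Sum>a\<le>length as. (-1) ^ a *\<^sub>R
      shuffle_sum as a (\<lambda>J L. dwedge (map C J) (\<lambda>gs ys. (contr \<alpha> c - core_contr (C \<alpha>) c) L (?hb @ gs) ys) xs))"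
    by (simp only: hproj.simps Cons.IH[OF tensorial_diff[OF tensorial_contr[OF c \<alpha>] tensorial_core_contrC[OF c \<alpha>]] as])
  also have "\<dots> = ?s *\<^sub>R (\<Sum>a\<le>length as. (-1) ^ a *\<^sub>R (?s *\<^sub>R ((-1) ^ a *\<^sub>R shuffle_sum as a D + (- 1) *\<^sub>R shuffle_sum as a E)))"
    using inner by (simp only: shuffle_sum_cong[OF as inner] shuffle_sum_scaleR shuffle_sum_add)
  also have "\<dots> = (\<Sum>a\<le>length as. shuffle_sum as a D) - (\<Sum>a\<le>length as. (-1) ^ a *\<^sub>R shuffle_sum as a E)"
  proof -
    have "?s *\<^sub>R ((-1) ^ a *\<^sub>R (?s *\<^sub>R ((-1) ^ a *\<^sub>R X + (- 1) *\<^sub>R Y))) = X - (-1) ^ a *\<^sub>R Y"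
      for a and X Y :: 'g
      by (cases "even a"; cases "even (length bs)") simp_all
    then show ?thesis by (simp only: scaleR_sum_right sum_subtractf)
  qed
  also have "\<dots> = (\<Sum>a\<le>length (\<alpha> # as). (-1) ^ a *\<^sub>R
      shuffle_sum (\<alpha> # as) a (\<lambda>J L. dwedge (map C J) (\<lambda>gs ys. c L (?hb @ gs) ys) xs))"
  proof -
    let ?G = "\<lambda>J L. dwedge (map C J) (\<lambda>gs ys. c L (?hb @ gs) ys) xs"
    have "(-1) ^ a *\<^sub>R shuffle_sum (\<alpha> # as) a ?G =
       (case a of 0 \<Rightarrow> 0 | Suc b \<Rightarrow> - ((-1) ^ b *\<^sub>R shuffle_sum as b E)) + shuffle_sum as a D" for a
      by (auto simp: D_def[abs_def] E_def[abs_def] scaleR_add_right split: nat.split)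
    then have "(\<Sum>a\<le>length (\<alpha> # as). (-1) ^ a *\<^sub>R shuffle_sum (\<alpha> # as) a ?G) =
       (\<Sum>a\<le>Suc (length as). case a of 0 \<Rightarrow> 0 | Suc b \<Rightarrow> - ((-1) ^ b *\<^sub>R shuffle_sum as b E))
       + (\<Sum>a\<le>Suc (length as). shuffle_sum as a D)"
      by (simp only: sum.distrib length_Cons)
    also have "(\<Sum>a\<le>Suc (length as). case a of 0 \<Rightarrow> 0 | Suc b \<Rightarrow> - ((-1) ^ b *\<^sub>R shuffle_sum as b E)) =
       - (\<Sum>a\<le>length as. (-1) ^ a *\<^sub>R shuffle_sum as a E)"
      unfolding sum.atMost_Suc_shift by (simp add: sum_negf)
    \<comment> \<open>The top index would project more arguments than \<open>as\<close> has.\<close>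
    also have "(\<Sum>a\<le>Suc (length as). shuffle_sum as a D) = (\<Sum>a\<le>length as. shuffle_sum as a D)"
      by (simp add: shuffle_sum_gt)
    finally show ?thesis by simp
  qed
  finally show ?case .
qed

end

section \<open>The Leibniz rule\<close>

text \<open>\<open>R\<close> is the ring of functions, \<open>Rc\<close> the set of constant functions, and \<open>D x f\<close> the derivative
  of \<open>f\<close> along \<open>x\<close>.\<close>

locale weil_conn = ideal_conn S K V br act rh C v R smS smV
  for S K :: "'g::real_vector set" and V :: "'x::ab_group_add set"
    and br :: "'g \<Rightarrow> 'g \<Rightarrow> 'g" and act :: "'g \<Rightarrow> 'x \<Rightarrow> 'x" and rh :: "'g \<Rightarrow> 'x"
    and C :: "'g \<Rightarrow> 'x \<Rightarrow> 'g" and v :: "'g \<Rightarrow> 'g"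
    and R :: "'f set" and smS :: "'f \<Rightarrow> 'g \<Rightarrow> 'g" and smV :: "'f \<Rightarrow> 'x \<Rightarrow> 'x" +
  fixes Rc :: "'f set" and D :: "'x \<Rightarrow> 'f \<Rightarrow> 'f"
  assumes smS_S: "f \<in> R \<Longrightarrow> a \<in> S \<Longrightarrow> smS f a \<in> S"
    and Rc_R: "Rc \<subseteq> R"
    and D_R: "x \<in> V \<Longrightarrow> f \<in> R \<Longrightarrow> D x f \<in> R"
    and C_lin1: "x \<in> V \<Longrightarrow> lin_on Rc smS smS S (\<lambda>a. C a x)"
    and C_leibniz: "f \<in> R \<Longrightarrow> a \<in> S \<Longrightarrow> x \<in> V \<Longrightarrow> C (smS f a) x = smS f (C a x) + smS (D x f) (v a)"
begin

text \<open>The conditions of \<open>weil\<close> without the bidegree: the alternating arguments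
  are linear over constants, and multiplication by functions is governed by the last clause.\<close>

definition raw_weil :: "('g, 'x) raw \<Rightarrow> bool" where
  "raw_weil c \<longleftrightarrow> tensorial R c \<and>
     (\<forall>bs xs. set bs \<subseteq> S \<longrightarrow> set xs \<subseteq> V \<longrightarrow>
       alt_on S (\<lambda>as. c as bs xs) \<and> mlin_on Rc smS smS S (\<lambda>as. c as bs xs)) \<and>
     (\<forall>f a as bs xs. f \<in> R \<longrightarrow> a \<in> S \<longrightarrow> set as \<subseteq> S \<longrightarrow> set bs \<subseteq> S \<longrightarrow> set xs \<subseteq> V \<longrightarrow>
       c (smS f a # as) bs xs =
         smS f (c (a # as) bs xs) + asum xs (\<lambda>x ys. smS (D x f) (c as (a # bs) ys)))"

lemma weilrI:
  assumes "tensorial R c"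
    and "\<And>bs xs. set bs \<subseteq> S \<Longrightarrow> set xs \<subseteq> V \<Longrightarrow> alt_on S (\<lambda>as. c as bs xs)"
    and "\<And>bs xs. set bs \<subseteq> S \<Longrightarrow> set xs \<subseteq> V \<Longrightarrow> mlin_on Rc smS smS S (\<lambda>as. c as bs xs)"
    and "\<And>f a as bs xs. f \<in> R \<Longrightarrow> a \<in> S \<Longrightarrow> set as \<subseteq> S \<Longrightarrow> set bs \<subseteq> S \<Longrightarrow> set xs \<subseteq> V \<Longrightarrow>
       c (smS f a # as) bs xs =
         smS f (c (a # as) bs xs) + asum xs (\<lambda>x ys. smS (D x f) (c as (a # bs) ys))"
  shows "raw_weil c"
  using assms unfolding raw_weil_def by blast

lemma raw_weil_tensorial: "raw_weil c \<Longrightarrow> tensorial R c"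
  unfolding raw_weil_def by blast

lemma raw_weil_good0: "raw_weil c \<Longrightarrow> tensorial {} c"
  using tensorial_mono[OF raw_weil_tensorial] by blast

lemma raw_weil_alt: "raw_weil c \<Longrightarrow> set bs \<subseteq> S \<Longrightarrow> set xs \<subseteq> V \<Longrightarrow> alt_on S (\<lambda>as. c as bs xs)"
  unfolding raw_weil_def by blast

lemma raw_weil_mlin:
  "raw_weil c \<Longrightarrow> set bs \<subseteq> S \<Longrightarrow> set xs \<subseteq> V \<Longrightarrow> mlin_on Rc smS smS S (\<lambda>as. c as bs xs)"
  unfolding raw_weil_def by blast

lemma raw_weil_leibniz:
  "raw_weil c \<Longrightarrow> f \<in> R \<Longrightarrow> a \<in> S \<Longrightarrow> set as \<subseteq> S \<Longrightarrow> set bs \<subseteq> S \<Longrightarrow> set xs \<subseteq> V \<Longrightarrow>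
     c (smS f a # as) bs xs =
       smS f (c (a # as) bs xs) + asum xs (\<lambda>x ys. smS (D x f) (c as (a # bs) ys))"
  unfolding raw_weil_def by blast

lemma linear_Rc: "f \<in> Rc \<Longrightarrow> linear (smS f)"
  using Rc_R linear_smS by blast

lemma asum_cong_V: "set xs \<subseteq> V \<Longrightarrow>
    (\<And>y ys. y \<in> V \<Longrightarrow> set ys \<subseteq> V \<Longrightarrow> F y ys = G y ys) \<Longrightarrow> asum xs F = asum xs G"
  by (rule asum_cong)

lemma raw_weil_add:
  assumes "raw_weil c" "raw_weil d"
  shows "raw_weil (c + d)"
proof (rule weilrI)
  show "tensorial R (c + d)" by (intro tensorial_add raw_weil_tensorial assms)
  fix bs :: "'g list" and xs :: "'x list" assume b: "set bs \<subseteq> S" "set xs \<subseteq> V"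
  show "alt_on S (\<lambda>as. (c + d) as bs xs)"
    unfolding plus_fun_apply by (intro alt_on_add raw_weil_alt assms b)
  show "mlin_on Rc smS smS S (\<lambda>as. (c + d) as bs xs)"
    unfolding plus_fun_apply by (intro mlin_on_add linear_Rc raw_weil_mlin assms b)
  fix f a and as :: "'g list" assume f: "f \<in> R" "a \<in> S" "set as \<subseteq> S"
  have "asum xs (\<lambda>x ys. smS (D x f) (c as (a # bs) ys + d as (a # bs) ys)) =
     asum xs (\<lambda>x ys. smS (D x f) (c as (a # bs) ys) + smS (D x f) (d as (a # bs) ys))"
    by (rule asum_cong_V[OF b(2)]) (use linear_smS[OF D_R] f linear_add in blast)
  then show "(c + d) (smS f a # as) bs xs = smS f ((c + d) (a # as) bs xs)
      + asum xs (\<lambda>x ys. smS (D x f) ((c + d) as (a # bs) ys))"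
    using raw_weil_leibniz[OF assms(1) f b] raw_weil_leibniz[OF assms(2) f b]
    by (simp add: asum_add linear_add[OF linear_smS[OF f(1)]])
qed

lemma raw_weil_scaleR:
  assumes "raw_weil c"
  shows "raw_weil (r *\<^sub>R c)"
proof (rule weilrI)
  show "tensorial R (r *\<^sub>R c)" by (intro tensorial_scaleR raw_weil_tensorial assms)
  fix bs :: "'g list" and xs :: "'x list" assume b: "set bs \<subseteq> S" "set xs \<subseteq> V"
  show "alt_on S (\<lambda>as. (r *\<^sub>R c) as bs xs)"
    unfolding scaleR_fun_def by (intro alt_on_scaleR raw_weil_alt assms b)
  show "mlin_on Rc smS smS S (\<lambda>as. (r *\<^sub>R c) as bs xs)"
    unfolding scaleR_fun_def by (intro mlin_on_scaleR linear_Rc raw_weil_mlin assms b)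
  fix f a and as :: "'g list" assume f: "f \<in> R" "a \<in> S" "set as \<subseteq> S"
  have "asum xs (\<lambda>x ys. smS (D x f) (r *\<^sub>R c as (a # bs) ys)) =
     asum xs (\<lambda>x ys. r *\<^sub>R smS (D x f) (c as (a # bs) ys))"
    by (rule asum_cong_V[OF b(2)]) (use linear_smS[OF D_R] f linear_scale in blast)
  then show "(r *\<^sub>R c) (smS f a # as) bs xs = smS f ((r *\<^sub>R c) (a # as) bs xs)
      + asum xs (\<lambda>x ys. smS (D x f) ((r *\<^sub>R c) as (a # bs) ys))"
    using raw_weil_leibniz[OF assms(1) f b]
    by (simp add: scaleR_fun_def asum_scaleR scaleR_add_right linear_scale[OF linear_smS[OF f(1)]])
qed

text \<open>The derivative terms have to recombine to \<open>vdeg c as (a # bs)\<close>. Projecting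
  the head contributes the argument \<open>v a\<close> through \<open>C_leibniz\<close>
  (\<open>T1\<close>), projecting another alternating argument contributes its \<open>C\<close>
  (\<open>T2\<close>), and projecting a symmetric argument its \<open>v\<close>
  (\<open>T3\<close>).\<close>

lemma raw_weil_vdeg:
  assumes c: "raw_weil c"
  shows "raw_weil (vdeg c)"
proof (rule weilrI)
  note g = raw_weil_tensorial[OF c]
  show "tensorial R (vdeg c)" by (rule tensorial_vdeg[OF g])
  fix bs :: "'g list" and xs :: "'x list" assume b: "set bs \<subseteq> S" "set xs \<subseteq> V"
  have Cb: "set (C a x # bs) \<subseteq> S" if "a \<in> S" "x \<in> V" for a x using C_S that b by simp
  show "alt_on S (\<lambda>as. vdeg c as bs xs)"
    unfolding vdeg_def
    by (intro alt_on_add alt_on_asum alt_on_outer_asum[OF b(2)] alt_on_outer_dsum[OF b(1)]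
        raw_weil_alt[OF c] Cb b v_S)
  have 1: "lin_on Rc smS smS S (\<lambda>a. c as (C a x # bs) ys)"
    if "set as \<subseteq> S" "x \<in> V" "set ys \<subseteq> V" for as x ys
    using lin_on_mono[OF tensorial_linS[OF g that(1) b(1) that(3)] Rc_R] C_lin1[OF that(2)] C_S that(2)
    by (simp add: lin_on_def)
  show "mlin_on Rc smS smS S (\<lambda>as. vdeg c as bs xs)"
    unfolding vdeg_def
    by (intro mlin_on_add[OF linear_Rc] mlin_on_asum[OF linear_Rc] mlin_on_outer_asum[OF linear_Rc b(2)]
        lin_on_asum[OF linear_Rc b(2)] mlin_on_outer_dsum[OF linear_Rc b(1)]
        raw_weil_mlin[OF c] Cb b v_S 1)
  fix f a and as :: "'g list" assume f: "f \<in> R" and a: "a \<in> S" and as: "set as \<subseteq> S"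
  note lf = linear_smS[OF f]
  have lD: "linear (smS (D x f))" if "x \<in> V" for x by (rule linear_smS[OF D_R[OF that f]])
  have "c as (C (smS f a) x # bs) ys = smS f (c as (C a x # bs) ys) + smS (D x f) (c as (v a # bs) ys)"
    if x: "x \<in> V" "set ys \<subseteq> V" for x ys
  proof -
    note l = tensorial_linS[OF g as b(1) x(2)]
    have s: "C a x \<in> S" "v a \<in> S" "smS f (C a x) \<in> S" "smS (D x f) (v a) \<in> S"
      using C_S[OF a x(1)] v_S[OF a] smS_S[OF f] smS_S[OF D_R[OF x(1) f]] by blast+
    show ?thesis
      unfolding C_leibniz[OF f a x(1)] lin_on_addD[OF l s(3,4)] lin_on_scaleD[OF l s(1) f]
        lin_on_scaleD[OF l s(2) D_R[OF x(1) f]] ..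
  qed
  then have T1: "asum xs (\<lambda>x ys. c as (C (smS f a) x # bs) ys) =
      smS f (asum xs (\<lambda>x ys. c as (C a x # bs) ys)) + asum xs (\<lambda>x ys. smS (D x f) (c as (v a # bs) ys))"
    unfolding asum_linear[OF lf, symmetric] asum_add[symmetric] by (intro asum_cong_V[OF b(2)])
  \<comment> \<open>One vector field differentiates \<open>f\<close> and another enters
    \<open>C a'\<close>. Reversing their order yields the minus sign that cancels the one in front
    of the later entries of \<open>asum\<close>.\<close>
  have T2: "asum xs (\<lambda>x ys. c (smS f a # as') (C a' x # bs) ys) =
      smS f (asum xs (\<lambda>x ys. c (a # as') (C a' x # bs) ys))
      - asum xs (\<lambda>x ys. smS (D x f) (asum ys (\<lambda>y zs. c as' (C a' y # a # bs) zs)))"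
    if a': "a' \<in> S" "set as' \<subseteq> S" for a' as'
  proof -
    have "asum xs (\<lambda>x ys. c (smS f a # as') (C a' x # bs) ys) =
       asum xs (\<lambda>x ys. smS f (c (a # as') (C a' x # bs) ys)
         + asum ys (\<lambda>y zs. smS (D y f) (c as' (a # C a' x # bs) zs)))"
      by (intro asum_cong_V[OF b(2)] raw_weil_leibniz[OF c f a a'(2)] Cb a'(1))
    also have "\<dots> = smS f (asum xs (\<lambda>x ys. c (a # as') (C a' x # bs) ys)) +
        asum xs (\<lambda>x ys. asum ys (\<lambda>y zs. smS (D y f) (c as' (a # C a' x # bs) zs)))"
      by (simp only: asum_add asum_linear[OF lf])
    also have "asum xs (\<lambda>x ys. asum ys (\<lambda>y zs. smS (D y f) (c as' (a # C a' x # bs) zs))) =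
        - asum xs (\<lambda>x ys. asum ys (\<lambda>y zs. smS (D x f) (c as' (a # C a' y # bs) zs)))"
      by (rule asum_asum_swap)
    also have "asum xs (\<lambda>x ys. asum ys (\<lambda>y zs. smS (D x f) (c as' (a # C a' y # bs) zs))) =
        asum xs (\<lambda>x ys. smS (D x f) (asum ys (\<lambda>y zs. c as' (C a' y # a # bs) zs)))"
    proof (rule asum_cong_V[OF b(2)])
      fix x ys assume x: "x \<in> V" "set ys \<subseteq> V"
      have "asum ys (\<lambda>y zs. smS (D x f) (c as' (a # C a' y # bs) zs)) =
          asum ys (\<lambda>y zs. smS (D x f) (c as' (C a' y # a # bs) zs))"
      proof (rule asum_cong_V[OF x(2)])
        fix y zs assume "y \<in> V" "set zs \<subseteq> V"
        then show "smS (D x f) (c as' (a # C a' y # bs) zs) = smS (D x f) (c as' (C a' y # a # bs) zs)"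
          using symm_onD[OF tensorial_symm[OF g a'(2)], of zs "[]" bs a "C a' y"] b a C_S[OF a'(1)] by simp
      qed
      then show "asum ys (\<lambda>y zs. smS (D x f) (c as' (a # C a' y # bs) zs)) =
          smS (D x f) (asum ys (\<lambda>y zs. c as' (C a' y # a # bs) zs))"
        by (simp only: asum_linear[OF lD[OF x(1)]])
    qed
    finally show ?thesis by simp
  qed
  have T2': "asum as (\<lambda>a' as'. asum xs (\<lambda>x ys. c (smS f a # as') (C a' x # bs) ys)) =
      smS f (asum as (\<lambda>a' as'. asum xs (\<lambda>x ys. c (a # as') (C a' x # bs) ys)))
      - asum xs (\<lambda>x ys. smS (D x f) (asum as (\<lambda>a' as'. asum ys (\<lambda>y zs. c as' (C a' y # a # bs) zs))))"
  proof -
    have "asum as (\<lambda>a' as'. asum xs (\<lambda>x ys. smS (D x f) (asum ys (\<lambda>y zs. c as' (C a' y # a # bs) zs)))) =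
      asum xs (\<lambda>x ys. smS (D x f) (asum as (\<lambda>a' as'. asum ys (\<lambda>y zs. c as' (C a' y # a # bs) zs))))"
      by (subst asum_asum_commute[of as], rule asum_cong_V[OF b(2)]) (rule asum_linear[OF lD])
    then show ?thesis
      unfolding asum_linear[OF lf, symmetric] by (subst asum_cong[OF as T2]) (auto simp: asum_diff asum_linear[OF lf])
  qed
  have T3: "dsum bs v (\<lambda>bs. c (smS f a # as) bs xs) = smS f (dsum bs v (\<lambda>bs. c (a # as) bs xs))
      + asum xs (\<lambda>x ys. smS (D x f) (dsum bs v (\<lambda>bs. c as (a # bs) ys)))"
  proof -
    have "dsum bs v (\<lambda>bs. c (smS f a # as) bs xs) = dsum bs v (\<lambda>bs. smS f (c (a # as) bs xs)
       + asum xs (\<lambda>x ys. smS (D x f) (c as (a # bs) ys)))"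
      by (rule dsum_cong[OF b(1)]) (use v_S raw_weil_leibniz[OF c f a as _ b(2)] in auto)
    also have "\<dots> = smS f (dsum bs v (\<lambda>bs. c (a # as) bs xs))
       + asum xs (\<lambda>x ys. dsum bs v (\<lambda>bs. smS (D x f) (c as (a # bs) ys)))"
      by (simp only: dsum_add dsum_linear[OF lf] dsum_asum_commute)
    also have "asum xs (\<lambda>x ys. dsum bs v (\<lambda>bs. smS (D x f) (c as (a # bs) ys))) =
       asum xs (\<lambda>x ys. smS (D x f) (dsum bs v (\<lambda>bs. c as (a # bs) ys)))"
      by (rule asum_cong_V[OF b(2)]) (rule dsum_linear[OF lD])
    finally show ?thesis .
  qed
  have "asum xs (\<lambda>x ys. smS (D x f) (vdeg c as (a # bs) ys)) =
     asum xs (\<lambda>x ys. smS (D x f) (asum as (\<lambda>a' as'. asum ys (\<lambda>y zs. c as' (C a' y # a # bs) zs)))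
       + (smS (D x f) (c as (v a # bs) ys) + smS (D x f) (dsum bs v (\<lambda>bs. c as (a # bs) ys))))"
    by (rule asum_cong_V[OF b(2)]) (simp add: vdeg_def linear_add[OF lD])
  then show "vdeg c (smS f a # as) bs xs = smS f (vdeg c (a # as) bs xs)
      + asum xs (\<lambda>x ys. smS (D x f) (vdeg c as (a # bs) ys))"
    unfolding vdeg_def[of c "_ # as"] asum.simps T1 T2' T3
    by (simp add: asum_add linear_add[OF lf] linear_diff[OF lf])
qed

end

section \<open>Smooth functions, vector fields and sections\<close>

text \<open>Partial derivatives at points of an open set are therefore determined by the values on
  that set.\<close>

lemma openin_coordinate_line:
  assumes "openin (Euclidean_space n) V" "x \<in> V" "i < n"
  shows "open {t. x(i := t) \<in> V}"
proof -
  have x: "\<forall>j\<ge>n. x j = 0"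
    using openin_subset[OF assms(1)] assms(2) by (auto simp: topspace_Euclidean_space)
  \<comment> \<open>Points of \<open>Euclidean_space n\<close> vanish from index \<open>n\<close>
    on, so the line is written with that cut-off and then identified with
    \<open>x(i := t)\<close>.\<close>
  have "continuous_map euclideanreal (Euclidean_space n)
      (\<lambda>t j. if j < n then (if j = i then t else x j) else 0)"
  proof -
    have "continuous_map euclideanreal euclideanreal (\<lambda>t. if j = i then t else x j)" for j
      by (cases "j = i") auto
    then show ?thesis
      using continuous_map_componentwise_Euclidean_space[of euclideanreal n "\<lambda>t j. if j = i then t else x j"]
      by blast
  qed
  moreover have "(\<lambda>t j. if j < n then (if j = i then t else x j) else 0) = (\<lambda>t. x(i := t))"
    using x assms(3) by (auto simp: fun_eq_iff)
  ultimately have "continuous_map euclideanreal (Euclidean_space n) (\<lambda>t. x(i := t))" by simp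
  from openin_continuous_map_preimage[OF this assms(1)] show ?thesis by simp
qed

lemma Ck_Suc_imp: "Ck n (Suc k) V f \<Longrightarrow> Ck n k V f"
  by (induction k arbitrary: f) auto

lemma Ck_mono: "Ck n k V f \<Longrightarrow> V' \<subseteq> V \<Longrightarrow> Ck n k V' f"
proof (induction k arbitrary: f)
  case 0
  then show ?case by (auto intro: continuous_map_from_subtopology_mono)
next
  case (Suc k)
  then show ?case by (auto intro: continuous_map_from_subtopology_mono)
qed

lemma Ck_cong:
  assumes V: "openin (Euclidean_space n) V" and "Ck n k V f" "\<And>x. x \<in> V \<Longrightarrow> f x = g x"
  shows "Ck n k V g"
  using assms(2,3)
proof (induction k arbitrary: f g)
  case 0
  then show ?case by (auto intro!: continuous_map_eq[of _ _ f])
next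
  case (Suc k)
  have d: "((\<lambda>t. g (x(i := t))) has_field_derivative deriv (\<lambda>t. f (x(i := t))) (x i)) (at (x i))"
    if "i < n" "x \<in> V" for i x
  proof (rule has_field_derivative_transform_within_open)
    show "((\<lambda>t. f (x(i := t))) has_field_derivative deriv (\<lambda>t. f (x(i := t))) (x i)) (at (x i))"
      using Suc.prems(1) that by (simp add: DERIV_deriv_iff_field_differentiable)
    show "open {t. x(i := t) \<in> V}" using openin_coordinate_line[OF V] that by simp
  qed (use Suc.prems(2) that in auto)
  have "Ck n k V (\<lambda>x. deriv (\<lambda>t. g (x(i := t))) (x i))" if "i < n" for i
  proof (rule Suc.IH)
    show "Ck n k V (\<lambda>x. deriv (\<lambda>t. f (x(i := t))) (x i))"
      using Suc.prems(1) that by simp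
    show "deriv (\<lambda>t. f (x(i := t))) (x i) = deriv (\<lambda>t. g (x(i := t))) (x i)" if "x \<in> V" for x
      by (rule DERIV_imp_deriv[OF d[OF \<open>i < n\<close> that], symmetric])
  qed
  moreover have "(\<lambda>t. g (x(i := t))) field_differentiable at (x i)" if "i < n" "x \<in> V" for i x
    using d[OF that] by (auto simp: field_differentiable_def)
  moreover have "continuous_map (subtopology (Euclidean_space n) V) euclideanreal g"
    using Suc.prems by (auto intro!: continuous_map_eq[of _ _ f])
  ultimately show ?case by simp
qed

lemma Ck_const: "Ck n k V (\<lambda>_. c)"
  by (induction k arbitrary: c) auto

lemma Ck_add:
  assumes V: "openin (Euclidean_space n) V" and "Ck n k V f" "Ck n k V g"
  shows "Ck n k V (\<lambda>x. f x + g x)"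
  using assms(2,3)
proof (induction k arbitrary: f g)
  case 0
  then show ?case by (auto intro!: continuous_map_add)
next
  case (Suc k)
  have fd: "(\<lambda>t. f (x(i := t))) field_differentiable at (x i)"
      "(\<lambda>t. g (x(i := t))) field_differentiable at (x i)" if "i < n" "x \<in> V" for i x
    using Suc.prems that by auto
  have "Ck n k V (\<lambda>x. deriv (\<lambda>t. f (x(i := t)) + g (x(i := t))) (x i))" if i: "i < n" for i
  proof (rule Ck_cong[OF V])
    show "Ck n k V (\<lambda>x. deriv (\<lambda>t. f (x(i := t))) (x i) + deriv (\<lambda>t. g (x(i := t))) (x i))"
    proof (rule Suc.IH)
      show "Ck n k V (\<lambda>x. deriv (\<lambda>t. f (x(i := t))) (x i))"
        "Ck n k V (\<lambda>x. deriv (\<lambda>t. g (x(i := t))) (x i))"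
        using Suc.prems i by simp_all
    qed
    show "deriv (\<lambda>t. f (x(i := t))) (x i) + deriv (\<lambda>t. g (x(i := t))) (x i) =
        deriv (\<lambda>t. f (x(i := t)) + g (x(i := t))) (x i)" if "x \<in> V" for x
      by (rule deriv_add[OF fd[OF i that], symmetric])
  qed
  moreover have "continuous_map (subtopology (Euclidean_space n) V) euclideanreal (\<lambda>x. f x + g x)"
    using Suc.prems by (auto intro!: continuous_map_add)
  ultimately show ?case using fd by (auto intro!: field_differentiable_add)
qed

text \<open>The product rule holds at points of \<open>V\<close> only, so it enters through
  \<open>Ck_cong\<close>. It involves \<open>f\<close> and \<open>g\<close> besides their
  derivatives, whose regularity is lowered to order \<open>k\<close> by
  \<open>Ck_Suc_imp\<close>.\<close>

lemma Ck_mult: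
  assumes V: "openin (Euclidean_space n) V" and "Ck n k V f" "Ck n k V g"
  shows "Ck n k V (\<lambda>x. f x * g x)"
  using assms(2,3)
proof (induction k arbitrary: f g)
  case 0
  then show ?case by (auto intro!: continuous_map_real_mult)
next
  case (Suc k)
  have fd: "(\<lambda>t. f (x(i := t))) field_differentiable at (x i)"
      "(\<lambda>t. g (x(i := t))) field_differentiable at (x i)" if "i < n" "x \<in> V" for i x
    using Suc.prems that by auto
  have "Ck n k V (\<lambda>x. deriv (\<lambda>t. f (x(i := t)) * g (x(i := t))) (x i))" if i: "i < n" for i
  proof (rule Ck_cong[OF V])
    show "Ck n k V (\<lambda>x. f x * deriv (\<lambda>t. g (x(i := t))) (x i) + deriv (\<lambda>t. f (x(i := t))) (x i) * g x)"
    proof (intro Ck_add[OF V] Suc.IH Ck_Suc_imp[OF Suc.prems(1)] Ck_Suc_imp[OF Suc.prems(2)])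
      show "Ck n k V (\<lambda>x. deriv (\<lambda>t. f (x(i := t))) (x i))"
        "Ck n k V (\<lambda>x. deriv (\<lambda>t. g (x(i := t))) (x i))"
        using Suc.prems i by simp_all
    qed
    show "f x * deriv (\<lambda>t. g (x(i := t))) (x i) + deriv (\<lambda>t. f (x(i := t))) (x i) * g x =
        deriv (\<lambda>t. f (x(i := t)) * g (x(i := t))) (x i)" if "x \<in> V" for x
      using deriv_mult[OF fd[OF i that]] by simp
  qed
  moreover have "continuous_map (subtopology (Euclidean_space n) V) euclideanreal (\<lambda>x. f x * g x)"
    using Suc.prems by (auto intro!: continuous_map_real_mult)
  ultimately show ?case using fd by (auto intro!: field_differentiable_mult)
qed

lemma smooth_manifold_chart_open:
  assumes "smooth_manifold M" "(U, \<phi>) \<in> charts M" "open W"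
  shows "openin (Euclidean_space (mdim M)) (\<phi> ` (U \<inter> W))"
proof -
  have U: "open U" "openin (Euclidean_space (mdim M)) (\<phi> ` U)"
    and h: "homeomorphic_map (top_of_set U) (subtopology (Euclidean_space (mdim M)) (\<phi> ` U)) \<phi>"
    using assms(1,2) unfolding smooth_manifold_def by auto
  have "openin (top_of_set U) (U \<inter> W)" using assms(3) by (simp add: openin_open_Int)
  then have "openin (subtopology (Euclidean_space (mdim M)) (\<phi> ` U)) (\<phi> ` (U \<inter> W))"
    using homeomorphic_imp_open_map[OF h] by (simp add: open_map_def)
  then show ?thesis using openin_trans_full U(2) by blast
qed

lemma smooth_funs_const: "(\<lambda>_. c) \<in> smooth_funs M W"
  by (auto simp: smooth_funs_def Csmooth_def Ck_const)

lemma smooth_funs_mono: "f \<in> smooth_funs M W \<Longrightarrow> W' \<subseteq> W \<Longrightarrow> f \<in> smooth_funs M W'"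
  by (fastforce simp: smooth_funs_def Csmooth_def intro: Ck_mono)

lemma smooth_funs_add:
  assumes "smooth_manifold M" "open W" "f \<in> smooth_funs M W" "g \<in> smooth_funs M W"
  shows "(\<lambda>x. f x + g x) \<in> smooth_funs M W"
  using assms(3,4) Ck_add[OF smooth_manifold_chart_open[OF assms(1) _ assms(2)]]
  by (fastforce simp: smooth_funs_def Csmooth_def)

lemma smooth_funs_mult:
  assumes "smooth_manifold M" "open W" "f \<in> smooth_funs M W" "g \<in> smooth_funs M W"
  shows "(\<lambda>x. f x * g x) \<in> smooth_funs M W"
  using assms(3,4) Ck_mult[OF smooth_manifold_chart_open[OF assms(1) _ assms(2)]]
  by (fastforce simp: smooth_funs_def Csmooth_def)

lemma Cinf_diff:
  assumes "smooth_manifold M" "f \<in> Cinf M" "g \<in> Cinf M"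
  shows "(\<lambda>x. f x - g x) \<in> Cinf M"
proof -
  have "(\<lambda>x. f x + (-1) * g x) \<in> Cinf M"
    by (intro smooth_funs_add smooth_funs_mult smooth_funs_const assms) auto
  then show ?thesis by simp
qed

text \<open>Serves non-smooth \<open>f\<close>: there \<open>\<lambda>x. Y x f\<close> is the zero
  function, and a bracket of vector fields has to vanish as well.\<close>

lemma tangent_space_zero_fun:
  assumes "D \<in> tangent_space M p"
  shows "D (\<lambda>_. 0) = 0"
proof -
  have "\<forall>f\<in>Cinf M. \<forall>a::real. D (\<lambda>x. a * f x) = a * D f"
    using assms unfolding tangent_space_def by blast
  from bspec[OF this smooth_funs_const[of 0], THEN spec, of 0] show ?thesis by simp
qed

section \<open>Vector fields and their bracket\<close>

lemma vfields_tangent: "X \<in> vfields M \<Longrightarrow> X p \<in> tangent_space M p"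
  by (simp add: vfields_def)

lemma vfields_Cinf: "X \<in> vfields M \<Longrightarrow> f \<in> Cinf M \<Longrightarrow> (\<lambda>p. X p f) \<in> Cinf M"
  by (simp add: vfields_def)

lemma vfields_nonsmooth: "X \<in> vfields M \<Longrightarrow> f \<notin> Cinf M \<Longrightarrow> X p f = 0"
  using vfields_tangent by (fastforce simp: tangent_space_def)

lemma vfields_fun_add:
  "X \<in> vfields M \<Longrightarrow> f \<in> Cinf M \<Longrightarrow> g \<in> Cinf M \<Longrightarrow> X p (\<lambda>x. f x + g x) = X p f + X p g"
  using vfields_tangent[of X M p] unfolding tangent_space_def plus_fun_def by blast

lemma vfields_fun_mult:
  "X \<in> vfields M \<Longrightarrow> f \<in> Cinf M \<Longrightarrow> g \<in> Cinf M \<Longrightarrow> X p (\<lambda>x. f x * g x) = f p * X p g + g p * X p f"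
  using vfields_tangent[of X M p] unfolding tangent_space_def times_fun_def by blast

lemma vfields_fun_scale:
  "X \<in> vfields M \<Longrightarrow> f \<in> Cinf M \<Longrightarrow> X p (\<lambda>x. a * f x) = a * X p f"
  using vfields_tangent[of X M p] unfolding tangent_space_def by blast

lemma vfieldsI:
  assumes "\<And>p f. f \<notin> Cinf M \<Longrightarrow> X p f = 0"
    and "\<And>p f g. f \<in> Cinf M \<Longrightarrow> g \<in> Cinf M \<Longrightarrow> X p (\<lambda>x. f x + g x) = X p f + X p g"
    and "\<And>p f g. f \<in> Cinf M \<Longrightarrow> g \<in> Cinf M \<Longrightarrow> X p (\<lambda>x. f x * g x) = f p * X p g + g p * X p f"
    and "\<And>p f a. f \<in> Cinf M \<Longrightarrow> X p (\<lambda>x. a * f x) = a * X p f"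
    and "\<And>f. f \<in> Cinf M \<Longrightarrow> (\<lambda>p. X p f) \<in> Cinf M"
  shows "X \<in> vfields M"
  using assms unfolding vfields_def tangent_space_def plus_fun_def times_fun_def by blast

lemma vfields_zero: "0 \<in> vfields M"
  by (rule vfieldsI) (auto simp: smooth_funs_const)

lemma vfields_add:
  assumes M: "smooth_manifold M" and X: "X \<in> vfields M" and Y: "Y \<in> vfields M"
  shows "X + Y \<in> vfields M"
proof (rule vfieldsI)
  fix f assume "f \<in> Cinf M"
  then show "(\<lambda>p. (X + Y) p f) \<in> Cinf M"
    using smooth_funs_add[OF M open_UNIV vfields_Cinf[OF X] vfields_Cinf[OF Y]] by simp
qed (use X Y in \<open>auto simp: vfields_nonsmooth vfields_fun_add vfields_fun_mult vfields_fun_scale algebra_simps\<close>)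

lemma vfields_bracket:
  assumes M: "smooth_manifold M" and X: "X \<in> vfields M" and Y: "Y \<in> vfields M"
  shows "vf_bracket X Y \<in> vfields M"
proof (rule vfieldsI)
  fix p f assume f: "f \<notin> Cinf M"
  then show "vf_bracket X Y p f = 0"
    using tangent_space_zero_fun[OF vfields_tangent[OF X]] tangent_space_zero_fun[OF vfields_tangent[OF Y]]
      vfields_nonsmooth[OF X f] vfields_nonsmooth[OF Y f] by (simp add: vf_bracket_def)
next
  fix p f g assume f: "f \<in> Cinf M" and g: "g \<in> Cinf M"
  note s = vfields_Cinf[OF X f] vfields_Cinf[OF X g] vfields_Cinf[OF Y f] vfields_Cinf[OF Y g]
  show "vf_bracket X Y p (\<lambda>x. f x + g x) = vf_bracket X Y p f + vf_bracket X Y p g"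
    by (simp add: vf_bracket_def vfields_fun_add[OF X] vfields_fun_add[OF Y] f g s)
  \<comment> \<open>The mixed products of first derivatives of \<open>f\<close> and \<open>g\<close>
    are the same in both orders and cancel.\<close>
  show "vf_bracket X Y p (\<lambda>x. f x * g x) = f p * vf_bracket X Y p g + g p * vf_bracket X Y p f"
    by (simp add: vf_bracket_def vfields_fun_mult[OF X] vfields_fun_mult[OF Y] vfields_fun_add[OF X]
        vfields_fun_add[OF Y] smooth_funs_mult[OF M open_UNIV] f g s algebra_simps)
next
  fix p f a assume f: "f \<in> Cinf M"
  show "vf_bracket X Y p (\<lambda>x. a * f x) = a * vf_bracket X Y p f"
    by (simp add: vf_bracket_def vfields_fun_scale[OF X] vfields_fun_scale[OF Y] f
        vfields_Cinf[OF X f] vfields_Cinf[OF Y f] algebra_simps)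
next
  fix f assume f: "f \<in> Cinf M"
  show "(\<lambda>p. vf_bracket X Y p f) \<in> Cinf M"
    unfolding vf_bracket_def by (intro Cinf_diff[OF M] vfields_Cinf[OF X] vfields_Cinf[OF Y] f)
qed

lemma vf_bracket_add:
  assumes M: "smooth_manifold M" and X: "X \<in> vfields M" and Y: "Y \<in> vfields M" and Z: "Z \<in> vfields M"
  shows "vf_bracket X (Y + Z) = vf_bracket X Y + vf_bracket X Z"
proof (intro ext)
  fix p f
  show "vf_bracket X (Y + Z) p f = (vf_bracket X Y + vf_bracket X Z) p f"
  proof (cases "f \<in> Cinf M")
    case True
    then show ?thesis
      by (simp add: vf_bracket_def vfields_fun_add[OF X] vfields_Cinf[OF Y] vfields_Cinf[OF Z])
  next
    case False
    note z = tangent_space_zero_fun[OF vfields_tangent[OF X]] tangent_space_zero_fun[OF vfields_tangent[OF Y]]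
      tangent_space_zero_fun[OF vfields_tangent[OF Z]]
    show ?thesis
      by (simp add: vf_bracket_def vfields_nonsmooth[OF X False] vfields_nonsmooth[OF Y False]
          vfields_nonsmooth[OF Z False] z)
  qed
qed

lemma linear_scale_sec: "linear (scale_sec f)"
  by (rule linearI) (auto simp: scale_sec_def scaleR_fun_def fun_eq_iff algebra_simps)

section \<open>Sections form a module over the smooth functions\<close>

lemma vector_bundle_frame:
  assumes "vector_bundle E" "(U, e) \<in> frames E"
  shows "open U" "p \<in> U \<Longrightarrow> frame_basis (\<lambda>i. e i p) (brank E) (fibre E p)"
proof -
  have "\<forall>(U, e)\<in>frames E. open U \<and> (\<forall>p\<in>U. frame_basis (\<lambda>i. e i p) (brank E) (fibre E p)) \<and>
        (\<forall>i<brank E. e i \<in> local_sections E U)"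
    using assms(1) unfolding vector_bundle_def by (rule conjunct2[THEN conjunct1])
  from bspec[OF this assms(2)]
  show "open U" "p \<in> U \<Longrightarrow> frame_basis (\<lambda>i. e i p) (brank E) (fibre E p)" by simp_all
qed

lemma vector_bundle_fibre_subspace:
  assumes "vector_bundle E"
  shows "subspace (fibre E p)"
proof -
  have "p \<in> (\<Union>(U, e)\<in>frames E. U)"
    using assms unfolding vector_bundle_def by (metis UNIV_I)
  then obtain U e where "(U, e) \<in> frames E" "p \<in> U" by auto
  from vector_bundle_frame(2)[OF assms this] show ?thesis
    unfolding frame_basis_def by (metis subspace_span)
qed

lemma subbundle_subspace:
  assumes "subbundle E K"
  shows "subspace (K p)"
proof -
  obtain d where "\<forall>p. \<exists>U e. open U \<and> p \<in> U \<and> (\<forall>i<brank E. e i \<in> local_sections E U) \<and>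
        (\<forall>x\<in>U. frame_basis (\<lambda>i. e i x) (brank E) (fibre E x) \<and> frame_basis (\<lambda>i. e i x) d (K x))"
    using assms unfolding subbundle_def by blast
  then obtain e :: "nat \<Rightarrow> 'a \<Rightarrow> 'b" where "frame_basis (\<lambda>i. e i p) d (K p)" by meson
  then show ?thesis unfolding frame_basis_def by (metis subspace_span)
qed

lemma sections_scale:
  assumes E: "vector_bundle E" and f: "f \<in> Cinf E" and s: "s \<in> sections E"
  shows "scale_sec f s \<in> sections E"
proof -
  have M: "smooth_manifold E" using E by (simp add: vector_bundle_def)
  show ?thesis
    unfolding local_sections_def
  proof (intro CollectI conjI ballI, goal_cases)
    case (1 p)
    then show ?case using s subspace_scale[OF vector_bundle_fibre_subspace[OF E]]
      by (simp add: local_sections_def scale_sec_def)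
  next
    case (2 Ue)
    obtain U e where Ue: "Ue = (U, e)" by (cases Ue)
    then have U: "open U" using 2 vector_bundle_frame(1)[OF E] by blast
    obtain a where a: "\<forall>i<brank E. a i \<in> smooth_funs E (U \<inter> UNIV)"
        "\<forall>p\<in>U \<inter> UNIV. s p = (\<Sum>i<brank E. a i p *\<^sub>R e i p)"
      using s 2 unfolding local_sections_def Ue by fast
    have "\<forall>i<brank E. (\<lambda>p. f p * a i p) \<in> smooth_funs E (U \<inter> UNIV)"
      using a(1) smooth_funs_mult[OF M _ smooth_funs_mono[OF f]] U by simp
    moreover have "\<forall>p\<in>U \<inter> UNIV. scale_sec f s p = (\<Sum>i<brank E. (f p * a i p) *\<^sub>R e i p)"
      using a(2) by (simp add: scale_sec_def scaleR_sum_right)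
    ultimately show ?case unfolding Ue case_prod_conv
      by (intro exI[of _ "\<lambda>i p. f p * a i p"] conjI)
  qed
qed

lemma sections_add:
  assumes E: "vector_bundle E" and s: "s \<in> sections E" and t: "t \<in> sections E"
  shows "s + t \<in> sections E"
proof -
  have M: "smooth_manifold E" using E by (simp add: vector_bundle_def)
  show ?thesis
    unfolding local_sections_def
  proof (intro CollectI conjI ballI, goal_cases)
    case (1 p)
    then show ?case using s t subspace_add[OF vector_bundle_fibre_subspace[OF E]]
      by (simp add: local_sections_def)
  next
    case (2 Ue)
    obtain U e where Ue: "Ue = (U, e)" by (cases Ue)
    then have U: "open U" using 2 vector_bundle_frame(1)[OF E] by blast
    obtain a where a: "\<forall>i<brank E. a i \<in> smooth_funs E (U \<inter> UNIV)"
        "\<forall>p\<in>U \<inter> UNIV. s p = (\<Sum>i<brank E. a i p *\<^sub>R e i p)"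
      using s 2 unfolding local_sections_def Ue by fast
    obtain b where b: "\<forall>i<brank E. b i \<in> smooth_funs E (U \<inter> UNIV)"
        "\<forall>p\<in>U \<inter> UNIV. t p = (\<Sum>i<brank E. b i p *\<^sub>R e i p)"
      using t 2 unfolding local_sections_def Ue by fast
    have "\<forall>i<brank E. (\<lambda>p. a i p + b i p) \<in> smooth_funs E (U \<inter> UNIV)"
      using a(1) b(1) smooth_funs_add[OF M] U by simp
    moreover have "\<forall>p\<in>U \<inter> UNIV. (s + t) p = (\<Sum>i<brank E. (a i p + b i p) *\<^sub>R e i p)"
      using a(2) b(2) by (simp add: scaleR_add_left sum.distrib)
    ultimately show ?case unfolding Ue case_prod_conv
      by (intro exI[of _ "\<lambda>i p. a i p + b i p"] conjI)
  qed
qed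

lemma sections_zero:
  assumes E: "vector_bundle E"
  shows "0 \<in> sections E"
  unfolding local_sections_def
proof (intro CollectI conjI ballI, goal_cases)
  case (1 p)
  then show ?case using subspace_0[OF vector_bundle_fibre_subspace[OF E]] by simp
next
  case (2 Ue)
  then show ?case
    by (cases Ue) (auto intro!: exI[of _ "\<lambda>_ _. 0"] smooth_funs_const)
qed

lemma subspace_sections:
  assumes E: "vector_bundle E"
  shows "subspace (sections E)"
proof -
  have "r *\<^sub>R s \<in> sections E" if "s \<in> sections E" for r s
    using sections_scale[OF E smooth_funs_const that, of r] by (simp add: scale_sec_const)
  then show ?thesis
    using sections_zero[OF E] sections_add[OF E] by (auto simp: subspace_def)
qed

lemma subspace_sub_sections:
  assumes E: "vector_bundle E" and K: "subbundle E K"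
  shows "subspace (sub_sections E K)"
  using subspace_sections[OF E] subbundle_subspace[OF K]
  by (auto simp: subspace_def sub_sections_def scaleR_fun_def)

lemma vfields_scale:
  assumes M: "smooth_manifold M" and X: "X \<in> vfields M" and h: "h \<in> Cinf M"
  shows "scale_vf h X \<in> vfields M"
proof (rule vfieldsI)
  fix f assume "f \<in> Cinf M"
  then show "(\<lambda>p. scale_vf h X p f) \<in> Cinf M"
    unfolding scale_vf_def by (intro smooth_funs_mult[OF M] h vfields_Cinf[OF X]) auto
qed (simp_all add: scale_vf_def vfields_nonsmooth[OF X] vfields_fun_add[OF X] vfields_fun_mult[OF X]
  vfields_fun_scale[OF X] algebra_simps)

section \<open>Multilinear maps on tuples\<close>

lemma scale_sec_zero [simp]: "scale_sec f 0 = 0"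
  by (simp add: scale_sec_def fun_eq_iff)

lemma tuples_update: "xs \<in> tuples n S \<Longrightarrow> x \<in> S \<Longrightarrow> xs[i := x] \<in> tuples n S"
  using set_update_subset_insert[of xs i x] by (auto simp: tuples_def)

lemma multilinear_onI:
  assumes F: "mlin_on R sm scale_sec S F" and G: "\<And>xs. xs \<in> tuples n S \<Longrightarrow> G xs = F xs"
    and "\<And>x y. x \<in> S \<Longrightarrow> y \<in> S \<Longrightarrow> x + y \<in> S" "\<And>f x. f \<in> R \<Longrightarrow> x \<in> S \<Longrightarrow> sm f x \<in> S"
  shows "multilinear_on R sm S n G"
  unfolding multilinear_on_def
proof (intro ballI allI impI)
  fix xs i x y f assume xs: "xs \<in> tuples n S" and i: "i < n" and xyf: "x \<in> S" "y \<in> S" "f \<in> R"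
  have us: "set (take i xs) \<subseteq> S" and vs: "set (drop (Suc i) xs) \<subseteq> S"
    using xs set_take_subset[of i xs] set_drop_subset[of "Suc i" xs] by (auto simp: tuples_def)
  have "G (xs[i := z]) = F (take i xs @ z # drop (Suc i) xs)" if "z \<in> S" for z
    using G[OF tuples_update[OF xs that], of i] upd_conv_take_nth_drop[of i xs z] i xs
    by (simp add: tuples_def)
  then show "G (xs[i := x + y]) = G (xs[i := x]) + G (xs[i := y]) \<and>
      G (xs[i := sm f x]) = scale_sec f (G (xs[i := x]))"
    using lin_on_addD[OF mlin_onD[OF F us vs] xyf(1,2)] lin_on_scaleD[OF mlin_onD[OF F us vs] xyf(1,3)]
      xyf assms(3,4) by simp
qed

lemma multilinear_onD:
  assumes "multilinear_on R sm S n F" "R \<noteq> {}"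
    and "set us \<subseteq> S" "set vs \<subseteq> S" "Suc (length us + length vs) = n"
  shows "lin_on R sm scale_sec S (\<lambda>x. F (us @ x # vs))"
proof -
  have m: "F (us @ (x + y) # vs) = F (us @ x # vs) + F (us @ y # vs) \<and>
      F (us @ sm f x # vs) = scale_sec f (F (us @ x # vs))"
    if "x \<in> S" "y \<in> S" "f \<in> R" for x y f
  proof -
    have "us @ x # vs \<in> tuples n S" "length us < n" using that assms by (auto simp: tuples_def)
    from assms(1)[unfolded multilinear_on_def, rule_format, OF this that] show ?thesis by simp
  qed
  show ?thesis using m assms(2) unfolding lin_on_def by blast
qed

text \<open>The alternative fits a cochain of fixed bidegree: with its other arguments fixed, it can
  be nonzero for one length only.\<close>

lemma mlin_on_lengthI:
  assumes "R \<noteq> {}"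
    and "\<And>n. multilinear_on R sm S n F \<or> (\<forall>xs. length xs = n \<longrightarrow> F xs = 0)"
  shows "mlin_on R sm scale_sec S F"
proof (rule mlin_onI)
  fix us vs assume uv: "set us \<subseteq> S" "set vs \<subseteq> S"
  show "lin_on R sm scale_sec S (\<lambda>x. F (us @ x # vs))"
    using assms(2)[of "Suc (length us + length vs)"]
  proof
    assume "multilinear_on R sm S (Suc (length us + length vs)) F"
    from multilinear_onD[OF this assms(1) uv refl] show ?thesis .
  qed (simp add: lin_on_def)
qed

lemma alternating_onI:
  assumes F: "alt_on S F" and G: "\<And>xs. xs \<in> tuples n S \<Longrightarrow> G xs = F xs"
  shows "alternating_on S n G"
  unfolding alternating_on_def
proof (intro ballI allI impI, elim conjE)
  fix xs i j assume xs: "xs \<in> tuples n S" and ij: "i < j" "j < n" "xs ! i = xs ! j"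
  let ?ws = "take (j - Suc i) (drop (Suc i) xs)"
  have l: "length xs = n" and st: "set xs \<subseteq> S" using xs by (auto simp: tuples_def)
  have "drop (Suc i) xs = ?ws @ xs ! j # drop (Suc j) xs"
    using id_take_nth_drop[of "j - Suc i" "drop (Suc i) xs"] ij l by simp
  then have e: "xs = take i xs @ xs ! i # ?ws @ xs ! i # drop (Suc j) xs"
    using id_take_nth_drop[of i xs] ij l by simp
  have "set (take i xs) \<subseteq> S" "set ?ws \<subseteq> S" "set (drop (Suc j) xs) \<subseteq> S" "xs ! i \<in> S"
    using st ij l by (auto dest!: in_set_takeD in_set_dropD)
  from alt_on_repeat[OF F this] show "G xs = 0"
    using G[OF xs] e by simp
qed

text \<open>Polarisation: the value with \<open>x + y\<close> in both neighbouring places is zero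
  and expands to the sum of the two mixed values.\<close>

lemma alt_on_lengthI:
  assumes "R \<noteq> {}" "\<And>x y. x \<in> S \<Longrightarrow> y \<in> S \<Longrightarrow> x + y \<in> S"
    and "\<And>n. multilinear_on R sm S n F \<and> alternating_on S n F \<or> (\<forall>xs. length xs = n \<longrightarrow> F xs = 0)"
  shows "alt_on S F"
proof (rule alt_onI)
  fix us vs x y assume uv: "set us \<subseteq> S" "set vs \<subseteq> S" and xy: "x \<in> S" "y \<in> S"
  let ?n = "Suc (Suc (length us + length vs))"
  show "F (us @ x # y # vs) = - F (us @ y # x # vs)"
    using assms(3)[of ?n]
  proof
    assume *: "multilinear_on R sm S ?n F \<and> alternating_on S ?n F"
    then have m: "multilinear_on R sm S ?n F" and a: "alternating_on S ?n F" by auto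
    have 0: "F (us @ z # z # vs) = 0" if "z \<in> S" for z
    proof -
      have "us @ z # z # vs \<in> tuples ?n S" using uv that by (auto simp: tuples_def)
      from bspec[OF a[unfolded alternating_on_def] this, rule_format, of "length us" "Suc (length us)"]
      show ?thesis by (simp add: nth_append)
    qed
    have 1: "F (us @ (x + y) # z # vs) = F (us @ x # z # vs) + F (us @ y # z # vs)" if "z \<in> S" for z
      using lin_on_addD[OF multilinear_onD[OF m assms(1) uv(1), of "z # vs"] xy] uv that by simp
    have 2: "F (us @ z # (x + y) # vs) = F (us @ z # x # vs) + F (us @ z # y # vs)" if "z \<in> S" for z
      using lin_on_addD[OF multilinear_onD[OF m assms(1), of "us @ [z]" vs] xy] uv that by simp
    have "F (us @ x # y # vs) + F (us @ y # x # vs) = 0"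
      using 0[OF assms(2)[OF xy]] 0[OF xy(1)] 0[OF xy(2)] 1[OF assms(2)[OF xy]] 2[OF xy(1)] 2[OF xy(2)]
      by simp
    then show ?thesis by (simp only: eq_neg_iff_add_eq_0)
  qed simp
qed

lemma symmetric_onI:
  assumes F: "symm_on S F" and G: "\<And>xs. xs \<in> tuples n S \<Longrightarrow> G xs = F xs"
  shows "symmetric_on S n G"
  unfolding symmetric_on_def
proof (intro ballI impI)
  fix xs ys assume "xs \<in> tuples n S" "ys \<in> tuples n S" "mset ys = mset xs"
  then show "G ys = G xs"
    using G symm_on_mset[OF F, of ys xs] by (auto simp: tuples_def)
qed

lemma symm_on_lengthI:
  assumes "\<And>n. symmetric_on S n F \<or> (\<forall>xs. length xs = n \<longrightarrow> F xs = 0)"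
  shows "symm_on S F"
proof (rule symm_onI)
  fix us vs x y assume uv: "set us \<subseteq> S" "set vs \<subseteq> S" "x \<in> S" "y \<in> S"
  let ?n = "Suc (Suc (length us + length vs))"
  show "F (us @ x # y # vs) = F (us @ y # x # vs)"
    using assms[of ?n]
  proof
    assume "symmetric_on S ?n F"
    from this[unfolded symmetric_on_def, rule_format, of "us @ y # x # vs" "us @ x # y # vs"]
    show ?thesis using uv by (simp add: tuples_def add_mset_commute)
  qed simp
qed

lemma multilinear_on_length_cong:
  assumes "\<And>xs. length xs = n \<Longrightarrow> F xs = G xs"
  shows "multilinear_on R sm S n F \<longleftrightarrow> multilinear_on R sm S n G"
  unfolding multilinear_on_def using assms by (auto simp: tuples_def)

lemma symmetric_on_length_cong:
  assumes "\<And>xs. length xs = n \<Longrightarrow> F xs = G xs"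
  shows "symmetric_on S n F \<longleftrightarrow> symmetric_on S n G"
  unfolding symmetric_on_def using assms by (auto simp: tuples_def)

lemma dwedge_short: "length xs < length \<theta>s \<Longrightarrow> dwedge \<theta>s G xs = 0"
proof (induction \<theta>s arbitrary: G xs)
  case (Cons \<theta> \<theta>s)
  have "dwedge (\<theta> # \<theta>s) G xs = asum xs (\<lambda>_ _. 0)"
    unfolding dwedge.simps by (rule asum_cong[where V = UNIV]) (use Cons in auto)
  then show ?case by simp
qed simp

text \<open>The alternating counterpart of \<open>dsum_eq_ssum\<close>: moving the modified entry to
  the front gives the sign of its position.\<close>

lemma dsum_eq_asum:
  assumes "alt_on S F" "set xs \<subseteq> S" "\<And>y. y \<in> S \<Longrightarrow> \<phi> y \<in> S"
  shows "dsum xs \<phi> F = asum xs (\<lambda>y ys. F (\<phi> y # ys))"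
  using assms(1,2)
proof (induction xs arbitrary: F)
  case (Cons x xs)
  have "dsum xs \<phi> (\<lambda>ys. F (x # ys)) = asum xs (\<lambda>y ys. F (x # \<phi> y # ys))"
    using Cons by (intro Cons.IH alt_on_Cons) auto
  also have "\<dots> = asum xs (\<lambda>y ys. - F (\<phi> y # x # ys))"
  proof (rule asum_cong[where V = S])
    fix y ys assume "y \<in> S" "set ys \<subseteq> S"
    then show "F (x # \<phi> y # ys) = - F (\<phi> y # x # ys)"
      using alt_onD[OF Cons.prems(1), of "[]" ys x "\<phi> y"] Cons.prems assms(3) by simp
  qed (use Cons.prems in simp)
  finally show ?case by (simp add: asum_minus)
qed simp

text \<open>\<open>F\<close> is only ever applied to nonempty lists, so \<open>hd\<close> and \<open>tl\<close> are harmless.\<close>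

primrec brk_sum :: "('x \<Rightarrow> 'x \<Rightarrow> 'x) \<Rightarrow> 'x list \<Rightarrow> ('x list \<Rightarrow> 'v::real_vector) \<Rightarrow> 'v" where
  "brk_sum br [] F = 0"
| "brk_sum br (x # xs) F = - asum xs (\<lambda>y ys. F (br x y # ys)) + brk_sum br xs (\<lambda>ys. F (hd ys # x # tl ys))"

lemma brk_sum_cong:
  assumes "\<And>a b. a \<in> S \<Longrightarrow> b \<in> S \<Longrightarrow> br a b \<in> S" "set xs \<subseteq> S"
    and "\<And>y ys. y \<in> S \<Longrightarrow> set ys \<subseteq> S \<Longrightarrow> F (y # ys) = G (y # ys)"
  shows "brk_sum br xs F = brk_sum br xs G"
  using assms(2,3)
proof (induction xs arbitrary: F G)
  case (Cons x xs)
  have "asum xs (\<lambda>y ys. F (br x y # ys)) = asum xs (\<lambda>y ys. G (br x y # ys))"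
    by (rule asum_cong[where V = S]) (use Cons.prems assms(1) in auto)
  moreover have "brk_sum br xs (\<lambda>ys. F (hd ys # x # tl ys)) = brk_sum br xs (\<lambda>ys. G (hd ys # x # tl ys))"
    by (rule Cons.IH) (use Cons.prems in auto)
  ultimately show ?case by simp
qed simp

lemma brk_sum_scaleR: "brk_sum br xs (\<lambda>ys. r *\<^sub>R F ys) = r *\<^sub>R brk_sum br xs F"
proof (induction xs arbitrary: F)
  case (Cons x xs)
  then show ?case by (simp add: asum_scaleR scaleR_diff_right)
qed simp

lemma brk_sum_index:
  "brk_sum br xs F = (\<Sum>j<length xs. \<Sum>i<j. (-1) ^ (i + j) *\<^sub>R F (br (xs ! i) (xs ! j) # omit i (omit j xs)))"
proof (induction xs arbitrary: F)
  case (Cons x xs)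
  have "(\<Sum>j<Suc (length xs). \<Sum>i<j. (-1) ^ (i + j) *\<^sub>R
      F (br ((x # xs) ! i) ((x # xs) ! j) # omit i (omit j (x # xs)))) =
    (\<Sum>j<length xs. (-1) ^ Suc j *\<^sub>R F (br x (xs ! j) # omit j xs) +
       (\<Sum>i<j. (-1) ^ (i + j) *\<^sub>R F (br (xs ! i) (xs ! j) # x # omit i (omit j xs))))"
    unfolding sum.lessThan_Suc_shift by simp
  also have "\<dots> = - asum xs (\<lambda>y ys. F (br x y # ys)) + brk_sum br xs (\<lambda>ys. F (hd ys # x # tl ys))"
    by (simp add: sum.distrib sum_subtractf asum_index Cons.IH)
  finally show ?case by simp
qed simp

context ideal_conn
begin

text \<open>The Lie derivative of forms, with the alternating arguments as parameters; it
  corresponds to \<open>lieD\<close>.\<close>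

definition wlie0 :: "'g \<Rightarrow> ('g, 'x) raw \<Rightarrow> ('g, 'x) raw" where
  "wlie0 a c as bs xs = br a (c as bs xs) - dsum bs (br a) (\<lambda>bs. c as bs xs)
     - dsum xs (act a) (\<lambda>xs. c as bs xs)"

text \<open>Each step of the recursion splits \<open>wlie a\<close> into \<open>wlie0 a\<close> and
  the brackets of \<open>a\<close> with the later arguments. Alternation brings every bracket to the
  first place, where the usual formula has it.\<close>

lemma wdelta_koszul:
  assumes c: "tensorial {} c" and alt: "\<And>bs xs. set bs \<subseteq> S \<Longrightarrow> set xs \<subseteq> V \<Longrightarrow> alt_on S (\<lambda>as. c as bs xs)"
    and carr: "set as \<subseteq> S" "set bs \<subseteq> S" "set xs \<subseteq> V"
  shows "wdelta c as bs xs = (-1) ^ length bs *\<^sub>R (asum as (\<lambda>a as. wlie0 a c as bs xs)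
    + brk_sum br as (\<lambda>as. c as bs xs) - ssum bs (\<lambda>b bs. c as bs (rh b # xs)))"
  using c alt carr(1)
proof (induction as arbitrary: c)
  case (Cons a as)
  let ?s = "(-1) ^ length bs :: real"
  have a: "a \<in> S" and as: "set as \<subseteq> S" using Cons.prems by auto
  note c = Cons.prems(1)
  have IH: "wdelta (contr a c) as bs xs = ?s *\<^sub>R (asum as (\<lambda>b as. wlie0 b (contr a c) as bs xs)
    + brk_sum br as (\<lambda>as. contr a c as bs xs) - ssum bs (\<lambda>b bs. contr a c as bs (rh b # xs)))"
  proof (rule Cons.IH[OF tensorial_contr[OF c a] _ as])
    fix bs :: "'g list" and xs :: "'x list" assume "set bs \<subseteq> S" "set xs \<subseteq> V"
    then show "alt_on S (\<lambda>as. contr a c as bs xs)"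
      unfolding contr_def by (intro alt_on_scaleR alt_on_Cons[OF Cons.prems(2)] a)
  qed
  have 1: "asum as (\<lambda>b as. wlie0 b (contr a c) as bs xs) = ?s *\<^sub>R asum as (\<lambda>b as. wlie0 b c (a # as) bs xs)"
    unfolding asum_scaleR[symmetric]
  proof (rule asum_cong[OF as])
    fix b as' assume b: "b \<in> S" "set as' \<subseteq> S"
    have "c (a # as') bs xs \<in> S" by (rule tensorial_S[OF c]) (use a b carr in auto)
    then show "wlie0 b (contr a c) as' bs xs = ?s *\<^sub>R wlie0 b c (a # as') bs xs"
      using b(1) by (simp add: wlie0_def contr_def br_scaleR dsum_scaleR dsum_sign scaleR_diff_right)
  qed
  have 2: "brk_sum br as (\<lambda>as. contr a c as bs xs) = - (?s *\<^sub>R brk_sum br as (\<lambda>ys. c (hd ys # a # tl ys) bs xs))"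
  proof -
    have "brk_sum br as (\<lambda>as. contr a c as bs xs) = brk_sum br as (\<lambda>ys. (- ?s) *\<^sub>R c (hd ys # a # tl ys) bs xs)"
    proof (rule brk_sum_cong[OF br_S as])
      fix y ys assume "y \<in> S" "set ys \<subseteq> S"
      then have "c (a # y # ys) bs xs = - c (y # a # ys) bs xs"
        using alt_onD[OF Cons.prems(2)[OF carr(2,3)], of "[]" ys a y] a by simp
      then show "contr a c (y # ys) bs xs = (- ?s) *\<^sub>R c (hd (y # ys) # a # tl (y # ys)) bs xs"
        by (simp add: contr_def)
    qed auto
    then show ?thesis unfolding brk_sum_scaleR by simp
  qed
  have 3: "ssum bs (\<lambda>b bs. contr a c as bs (rh b # xs)) = - (?s *\<^sub>R ssum bs (\<lambda>b bs. c (a # as) bs (rh b # xs)))"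
    unfolding contr_def by (rule ssum_sign)
  have 4: "wlie a c as bs xs = wlie0 a c as bs xs - asum as (\<lambda>y ys. c (br a y # ys) bs xs)"
    using dsum_eq_asum[OF Cons.prems(2)[OF carr(2,3)] as br_S[OF a]] by (simp add: wlie_def wlie0_def)
  show ?case
    unfolding wdelta.simps IH 1 2 3 4 by (simp add: algebra_simps)
qed (simp add: wlie0_def)

end

section \<open>Weil cochains\<close>

text \<open>On a Weil cochain no information is lost, because it is zero unless \<open>k\<close> is
  the number of symmetric arguments.\<close>

definition raw_of :: "('m, 'a) cochain \<Rightarrow> ('m \<Rightarrow> 'a, 'm vfield) raw" where
  "raw_of c as bs xs = c (length bs) as bs xs"

lemma weil_forms:
  "c \<in> weil A K p q \<Longrightarrow> k \<le> p \<Longrightarrow> k \<le> q \<Longrightarrow> as \<in> tuples (p - k) (sections A) \<Longrightarrow>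
    c k as \<in> forms A K (q - k) k"
  unfolding weil_def by blast

lemma weil_alpha:
  assumes "c \<in> weil A K p q" "k \<le> p" "k \<le> q" "bs \<in> tuples k (sections A)" "xs \<in> tuples (q - k) (vfields A)"
  shows "multilinear_on (range (\<lambda>a _. a)) scale_sec (sections A) (p - k) (\<lambda>as. c k as bs xs)"
    "alternating_on (sections A) (p - k) (\<lambda>as. c k as bs xs)"
  using assms unfolding weil_def by blast+

lemma weil_leibniz:
  assumes "c \<in> weil A K p q" "f \<in> Cinf A" "k < p" "weil_dom A p q k (a # as) bs xs"
  shows "c k (scale_sec f a # as) bs xs = scale_sec f (c k (a # as) bs xs)
    + df_wedge f (\<lambda>bs. c (Suc k) as (a # bs)) bs xs"
  using assms unfolding weil_def by blast

lemma weil_out: "c \<in> weil A K p q \<Longrightarrow> \<not> weil_dom A p q k as bs xs \<Longrightarrow> c k as bs xs = 0"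
  unfolding weil_def by blast

lemma forms_K:
  "\<gamma> \<in> forms A K m n \<Longrightarrow> bs \<in> tuples n (sections A) \<Longrightarrow> xs \<in> tuples m (vfields A) \<Longrightarrow>
    \<gamma> bs xs \<in> sub_sections A K"
  unfolding forms_def by blast

lemma forms_S:
  assumes "\<gamma> \<in> forms A K m n" "xs \<in> tuples m (vfields A)"
  shows "multilinear_on (Cinf A) scale_sec (sections A) n (\<lambda>bs. \<gamma> bs xs)"
    "symmetric_on (sections A) n (\<lambda>bs. \<gamma> bs xs)"
  using assms unfolding forms_def by blast+

lemma forms_V:
  assumes "\<gamma> \<in> forms A K m n" "bs \<in> tuples n (sections A)"
  shows "multilinear_on (Cinf A) scale_vf (vfields A) m (\<lambda>xs. \<gamma> bs xs)"
    "alternating_on (vfields A) m (\<lambda>xs. \<gamma> bs xs)"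
  using assms unfolding forms_def by blast+

lemma df_wedge_asum:
  "df_wedge f \<gamma> bs xs = asum xs (\<lambda>x ys. scale_sec (\<lambda>p. x p f) (\<gamma> bs ys))"
proof -
  have "scale_sec (\<lambda>p. (-1) ^ i * x p f) s = (-1) ^ i *\<^sub>R scale_sec (\<lambda>p. x p f) s"
    for i and x :: "'a \<Rightarrow> ('a \<Rightarrow> real) \<Rightarrow> real" and s :: "'a \<Rightarrow> 'b"
    by (simp add: scale_sec_def scaleR_fun_def)
  then show ?thesis by (simp add: df_wedge_def asum_index)
qed

locale im_conn =
  fixes A :: "('m::{second_countable_topology,t2_space}, 'a::real_vector) algebroid"
    and K :: "'m \<Rightarrow> 'a set"
    and w :: "('m, 'a) cochain"
  assumes lie_algebroid: "lie_algebroid A"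
    and ideals: "bundle_of_ideals A K"
    and im: "w \<in> im_connections A K"
begin

abbreviation "S \<equiv> sections A"
abbreviation "KS \<equiv> sub_sections A K"
abbreviation "V \<equiv> vfields A"

lemma vector_bundle: "vector_bundle A"
  using lie_algebroid unfolding lie_algebroid_def by (rule conjunct1)

lemma smooth_manifold: "smooth_manifold A"
  using vector_bundle unfolding vector_bundle_def by (rule conjunct1)

lemma subbundle: "subbundle A K"
  using ideals unfolding bundle_of_ideals_def by (rule conjunct1)

lemma w_weil: "w \<in> weil A K 1 1"
  using im by (simp add: im_connections_def)

lemma w_delta: "delta A 1 1 w k as bs xs = 0"
  using im by (simp add: im_connections_def)

lemma KS_S: "KS \<subseteq> S"
  by (auto simp: sub_sections_def)

lemma const_Cinf: "(\<lambda>_. r) \<in> Cinf A"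
  by (rule smooth_funs_const)

section \<open>The given connection satisfies the axioms of the locale
  \<open>weil_conn\<close>\<close>

lemma conn_C_sub: "a \<in> S \<Longrightarrow> x \<in> V \<Longrightarrow> conn_C w a x \<in> KS"
  unfolding conn_C_def
  using forms_K[OF weil_forms[OF w_weil, of 0 "[a]"], of "[]" "[x]"] by (simp add: tuples_def)

lemma conn_v_sub: "a \<in> S \<Longrightarrow> conn_v w a \<in> KS"
  unfolding conn_v_def
  using forms_K[OF weil_forms[OF w_weil, of 1 "[]"], of "[a]" "[]"] by (simp add: tuples_def)

lemma conn_C_lin:
  assumes "a \<in> S"
  shows "lin_on (Cinf A) scale_vf scale_sec V (conn_C w a)"
proof -
  have "multilinear_on (Cinf A) scale_vf V (Suc 0) (\<lambda>xs. w 0 [a] [] xs)"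
    using forms_V(1)[OF weil_forms[OF w_weil, of 0 "[a]"], of "[]"] assms by (simp add: tuples_def)
  from multilinear_onD[OF this, of "[]" "[]"] const_Cinf show ?thesis
    by (auto simp: conn_C_def[abs_def])
qed

lemma conn_v_lin: "lin_on (Cinf A) scale_sec scale_sec S (conn_v w)"
proof -
  have "multilinear_on (Cinf A) scale_sec S (Suc 0) (\<lambda>bs. w 1 [] bs [])"
    using forms_S(1)[OF weil_forms[OF w_weil, of 1 "[]"], of "[]"] by (simp add: tuples_def)
  from multilinear_onD[OF this, of "[]" "[]"] const_Cinf show ?thesis
    by (auto simp: conn_v_def[abs_def])
qed

lemma conn_C_lin1:
  assumes "x \<in> V"
  shows "lin_on (range (\<lambda>a _. a)) scale_sec scale_sec S (\<lambda>a. conn_C w a x)"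
proof -
  have "multilinear_on (range (\<lambda>a _. a)) scale_sec S (Suc 0) (\<lambda>as. w 0 as [] [x])"
    using weil_alpha(1)[OF w_weil, of 0 "[]" "[x]"] assms by (simp add: tuples_def)
  from multilinear_onD[OF this, of "[]" "[]"] show ?thesis
    by (simp add: conn_C_def)
qed

lemma conn_C_leibniz:
  assumes "f \<in> Cinf A" "a \<in> S" "x \<in> V"
  shows "conn_C w (scale_sec f a) x = scale_sec f (conn_C w a x) + scale_sec (\<lambda>p. x p f) (conn_v w a)"
proof -
  have "weil_dom A 1 1 0 [a] [] [x]" using assms by (simp add: weil_dom_def tuples_def)
  from weil_leibniz[OF w_weil assms(1) _ this]
  show ?thesis by (simp add: conn_C_def conn_v_def df_wedge_asum fun_eq_iff)
qed

lemma conn_eq2: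
  assumes "a \<in> S" "b \<in> S"
  shows "brk A a (conn_v w b) - conn_v w (brk A a b) = conn_C w a (rho A b)"
proof -
  have "weil_dom A (Suc 1) 1 1 [a] [b] []" using assms by (simp add: weil_dom_def tuples_def)
  with w_delta[of 1 "[a]" "[b]" "[]"] show ?thesis
    by (simp add: delta_def lieD_def scale_sec_const omit_def conn_v_def conn_C_def fun_eq_iff)
qed

lemma conn_eq1:
  assumes "a \<in> S" "b \<in> S" "x \<in> V"
  shows "brk A a (conn_C w b x) - conn_C w b (vf_bracket (rho A a) x) -
    (brk A b (conn_C w a x) - conn_C w a (vf_bracket (rho A b) x)) = conn_C w (brk A a b) x"
proof -
  have "weil_dom A (Suc 1) 1 0 [a, b] [] [x]" using assms by (simp add: weil_dom_def tuples_def)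
  with w_delta[of 0 "[a, b]" "[]" "[x]"] show ?thesis
    by (simp add: delta_def lieD_def scale_sec_const omit_def conn_C_def lessThan_Suc algebra_simps)
qed

lemma brk_facts:
  assumes "a \<in> S" "b \<in> S"
  shows "brk A a b \<in> S" "b' \<in> S \<Longrightarrow> brk A a (b + b') = brk A a b + brk A a b'"
    "brk A a (r *\<^sub>R b) = r *\<^sub>R brk A a b" "rho A a \<in> V"
  using lie_algebroid assms unfolding lie_algebroid_def scale_sec_const by blast+

lemma rho_add:
  assumes "a \<in> S" "b \<in> S"
  shows "rho A (a + b) = rho A a + rho A b"
proof -
  have f: "a p \<in> fibre A p" "b p \<in> fibre A p" for p using assms by (auto simp: local_sections_def)
  have "\<forall>p. \<forall>u\<in>fibre A p. \<forall>v\<in>fibre A p. \<forall>a::real. anchor A p u \<in> tangent_space A p \<and>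
        anchor A p (u + v) = anchor A p u + anchor A p v \<and>
        anchor A p (a *\<^sub>R u) = (\<lambda>f. a * anchor A p u f)"
    using lie_algebroid unfolding lie_algebroid_def by blast
  then show ?thesis using f by (auto simp: rho_def fun_eq_iff)
qed

sublocale weil_conn S KS V "brk A" "\<lambda>a. vf_bracket (rho A a)" "rho A" "conn_C w" "conn_v w"
  "Cinf A" scale_sec scale_vf "range (\<lambda>a _. a)" "\<lambda>x f p. x p f"
proof (intro weil_conn.intro ideal_conn.intro weil_conn_axioms.intro, goal_cases)
  case 1 show ?case by (rule subspace_sections[OF vector_bundle])
next
  case 2 show ?case by (rule subspace_sub_sections[OF vector_bundle subbundle])
next
  case 3 show ?case by (rule KS_S)
next
  case 4 show ?case by (rule vfields_zero)
next
  case 5 show ?case by (rule linear_scale_sec)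
next
  case (6 a b) then show ?case by (rule brk_facts)
next
  case (7 a b) then show ?case using ideals unfolding bundle_of_ideals_def by blast
next
  case (8 a b b') then show ?case by (rule brk_facts)
next
  case (9 a b r) then show ?case by (rule brk_facts)
next
  case (10 a x) then show ?case using vfields_bracket[OF smooth_manifold brk_facts(4)] by blast
next
  case (11 a x y) then show ?case using vf_bracket_add[OF smooth_manifold brk_facts(4)] by blast
next
  case (12 a) then show ?case using brk_facts(4) by blast
next
  case (13 a b) then show ?case by (rule rho_add)
next
  case (14 a)
  then have "\<forall>p. anchor A p (a p) = 0"
    using ideals unfolding bundle_of_ideals_def sub_sections_def by blast
  then show ?case by (simp add: rho_def fun_eq_iff)
next
  case (15 a x) then show ?case by (rule conn_C_sub)
next
  case (16 a) then show ?case by (rule conn_C_lin)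
next
  case (17 a) then show ?case by (rule conn_v_sub)
next
  case 18 show ?case by (rule conn_v_lin)
next
  case (19 a) then show ?case using im by (simp add: im_connections_def conn_v_def)
next
  case (20 a b x) then show ?case by (rule conn_eq1)
next
  case (21 a b) then show ?case by (rule conn_eq2)
next
  case (22 f a) then show ?case by (rule sections_scale[OF vector_bundle])
next
  case 23 show ?case using const_Cinf by auto
next
  case (24 x f) then show ?case by (rule vfields_Cinf)
next
  case (25 x) then show ?case by (rule conn_C_lin1)
next
  case (26 f a x) then show ?case by (rule conn_C_leibniz)
qed

lemma raw_of_out:
  assumes "c \<in> weil A K p q" "length as + length bs \<noteq> p \<or> length bs + length xs \<noteq> q"
  shows "raw_of c as bs xs = 0"
  unfolding raw_of_def by (rule weil_out[OF assms(1)]) (use assms(2) in \<open>auto simp: weil_dom_def tuples_def\<close>)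

text \<open>For every property the lengths either match the bidegree, and it is read off from
  \<open>weil\<close>, or all values involved are zero.\<close>

lemma raw_of_raw_weil:
  assumes c: "c \<in> weil A K p q"
  shows "raw_weil (raw_of c)"
proof (rule weilrI)
  have R: "Cinf A \<noteq> {}" "range (\<lambda>a _. a) \<noteq> ({} :: ('m \<Rightarrow> real) set)" using const_Cinf by auto
  note out = raw_of_out[OF c]
  have F: "c (length bs) as \<in> forms A K (length xs) (length bs)"
    if "set as \<subseteq> S" "length as + length bs = p \<and> length bs + length xs = q" for as bs and xs :: "'m vfield list"
    using weil_forms[OF c, of "length bs" as] that by (auto simp: tuples_def)
  have tS: "xs \<in> tuples (length xs) S" if "set xs \<subseteq> S" for xs using that by (simp add: tuples_def)
  have tV: "xs \<in> tuples (length xs) V" if "set xs \<subseteq> V" for xs using that by (simp add: tuples_def)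
  show "tensorial (Cinf A) (raw_of c)"
  proof (rule goodI)
    fix as bs :: "('m \<Rightarrow> 'a) list" and xs :: "'m vfield list"
    assume as: "set as \<subseteq> S"
    { assume bs: "set bs \<subseteq> S" and xs: "set xs \<subseteq> V"
      show "raw_of c as bs xs \<in> KS"
      proof (cases "length as + length bs = p \<and> length bs + length xs = q")
        case True
        from forms_K[OF F[OF as True] tS[OF bs] tV[OF xs]] show ?thesis by (simp add: raw_of_def)
      next
        case False
        with out have "raw_of c as bs xs = 0" by blast
        then show ?thesis by (simp add: subspace_0[OF subspace_K])
      qed }
    { assume xs: "set xs \<subseteq> V"
      have S: "(multilinear_on (Cinf A) scale_sec S n (\<lambda>bs. raw_of c as bs xs) \<and>
            symmetric_on S n (\<lambda>bs. raw_of c as bs xs)) \<or>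
          (\<forall>bs. length bs = n \<longrightarrow> raw_of c as bs xs = 0)" for n
      proof (cases "length as + n = p \<and> n + length xs = q")
        case True
        then have "c n as \<in> forms A K (length xs) n"
          using weil_forms[OF c, of n as] as by (auto simp: tuples_def)
        note f = forms_S[OF this tV[OF xs]]
        have e: "raw_of c as bs xs = c n as bs xs" if "length bs = n" for bs
          using that by (simp add: raw_of_def)
        show ?thesis
          using f multilinear_on_length_cong[of n "\<lambda>bs. raw_of c as bs xs", OF e]
            symmetric_on_length_cong[of n "\<lambda>bs. raw_of c as bs xs", OF e] by blast
      next
        case False
        then show ?thesis using out by blast
      qed
      show "symm_on S (\<lambda>bs. raw_of c as bs xs)"
        by (rule symm_on_lengthI) (use S in blast)
      show "mlin_on (Cinf A) scale_sec scale_sec S (\<lambda>bs. raw_of c as bs xs)"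
        by (rule mlin_on_lengthI[OF R(1)]) (use S in blast) }
    { assume bs: "set bs \<subseteq> S"
      have X: "(multilinear_on (Cinf A) scale_vf V n (\<lambda>xs. raw_of c as bs xs) \<and>
            alternating_on V n (\<lambda>xs. raw_of c as bs xs)) \<or>
          (\<forall>xs. length xs = n \<longrightarrow> raw_of c as bs xs = 0)" for n
      proof (cases "length as + length bs = p \<and> length bs + n = q")
        case True
        then have "c (length bs) as \<in> forms A K n (length bs)"
          using weil_forms[OF c, of "length bs" as] as by (auto simp: tuples_def)
        from forms_V[OF this tS[OF bs]] show ?thesis by (simp add: raw_of_def)
      next
        case False
        then show ?thesis using out by blast
      qed
      show "alt_on V (\<lambda>xs. raw_of c as bs xs)"
        by (rule alt_on_lengthI[OF R(1) vfields_add[OF smooth_manifold] X])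
      show "mlin_on (Cinf A) scale_vf scale_sec V (\<lambda>xs. raw_of c as bs xs)"
        by (rule mlin_on_lengthI[OF R(1)]) (use X in blast) }
  qed simp
  fix bs :: "('m \<Rightarrow> 'a) list" and xs :: "'m vfield list"
  assume bs: "set bs \<subseteq> S" and xs: "set xs \<subseteq> V"
  have X: "(multilinear_on (range (\<lambda>a _. a)) scale_sec S n (\<lambda>as. raw_of c as bs xs) \<and>
        alternating_on S n (\<lambda>as. raw_of c as bs xs)) \<or>
      (\<forall>as. length as = n \<longrightarrow> raw_of c as bs xs = 0)" for n
  proof (cases "n + length bs = p \<and> length bs + length xs = q")
    case True
    then have "length bs \<le> p" "length bs \<le> q" "bs \<in> tuples (length bs) S"
      "xs \<in> tuples (q - length bs) V" "p - length bs = n"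
      using bs xs by (auto simp: tuples_def)
    with weil_alpha[OF c, of "length bs" bs xs] show ?thesis by (simp add: raw_of_def)
  next
    case False
    then show ?thesis using out by blast
  qed
  show "alt_on S (\<lambda>as. raw_of c as bs xs)"
    by (rule alt_on_lengthI[OF R(2) sections_add[OF vector_bundle] X])
  show "mlin_on (range (\<lambda>a _. a)) scale_sec scale_sec S (\<lambda>as. raw_of c as bs xs)"
    by (rule mlin_on_lengthI[OF R(2)]) (use X in blast)
  fix f a and as :: "('m \<Rightarrow> 'a) list" assume f: "f \<in> Cinf A" and a: "a \<in> S" and as: "set as \<subseteq> S"
  show "raw_of c (scale_sec f a # as) bs xs = scale_sec f (raw_of c (a # as) bs xs)
      + asum xs (\<lambda>x ys. scale_sec (\<lambda>p. x p f) (raw_of c as (a # bs) ys))"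
  proof (cases "length (a # as) + length bs = p \<and> length bs + length xs = q")
    case True
    then have "weil_dom A p q (length bs) (a # as) bs xs" "length bs < p"
      using a as bs xs by (auto simp: weil_dom_def tuples_def)
    from weil_leibniz[OF c f this(2,1)] show ?thesis
      by (simp only: raw_of_def df_wedge_asum length_Cons)
  next
    case False
    \<comment> \<open>Moving \<open>a\<close> to the symmetric arguments and dropping a vector field
      preserves both degree sums, so the derivative terms miss the bidegree as well.\<close>
    have "asum xs (\<lambda>x ys. scale_sec (\<lambda>p. x p f) (raw_of c as (a # bs) ys)) = asum xs (\<lambda>_ _. 0)"
    proof (rule asum_cong[where V = UNIV])
      fix y and ys :: "'m vfield list" assume "Suc (length ys) = length xs"
      then have "raw_of c as (a # bs) ys = 0" using False by (intro out) auto
      then show "scale_sec (\<lambda>p. y p f) (raw_of c as (a # bs) ys) = 0" by simp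
    qed simp
    moreover have "raw_of c (scale_sec f a # as) bs xs = 0" "raw_of c (a # as) bs xs = 0"
      using False by (auto intro!: out)
    ultimately show ?thesis by simp
  qed
qed

text \<open>The way back from \<open>raw_of\<close>; the cut-off enforces the convention that
  cochains are zero outside \<open>weil_dom\<close>.\<close>

definition cochain_of :: "nat \<Rightarrow> nat \<Rightarrow> ('m \<Rightarrow> 'a, 'm vfield) raw \<Rightarrow> ('m, 'a) cochain" where
  "cochain_of p q f k as bs xs = (if weil_dom A p q k as bs xs then f as bs xs else 0)"

lemma cochain_of_weil:
  assumes f: "raw_weil f"
  shows "cochain_of p q f \<in> weil A K p q"
  unfolding weil_def
proof (intro CollectI conjI allI impI ballI, goal_cases)
  case (1 k as bs xs)
  then show ?case by (simp add: cochain_of_def)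
next
  note g = raw_weil_tensorial[OF f]
  case (2 k as)
  then have k: "k \<le> p" "k \<le> q" and as: "set as \<subseteq> S" "as \<in> tuples (p - k) S" by (auto simp: tuples_def)
  have e: "cochain_of p q f k as bs xs = f as bs xs" if "bs \<in> tuples k S" "xs \<in> tuples (q - k) V" for bs xs
    using that k as by (simp add: cochain_of_def weil_dom_def)
  show ?case
    unfolding forms_def
  proof (intro CollectI conjI ballI, goal_cases)
    case (1 bs xs)
    then show ?case using e tensorial_K[OF g as(1)] by (simp add: tuples_def)
  next
    case (2 xs)
    then have "set xs \<subseteq> V" by (simp add: tuples_def)
    from multilinear_onI[OF tensorial_mlinS[OF g as(1) this] e sections_add[OF vector_bundle] sections_scale[OF vector_bundle]]
    show ?case using 2 by blast
  next
    case (3 xs)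
    then have "set xs \<subseteq> V" by (simp add: tuples_def)
    from symmetric_onI[OF tensorial_symm[OF g as(1) this] e] show ?case using 3 by blast
  next
    case (4 bs)
    then have "set bs \<subseteq> S" by (simp add: tuples_def)
    from multilinear_onI[OF tensorial_mlinV[OF g as(1) this] e[OF 4] vfields_add[OF smooth_manifold] vfields_scale[OF smooth_manifold]]
    show ?case by blast
  next
    case (5 bs)
    then have "set bs \<subseteq> S" by (simp add: tuples_def)
    from alternating_onI[OF tensorial_alt[OF g as(1) this] e[OF 5]] show ?case by blast
  qed
next
  case (3 k bs xs)
  then have e: "cochain_of p q f k as bs xs = f as bs xs" if "as \<in> tuples (p - k) S" for as
    using that by (simp add: cochain_of_def weil_dom_def)
  have "set bs \<subseteq> S" "set xs \<subseteq> V" using 3 by (auto simp: tuples_def)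
  from multilinear_onI[OF raw_weil_mlin[OF f this] e sections_add[OF vector_bundle]]
  show ?case using sections_scale[OF vector_bundle] const_Cinf by blast
next
  case (4 k bs xs)
  then have e: "cochain_of p q f k as bs xs = f as bs xs" if "as \<in> tuples (p - k) S" for as
    using that by (simp add: cochain_of_def weil_dom_def)
  have "set bs \<subseteq> S" "set xs \<subseteq> V" using 4 by (auto simp: tuples_def)
  from alternating_onI[OF raw_weil_alt[OF f this] e] show ?case by blast
next
  case (5 k h a as bs xs)
  then have d: "weil_dom A p q k (a # as) bs xs" and h: "h \<in> Cinf A" and k: "k < p" by auto
  then have carr: "a \<in> S" "set as \<subseteq> S" "set bs \<subseteq> S" "set xs \<subseteq> V"
    by (auto simp: weil_dom_def tuples_def)
  have "weil_dom A p q k (scale_sec h a # as) bs xs"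
    using d sections_scale[OF vector_bundle h carr(1)] by (simp add: weil_dom_def tuples_def)
  moreover have "asum xs (\<lambda>x ys. scale_sec (\<lambda>p. x p h) (f as (a # bs) ys)) =
      asum xs (\<lambda>x ys. scale_sec (\<lambda>p. x p h) (cochain_of p q f (Suc k) as (a # bs) ys))"
  proof (rule asum_cong[OF carr(4)])
    fix x ys assume "set ys \<subseteq> V" "Suc (length ys) = length xs"
    \<comment> \<open>Here \<open>xs\<close> is nonempty, so \<open>k < q\<close> and the next
      component is still in range.\<close>
    then have "weil_dom A p q (Suc k) as (a # bs) ys"
      using d k by (auto simp: weil_dom_def tuples_def)
    then show "scale_sec (\<lambda>p. x p h) (f as (a # bs) ys) =
        scale_sec (\<lambda>p. x p h) (cochain_of p q f (Suc k) as (a # bs) ys)" by (simp add: cochain_of_def)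
  qed
  ultimately show ?case
    using d raw_weil_leibniz[OF f h carr] by (simp only: df_wedge_asum cochain_of_def if_True)
qed

lemma delta_wdelta:
  assumes c: "c \<in> weil A K p q" and d: "weil_dom A (Suc p) q k as bs xs"
  shows "delta A p q c k as bs xs = wdelta (raw_of c) as bs xs"
proof -
  note W = raw_of_raw_weil[OF c]
  have k: "k = length bs" and carr: "set as \<subseteq> S" "set bs \<subseteq> S" "set xs \<subseteq> V"
    using d by (auto simp: weil_dom_def tuples_def)
  have l: "lieD A a (c (length bs) as') bs xs = wlie0 a (raw_of c) as' bs xs" for a as'
    by (simp add: lieD_def wlie0_def raw_of_def dsum_index)
  have s: "(\<Sum>j<length bs. c (length bs - 1) as (omit j bs) (rho A (bs ! j) # xs)) =
      ssum bs (\<lambda>b bs. raw_of c as bs (rho A b # xs))"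
    unfolding ssum_index by (rule sum.cong[OF refl]) (simp add: raw_of_def length_omit)
  have kz: "wdelta (raw_of c) as bs xs = (-1) ^ length bs *\<^sub>R (asum as (\<lambda>a as. wlie0 a (raw_of c) as bs xs)
      + brk_sum (brk A) as (\<lambda>as. raw_of c as bs xs) - ssum bs (\<lambda>b bs. raw_of c as bs (rho A b # xs)))"
    by (intro wdelta_koszul raw_weil_good0 raw_weil_alt W carr)
  have "delta A p q c k as bs xs = (-1) ^ length bs *\<^sub>R
      ((\<Sum>i<length as. (-1) ^ i *\<^sub>R lieD A (as ! i) (c (length bs) (omit i as)) bs xs)
       + (\<Sum>j<length as. \<Sum>i<j. (-1) ^ (i + j) *\<^sub>R
            c (length bs) (brk A (as ! i) (as ! j) # omit i (omit j as)) bs xs)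
       - (\<Sum>j<length bs. c (length bs - 1) as (omit j bs) (rho A (bs ! j) # xs)))"
    using d unfolding k by (simp only: delta_def if_True scale_sec_const)
  then show ?thesis unfolding kz l s asum_index brk_sum_index raw_of_def .
qed

text \<open>\<open>f\<close> has to agree with \<open>raw_of c\<close> on the carrier only: for
  \<open>delta A p q c\<close> the agreement with \<open>wdelta (raw_of c)\<close> is known just
  there.\<close>

lemma hor_proj_hproj:
  assumes f: "tensorial {} f" and d: "weil_dom A p q k as bs xs"
    and eq: "\<And>as bs xs. set as \<subseteq> S \<Longrightarrow> set bs \<subseteq> S \<Longrightarrow> set xs \<subseteq> V \<Longrightarrow> raw_of c as bs xs = f as bs xs"
  shows "hor_proj A w p q c k as bs xs = hproj f as bs xs"
proof -
  have k: "k = length bs" "k \<le> p" "k \<le> q" "length as = p - k" "length xs = q - k"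
    and carr: "set as \<subseteq> S" "set bs \<subseteq> S" "set xs \<subseteq> V"
    using d by (auto simp: weil_dom_def tuples_def)
  have hb: "map (conn_h w) bs = map hmap bs" by (simp add: conn_h_def hmap_def)
  let ?T = "\<lambda>a. (-1) ^ a *\<^sub>R shuffle_sum as a (\<lambda>J L. dwedge (map (conn_C w) J) (\<lambda>gs ys. f L (map hmap bs @ gs) ys) xs)"
  let ?t = "\<lambda>j. rscale ((-1) ^ (j - k))
          (\<Sum>\<sigma>\<in>shuffles (j - k) (p - j). rscale (of_int (sign \<sigma>))
             (dot_wedge (q - j)
                (\<lambda>gs. c j (map (\<lambda>i. as ! \<sigma> i) [j - k..<p - k]) (map (conn_h w) bs @ gs))
                (map (\<lambda>i. conn_C w (as ! \<sigma> i)) [0..<j - k])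
                [] xs))"
  have "?t (k + a) = ?T a" if a: "a \<le> length as" "a \<le> length xs" for a
  proof -
    let ?b = "p - (k + a)"
    have la: "length as = a + ?b" using a k by simp
    have dw: "dot_wedge (q - (k + a)) (\<lambda>gs. c (k + a) L (map hmap bs @ gs)) (map (conn_C w) J) [] xs =
        dwedge (map (conn_C w) J) (\<lambda>gs ys. f L (map hmap bs @ gs) ys) xs"
      if J: "set J \<subseteq> S" "set L \<subseteq> S" "length J = a" for J L
    proof -
      have "dot_wedge (q - (k + a)) (\<lambda>gs. c (k + a) L (map hmap bs @ gs)) (map (conn_C w) J) [] xs =
          dwedge (map (conn_C w) J) (\<lambda>gs. c (k + a) L (map hmap bs @ gs)) xs"
      proof (rule dot_wedge_dwedge[OF _ carr(3), where W = S])
        fix gs assume g: "length gs = length (map (conn_C w) J)" "set gs \<subseteq> S"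
        have hg: "set (map hmap bs @ gs) \<subseteq> S" using set_map_hmap[OF carr(2)] g by simp
        have e: "c (k + a) L (map hmap bs @ gs) ys = f L (map hmap bs @ gs) ys" if "set ys \<subseteq> V" for ys
          using eq[OF J(2) hg that] g J k by (simp add: raw_of_def)
        show "alt_on V (c (k + a) L (map hmap bs @ gs))"
        proof (rule alt_onI)
          fix us vs x y assume uv: "set us \<subseteq> V" "set vs \<subseteq> V" "x \<in> V" "y \<in> V"
          then show "c (k + a) L (map hmap bs @ gs) (us @ x # y # vs) =
              - c (k + a) L (map hmap bs @ gs) (us @ y # x # vs)"
            using alt_onD[OF tensorial_alt[OF f J(2) hg] uv] by (simp add: e)
        qed
      qed (use a k J in \<open>auto intro!: C_S\<close>)
      also have "\<dots> = dwedge (map (conn_C w) J) (\<lambda>gs ys. f L (map hmap bs @ gs) ys) xs"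
      proof (rule dwedge_cong[OF carr(3), where W = S])
        fix gs ys assume g: "set gs \<subseteq> S" "set ys \<subseteq> V" "length gs = length (map (conn_C w) J)"
        have hg: "set (map hmap bs @ gs) \<subseteq> S" using set_map_hmap[OF carr(2)] g by simp
        show "c (k + a) L (map hmap bs @ gs) ys = f L (map hmap bs @ gs) ys"
          using eq[OF J(2) hg g(2)] g J k by (simp add: raw_of_def)
      qed (use J in \<open>auto intro!: C_S\<close>)
      finally show ?thesis .
    qed
    have nth: "as ! \<sigma> i \<in> S" if "\<sigma> \<in> shuffles a ?b" "i < a + ?b" for \<sigma> i
    proof -
      have "\<sigma> permutes {..<a + ?b}" using that by (simp add: shuffles_def)
      from permutes_in_image[OF this, of i] that have "\<sigma> i < length as" using la by simp
      then show ?thesis using carr(1) nth_mem by blast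
    qed
    have "?t (k + a) = (-1) ^ a *\<^sub>R (\<Sum>\<sigma>\<in>shuffles a ?b. real_of_int (sign \<sigma>) *\<^sub>R
        dot_wedge (q - (k + a)) (\<lambda>gs. c (k + a) (map (\<lambda>i. as ! \<sigma> i) [a..<a + ?b]) (map hmap bs @ gs))
          (map (conn_C w) (map (\<lambda>i. as ! \<sigma> i) [0..<a])) [] xs)"
    proof -
      have "p - k = a + ?b" using la k by linarith
      then show ?thesis
        by (simp only: diff_add_inverse scale_sec_const hb map_map o_def)
    qed
    also have "\<dots> = (-1) ^ a *\<^sub>R (\<Sum>\<sigma>\<in>shuffles a ?b. real_of_int (sign \<sigma>) *\<^sub>R
        dwedge (map (conn_C w) (map (\<lambda>i. as ! \<sigma> i) [0..<a]))
          (\<lambda>gs ys. f (map (\<lambda>i. as ! \<sigma> i) [a..<a + ?b]) (map hmap bs @ gs) ys) xs)"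
    proof (intro arg_cong[where f = "\<lambda>z. (-1) ^ a *\<^sub>R z"] sum.cong refl)
      fix \<sigma> assume "\<sigma> \<in> shuffles a ?b"
      then have "set (map (\<lambda>i. as ! \<sigma> i) [0..<a]) \<subseteq> S" "set (map (\<lambda>i. as ! \<sigma> i) [a..<a + ?b]) \<subseteq> S"
        using nth by auto
      from dw[OF this] show "real_of_int (sign \<sigma>) *\<^sub>R
        dot_wedge (q - (k + a)) (\<lambda>gs. c (k + a) (map (\<lambda>i. as ! \<sigma> i) [a..<a + ?b]) (map hmap bs @ gs))
          (map (conn_C w) (map (\<lambda>i. as ! \<sigma> i) [0..<a])) [] xs = real_of_int (sign \<sigma>) *\<^sub>R
        dwedge (map (conn_C w) (map (\<lambda>i. as ! \<sigma> i) [0..<a]))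
          (\<lambda>gs ys. f (map (\<lambda>i. as ! \<sigma> i) [a..<a + ?b]) (map hmap bs @ gs) ys) xs"
        by simp
    qed
    also have "\<dots> = ?T a"
      using sum_shuffles[OF la, of "\<lambda>J L. dwedge (map (conn_C w) J) (\<lambda>gs ys. f L (map hmap bs @ gs) ys) xs"]
      by simp
    finally show ?thesis .
  qed
  note t = this
  have "hor_proj A w p q c k as bs xs = (\<Sum>j = k..min p q. ?t j)"
    using d by (simp add: hor_proj_def)
  \<comment> \<open>The index becomes the number \<open>a = j - k\<close> of projected
    arguments.\<close>
  also have "\<dots> = (\<Sum>a\<le>min (length as) (length xs). ?t (k + a))"
  proof (rule sum.reindex_bij_witness[where i = "\<lambda>a. k + a" and j = "\<lambda>j. j - k"])
  qed (use k in auto)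
  also have "\<dots> = (\<Sum>a\<le>min (length as) (length xs). ?T a)"
    by (rule sum.cong[OF refl], rule t) auto
  \<comment> \<open>Each projected argument needs a vector field of its own, so the additional terms
    with \<open>a > length xs\<close> are zero.\<close>
  also have "\<dots> = (\<Sum>a\<le>length as. ?T a)"
  proof (rule sum.mono_neutral_left)
    show "\<forall>a\<in>{..length as} - {..min (length as) (length xs)}. ?T a = 0"
    proof
      fix a assume "a \<in> {..length as} - {..min (length as) (length xs)}"
      then have "length xs < a" by auto
      then have "shuffle_sum as a (\<lambda>J L. dwedge (map (conn_C w) J) (\<lambda>gs ys. f L (map hmap bs @ gs) ys) xs) = shuffle_sum as a (\<lambda>_ _. 0)"
        by (intro shuffle_sum_cong[OF carr(1)] dwedge_short) simp
      then show "?T a = 0" using shuffle_sum_scaleR[of as a 0 "\<lambda>_ _. 0"] by simp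
    qed
  qed auto
  also have "\<dots> = hproj f as bs xs"
    using hproj_expand[OF f carr] by simp
  finally show ?thesis .
qed

end

theorem proposition4p10:
  fixes A :: "('m::{second_countable_topology,t2_space}, 'a::real_vector) algebroid"
    and K :: "'m \<Rightarrow> 'a set"
    and w :: "('m, 'a) cochain"
    and p q :: nat
  assumes "lie_algebroid A"
    and "bundle_of_ideals A K"
    and "w \<in> im_connections A K"
  shows "hor_proj A w p q \<in> weil A K p q \<rightarrow> weil_hor A K p q \<and>
    (\<forall>c\<in>weil A K p q.
       hor_proj A w (Suc p) q (delta A p q c) = delta A p q (hor_proj A w p q c))"
proof -
  interpret im_conn A K w by unfold_locales (fact assms)+
  \<comment> \<open>Vanishing off the bidegree is part of the class, so that \<open>u\<close> is
    recovered on the carrier from its cut-off \<open>cochain_of p q u\<close>.\<close>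
  define W where "W f \<longleftrightarrow> raw_weil f \<and>
    (\<forall>as bs xs. length as + length bs \<noteq> p \<or> length bs + length xs \<noteq> q \<longrightarrow> f as bs xs = 0)" for f
  \<comment> \<open>A projection exchanges an alternating argument and a vector field for a
    symmetric argument, or one symmetric argument for another; both degree sums are
    unchanged.\<close>
  have W_vdeg: "vdeg f as bs xs = 0"
    if f: "\<forall>as bs xs. length as + length bs \<noteq> p \<or> length bs + length xs \<noteq> q \<longrightarrow> f as bs xs = 0"
      and l: "length as + length bs \<noteq> p \<or> length bs + length xs \<noteq> q" for f as bs xs
  proof -
    have "asum as (\<lambda>a as. asum xs (\<lambda>x xs. f as (conn_C w a x # bs) xs)) = asum as (\<lambda>a as. asum xs (\<lambda>x xs. 0))"
      by (rule asum_cong[where V = UNIV], simp, rule asum_cong[where V = UNIV]) (use f l in auto)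
    moreover have "dsum bs (conn_v w) (\<lambda>bs. f as bs xs) = dsum bs (conn_v w) (\<lambda>_. 0)"
      by (rule dsum_cong[where V = UNIV]) (use f l in auto)
    ultimately show ?thesis by (simp add: vdeg_def)
  qed
  have Wcl: "\<And>f. W f \<Longrightarrow> tensorial {} f" "\<And>f g. W f \<Longrightarrow> W g \<Longrightarrow> W (f + g)"
      "\<And>f r. W f \<Longrightarrow> W (r *\<^sub>R f)" "\<And>f. W f \<Longrightarrow> W (vdeg f)"
    using raw_weil_good0 raw_weil_add raw_weil_scaleR raw_weil_vdeg W_vdeg unfolding W_def by (auto simp: scaleR_fun_def)
  have main: "hor_proj A w p q c \<in> weil_hor A K p q \<and>
      hor_proj A w (Suc p) q (delta A p q c) = delta A p q (hor_proj A w p q c)"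
    if c: "c \<in> weil A K p q" for c
  proof -
    have Wc: "W (raw_of c)"
      unfolding W_def using raw_of_raw_weil[OF c] raw_of_out[OF c] by blast
    have "raw_of c as bs xs = 0" if "length bs > p" for as bs xs
      by (rule raw_of_out[OF c]) (use that in auto)
    then have "\<exists>u. W u \<and> horizontal 1 u \<and>
        (\<forall>as bs xs. set as \<subseteq> S \<longrightarrow> set bs \<subseteq> S \<longrightarrow> set xs \<subseteq> V \<longrightarrow>
           hproj (raw_of c) as bs xs = u as bs xs \<and> hproj (wdelta (raw_of c)) as bs xs = wdelta u as bs xs)"
      by (intro hproj_wdelta[of W "raw_of c" p] Wcl Wc)
    then obtain u where u: "W u" "horizontal 1 u"
      and H: "\<forall>as bs xs. set as \<subseteq> S \<longrightarrow> set bs \<subseteq> S \<longrightarrow> set xs \<subseteq> V \<longrightarrow>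
           hproj (raw_of c) as bs xs = u as bs xs \<and> hproj (wdelta (raw_of c)) as bs xs = wdelta u as bs xs"
      by (elim exE conjE)
    have Hu: "hproj (raw_of c) as bs xs = u as bs xs" and Hdu: "hproj (wdelta (raw_of c)) as bs xs = wdelta u as bs xs"
      if "set as \<subseteq> S" "set bs \<subseteq> S" "set xs \<subseteq> V" for as bs xs
      using H[rule_format, OF that] by simp_all
    have carr: "set as \<subseteq> S" "set bs \<subseteq> S" "set xs \<subseteq> V" if "weil_dom A p' q k as bs xs" for p' k as bs xs
      using that by (auto simp: weil_dom_def tuples_def)
    \<comment> \<open>From here on the shuffle formula is replaced by \<open>u\<close>; outside
      \<open>weil_dom\<close> both sides are zero by convention.\<close>
    have hc: "hor_proj A w p q c = cochain_of p q u"
    proof (intro ext)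
      fix k as bs xs pt
      show "hor_proj A w p q c k as bs xs pt = cochain_of p q u k as bs xs pt"
        using hor_proj_hproj[OF Wcl(1)[OF Wc] _ refl, of p q k as bs xs] Hu carr[of p k as bs xs]
        by (cases "weil_dom A p q k as bs xs") (simp_all add: cochain_of_def hor_proj_def)
    qed
    have tu: "cochain_of p q u \<in> weil A K p q" using u(1) by (simp add: W_def cochain_of_weil)
    have "cochain_of p q u i as (\<xi> # bs) xs = 0" if "\<xi> \<in> KS" for i as bs xs \<xi>
    proof (cases "weil_dom A p q i as (\<xi> # bs) xs")
      case True
      then show ?thesis
        using horizontal_1[OF u(2) carr(1)[OF True] that _ carr(3)[OF True], of bs] carr(2)[OF True]
        by (simp add: cochain_of_def)
    qed (simp add: cochain_of_def)
    then have 1: "hor_proj A w p q c \<in> weil_hor A K p q"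
      using tu unfolding hc weil_hor_def by blast
    have r: "raw_of (delta A p q c) as bs xs = wdelta (raw_of c) as bs xs"
      if s: "set as \<subseteq> S" "set bs \<subseteq> S" "set xs \<subseteq> V" for as bs xs
    proof (cases "weil_dom A (Suc p) q (length bs) as bs xs")
      case True
      then show ?thesis using delta_wdelta[OF c True] by (simp add: raw_of_def)
    next
      case False
      then have l: "length as + length bs \<noteq> Suc p \<or> length bs + length xs \<noteq> q"
        using s by (auto simp: weil_dom_def tuples_def)
      \<comment> \<open>Both shapes at which \<open>wdelta\<close> evaluates its cochain lower the
        first degree sum by one and keep the second, so they miss \<open>(p, q)\<close> too.\<close>
      have "wdelta (raw_of c) as bs xs = 0"
      proof (rule wdelta_support[of "\<lambda>n m l. n + m = p \<and> m + l = q"])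
        show "raw_of c as bs xs = 0" if "\<not> (length as + length bs = p \<and> length bs + length xs = q)" for as bs xs
          by (rule raw_of_out[OF c]) (use that in blast)
      qed (use l s in \<open>auto simp: neq_Nil_conv\<close>)
      then show ?thesis using False by (simp add: raw_of_def delta_def fun_eq_iff)
    qed
    have gr: "tensorial {} (wdelta (raw_of c))" by (rule tensorial_wdelta[OF Wcl(1)[OF Wc]])
    have ru: "raw_of (cochain_of p q u) as bs xs = u as bs xs"
      if s: "set as \<subseteq> S" "set bs \<subseteq> S" "set xs \<subseteq> V" for as bs xs
    proof (cases "weil_dom A p q (length bs) as bs xs")
      case False
      then have "length as + length bs \<noteq> p \<or> length bs + length xs \<noteq> q"
        using s by (auto simp: weil_dom_def tuples_def)
      then have "u as bs xs = 0" using u(1) unfolding W_def by blast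
      then show ?thesis using False by (simp add: raw_of_def cochain_of_def fun_eq_iff)
    qed (simp add: raw_of_def cochain_of_def)
    have "hor_proj A w (Suc p) q (delta A p q c) = delta A p q (cochain_of p q u)"
    proof (intro ext)
      fix k as bs xs pt
      show "hor_proj A w (Suc p) q (delta A p q c) k as bs xs pt = delta A p q (cochain_of p q u) k as bs xs pt"
      proof (cases "weil_dom A (Suc p) q k as bs xs")
        case True
        note s = carr[OF True]
        have "hor_proj A w (Suc p) q (delta A p q c) k as bs xs = hproj (wdelta (raw_of c)) as bs xs"
          by (rule hor_proj_hproj[OF gr True r])
        also have "\<dots> = wdelta (raw_of (cochain_of p q u)) as bs xs"
          unfolding Hdu[OF s] by (rule wdelta_cong[OF ru[symmetric] s])
        finally show ?thesis by (simp add: delta_wdelta[OF tu True])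
      qed (simp add: hor_proj_def delta_def)
    qed
    then show ?thesis using 1 hc by simp
  qed
  then show ?thesis by blast
qed

end
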